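(* Let $G$ be a countable graph, let $v_1,v_2,\ldots$ be an enumeration of the vertices of $G$, and for every edge $v_iv_j$ let $\ell'(v_iv_j)=\frac12(\ell_i+\ell_j)$, where $(\ell_i)_{i\in\mathbb{N}}$ is a sequence of positive real numbers with $\sum_i\ell_i<\infty$. Then $|G|_{\ell'}\approx MTOP(G)$; that is, the identity on $G$ extends to a homeomorphism between $|G|_{\ell'}$ and $MTOP(G)$.
   Context: A graph $G$ is viewed as a 1-complex: each edge is a homeomorphic copy of the real unit interval. Given $\ell:E(G)\to\mathbb{R}_{>0}$, fix for each edge $e$ a homeomorphism $\sigma_e:e\to[0,\ell(e)]$. A half-edge is a connected subset $f$ of an edge $e$; if its endpoints are $a,b$, its length is $|\sigma_e(a)-\sigma_e(b)|$. For points $x,y$ of $G$ let $d_\ell(x,y)=\inf\{\ell(P): P \text{ is an } x\text{--}y \text{ arc in the 1-complex } G\}$, where $\ell(P)$ is the sum of the lengths of the edges and maximal half-edges in $P$. Identifying any two vertices $x,x'$ with $d_\ell(x,x')=0$ yields a metric space $(\overline{G},d_\ell)$, and $|G|_\ell$ denotes its completion. A ray is a 1-way infinite path. Two rays are vertex-equivalent if no finite set of vertices separates them; the classes are the vertex-ends, and $\Omega(G)$ denotes the set of vertex-ends. $MTOP(G)$ is the space $G\cup\Omega(G)$ with the following topology: each edge is a copy of $[0,1]$ bearing the corresponding metric and topology (so open subsets of edge interiors are open); the basic open neighbourhoods of a vertex $v$ are the open stars of radius $\varepsilon$ centred at $v$, for $0<\varepsilon<1$; for a vertex-end $\omega$ the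 sets $C(S,\omega)\cup\Omega(S,\omega)\cup \mathring{E}_\varepsilon(S,\omega)$ are open, where $S\subseteq V(G)$ is finite, $C(S,\omega)$ is the unique component of $G-S$ containing a ray in $\omega$, $\Omega(S,\omega)$ is the set of vertex-ends having a ray in $C(S,\omega)$, and $\mathring{E}_\varepsilon(S,\omega)$ is the set of all inner points of $S$--$C(S,\omega)$ edges at distance less than $\varepsilon$ from their endpoint in $C(S,\omega)$. *)

theory Defs
  imports "HOL-Analysis.Analysis"
begin

section \<open>Graphs and the 1-complex of a graph\<close>

text \<open>Graphs are simple and undirected: edges are 2-element sets of vertices.\<close>

definition ugraph :: "'a set \<Rightarrow> 'a set set \<Rightarrow> bool" where
  "ugraph V E \<longleftrightarrow> (\<forall>e\<in>E. e \<subseteq> V \<and> card e = 2)"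

text \<open>
  A point of the 1-complex is given by its barycentric coordinates: a vertex \<open>v\<close> has coordinate 1
  at \<open>v\<close>, and the point at distance \<open>t\<close> from \<open>u\<close> on the unit-interval copy \<open>{u, v}\<close> has
  coordinate \<open>1 - t\<close> at \<open>u\<close> and \<open>t\<close> at \<open>v\<close>. Thus on an edge containing \<open>v\<close>, the distance of
  \<open>p\<close> from \<open>v\<close> in the metric of \<open>[0,1]\<close> is \<open>1 - p v\<close>.
\<close>

type_synonym 'a point = "'a \<Rightarrow> real"

definition supp :: "'a point \<Rightarrow> 'a set" where
  "supp p = {w. p w \<noteq> 0}"

definition vertex_point :: "'a \<Rightarrow> 'a point" where
  "vertex_point v = (\<lambda>w. if w = v then 1 else 0)"

definition edge_point :: "'a \<Rightarrow> 'a \<Rightarrow> real \<Rightarrow> 'a point" where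
  "edge_point u v t = (\<lambda>w. if w = u then 1 - t else if w = v then t else 0)"

definition points :: "'a set \<Rightarrow> 'a set set \<Rightarrow> 'a point set" where
  "points V E = {p. (\<forall>w. 0 \<le> p w) \<and> (supp p \<in> E \<or> (\<exists>v\<in>V. supp p = {v})) \<and> sum p (supp p) = 1}"

definition edge_set :: "'a set \<Rightarrow> 'a set set \<Rightarrow> 'a set \<Rightarrow> 'a point set" where
  "edge_set V E e = {p \<in> points V E. supp p \<subseteq> e}"

text \<open>The topology of the 1-complex is the CW (weak) topology.\<close>

definition complex_open :: "'a set \<Rightarrow> 'a set set \<Rightarrow> 'a point set \<Rightarrow> bool" where
  "complex_open V E U \<longleftrightarrow> U \<subseteq> points V E \<and>
     (\<forall>u v. {u, v} \<in> E \<longrightarrow>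
        openin (top_of_set {0..1}) {t \<in> {0..1}. edge_point u v t \<in> U})"

definition complex_top :: "'a set \<Rightarrow> 'a set set \<Rightarrow> 'a point topology" where
  "complex_top V E = topology (complex_open V E)"

lemma istopology_complex_open: "istopology (complex_open V E)"
  unfolding istopology_def
proof (intro conjI allI impI)
  fix S T assume S: "complex_open V E S" and T: "complex_open V E T"
  have "{t \<in> {0..1}. edge_point u v t \<in> S \<inter> T} =
      {t \<in> {0..1}. edge_point u v t \<in> S} \<inter> {t \<in> {0..1}. edge_point u v t \<in> T}" for u v
    by auto
  with S T show "complex_open V E (S \<inter> T)"
    unfolding complex_open_def by (auto intro!: openin_Int)
next
  fix K assume K: "\<forall>U\<in>K. complex_open V E U"
  have "{t \<in> {0..1}. edge_point u v t \<in> \<Union>K} =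
      \<Union>((\<lambda>U. {t \<in> {0..1}. edge_point u v t \<in> U}) ` K)" for u v
    by auto
  with K show "complex_open V E (\<Union>K)"
    unfolding complex_open_def by (auto simp del: UN_simps intro!: openin_Union)
qed

lemma openin_complex_top: "openin (complex_top V E) U \<longleftrightarrow> complex_open V E U"
  by (simp add: complex_top_def istopology_complex_open)


section \<open>The distance induced by edge lengths\<close>

text \<open>
  For an edge \<open>e\<close>, \<open>edge_coord l e\<close> is the map \<open>\<sigma>\<^sub>e\<close> from \<open>e\<close> onto \<open>[0, l e]\<close>. It is the rescaling of
  the identification of \<open>e\<close> with the unit interval; which endpoint is sent to 0 is irrelevant.
\<close>

definition edge_coord :: "('a set \<Rightarrow> real) \<Rightarrow> 'a set \<Rightarrow> 'a point \<Rightarrow> real" where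
  "edge_coord l e p = l e * p (SOME u. u \<in> e)"

definition half_edges :: "'a set \<Rightarrow> 'a set set \<Rightarrow> 'a set \<Rightarrow> 'a point set set" where
  "half_edges V E e = {f. f \<noteq> {} \<and> f \<subseteq> edge_set V E e \<and> connectedin (complex_top V E) f}"

text \<open>
  The image of a half-edge under \<open>\<sigma>\<^sub>e\<close> is an interval, so the values of \<open>\<sigma>\<^sub>e\<close> at its endpoints are
  the supremum and the infimum of the image.
\<close>

definition half_edge_length :: "('a set \<Rightarrow> real) \<Rightarrow> 'a set \<Rightarrow> 'a point set \<Rightarrow> real" where
  "half_edge_length l e f = Sup (edge_coord l e ` f) - Inf (edge_coord l e ` f)"

definition max_half_edges ::
    "'a set \<Rightarrow> 'a set set \<Rightarrow> 'a point set \<Rightarrow> 'a set \<Rightarrow> 'a point set set" where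
  "max_half_edges V E P e =
     {f \<in> half_edges V E e. f \<subseteq> P \<and> (\<forall>f'\<in>half_edges V E e. f \<subseteq> f' \<and> f' \<subseteq> P \<longrightarrow> f' = f)}"

text \<open>
  An edge contained in \<open>P\<close> is itself a maximal half-edge in \<open>P\<close>, of length \<open>l e\<close>, so the sum of the
  lengths of the edges and maximal half-edges in \<open>P\<close> is a single sum. Half-edges consisting of one
  vertex may be counted for several edges, but they have length 0.
\<close>

definition arc_length ::
    "'a set \<Rightarrow> 'a set set \<Rightarrow> ('a set \<Rightarrow> real) \<Rightarrow> 'a point set \<Rightarrow> ennreal" where
  "arc_length V E l P =
     (\<Sum>\<^sub>\<infinity>(e, f)\<in>Sigma E (max_half_edges V E P). ennreal (half_edge_length l e f))"

text \<open>For \<open>x = y\<close> the only arc is the trivial one.\<close>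

definition arcs_between :: "'b topology \<Rightarrow> 'b \<Rightarrow> 'b \<Rightarrow> 'b set set" where
  "arcs_between X x y =
     {g ` {0..1} | g. pathin X g \<and> inj_on g {0..1} \<and> g 0 = x \<and> g 1 = y} \<union>
     (if x = y then {{x}} else {})"

text \<open>The distance is \<open>\<infinity>\<close> between points of different components of the graph.\<close>

definition dist_len ::
    "'a set \<Rightarrow> 'a set set \<Rightarrow> ('a set \<Rightarrow> real) \<Rightarrow> 'a point \<Rightarrow> 'a point \<Rightarrow> ennreal" where
  "dist_len V E l x y = (INF P\<in>arcs_between (complex_top V E) x y. arc_length V E l P)"

definition vertex_ident ::
    "'a set \<Rightarrow> 'a set set \<Rightarrow> ('a set \<Rightarrow> real) \<Rightarrow> ('a point \<times> 'a point) set" where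
  "vertex_ident V E l = {(x, y). x \<in> points V E \<and> y \<in> points V E \<and>
     (x = y \<or> (x \<in> vertex_point ` V \<and> y \<in> vertex_point ` V \<and> dist_len V E l x y = 0))}"

definition Gbar :: "'a set \<Rightarrow> 'a set set \<Rightarrow> ('a set \<Rightarrow> real) \<Rightarrow> 'a point set set" where
  "Gbar V E l = points V E // vertex_ident V E l"

text \<open>The infimum is over pairs of representatives, which all have the same distance.\<close>

definition Gbar_dist ::
    "'a set \<Rightarrow> 'a set set \<Rightarrow> ('a set \<Rightarrow> real) \<Rightarrow> 'a point set \<Rightarrow> 'a point set \<Rightarrow> ennreal" where
  "Gbar_dist V E l A B = (INF x\<in>A. INF y\<in>B. dist_len V E l x y)"


section \<open>Completion of an extended metric space\<close>

definition cauchy_seqs :: "'b set \<Rightarrow> ('b \<Rightarrow> 'b \<Rightarrow> ennreal) \<Rightarrow> (nat \<Rightarrow> 'b) set" where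
  "cauchy_seqs M d =
     {s. range s \<subseteq> M \<and> (\<forall>\<epsilon>>0. \<exists>N. \<forall>m\<ge>N. \<forall>n\<ge>N. d (s m) (s n) < \<epsilon>)}"

definition cauchy_equiv ::
    "'b set \<Rightarrow> ('b \<Rightarrow> 'b \<Rightarrow> ennreal) \<Rightarrow> ((nat \<Rightarrow> 'b) \<times> (nat \<Rightarrow> 'b)) set" where
  "cauchy_equiv M d = {(s, t). s \<in> cauchy_seqs M d \<and> t \<in> cauchy_seqs M d \<and>
     (\<lambda>n. d (s n) (t n)) \<longlonglongrightarrow> 0}"

definition completion :: "'b set \<Rightarrow> ('b \<Rightarrow> 'b \<Rightarrow> ennreal) \<Rightarrow> (nat \<Rightarrow> 'b) set set" where
  "completion M d = cauchy_seqs M d // cauchy_equiv M d"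

definition completion_dist ::
    "('b \<Rightarrow> 'b \<Rightarrow> ennreal) \<Rightarrow> (nat \<Rightarrow> 'b) set \<Rightarrow> (nat \<Rightarrow> 'b) set \<Rightarrow> ennreal" where
  "completion_dist d A B = (THE c. \<forall>s\<in>A. \<forall>t\<in>B. (\<lambda>n. d (s n) (t n)) \<longlonglongrightarrow> c)"

definition completion_embed ::
    "'b set \<Rightarrow> ('b \<Rightarrow> 'b \<Rightarrow> ennreal) \<Rightarrow> 'b \<Rightarrow> (nat \<Rightarrow> 'b) set" where
  "completion_embed M d x = cauchy_equiv M d `` {\<lambda>_. x}"

definition emetric_open :: "'c set \<Rightarrow> ('c \<Rightarrow> 'c \<Rightarrow> ennreal) \<Rightarrow> 'c set \<Rightarrow> bool" where
  "emetric_open M d U \<longleftrightarrow> U \<subseteq> M \<and> (\<forall>x\<in>U. \<exists>\<epsilon>>0. {y \<in> M. d x y < \<epsilon>} \<subseteq> U)"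

definition emetric_top :: "'c set \<Rightarrow> ('c \<Rightarrow> 'c \<Rightarrow> ennreal) \<Rightarrow> 'c topology" where
  "emetric_top M d = topology (emetric_open M d)"

lemma istopology_emetric_open: "istopology (emetric_open M d)"
  unfolding istopology_def
proof (intro conjI allI impI)
  fix S T assume S: "emetric_open M d S" and T: "emetric_open M d T"
  show "emetric_open M d (S \<inter> T)"
    unfolding emetric_open_def
  proof (intro conjI ballI)
    show "S \<inter> T \<subseteq> M" using S by (auto simp: emetric_open_def)
    fix x assume x: "x \<in> S \<inter> T"
    obtain a where a: "a > 0" "{y \<in> M. d x y < a} \<subseteq> S"
      using S x unfolding emetric_open_def by blast
    obtain b where b: "b > 0" "{y \<in> M. d x y < b} \<subseteq> T"
      using T x unfolding emetric_open_def by blast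
    from a b show "\<exists>\<epsilon>>0. {y \<in> M. d x y < \<epsilon>} \<subseteq> S \<inter> T"
      by (intro exI[of _ "min a b"]) auto
  qed
next
  fix K assume "\<forall>U\<in>K. emetric_open M d U"
  then show "emetric_open M d (\<Union>K)"
    unfolding emetric_open_def by (meson Sup_least Union_iff Union_upper subset_trans)
qed

lemma openin_emetric_top: "openin (emetric_top M d) U \<longleftrightarrow> emetric_open M d U"
  by (simp add: emetric_top_def istopology_emetric_open)


section \<open>The completed space of a graph with edge lengths\<close>

definition len_space ::
    "'a set \<Rightarrow> 'a set set \<Rightarrow> ('a set \<Rightarrow> real) \<Rightarrow> (nat \<Rightarrow> 'a point set) set topology" where
  "len_space V E l = emetric_top (completion (Gbar V E l) (Gbar_dist V E l))
                                 (completion_dist (Gbar_dist V E l))"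

definition len_embed ::
    "'a set \<Rightarrow> 'a set set \<Rightarrow> ('a set \<Rightarrow> real) \<Rightarrow> 'a point \<Rightarrow> (nat \<Rightarrow> 'a point set) set" where
  "len_embed V E l x =
     completion_embed (Gbar V E l) (Gbar_dist V E l) (vertex_ident V E l `` {x})"


section \<open>Vertex-ends and \<open>MTOP\<close>\<close>

definition adj_minus :: "'a set \<Rightarrow> 'a set set \<Rightarrow> 'a set \<Rightarrow> ('a \<times> 'a) set" where
  "adj_minus V E S = {(x, y). x \<in> V - S \<and> y \<in> V - S \<and> {x, y} \<in> E}"

text \<open>Vertex sets of the components of \<open>G - S\<close>.\<close>

definition comps_minus :: "'a set \<Rightarrow> 'a set set \<Rightarrow> 'a set \<Rightarrow> 'a set set" where
  "comps_minus V E S = {(adj_minus V E S)\<^sup>* `` {x} | x. x \<in> V - S}"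

text \<open>A ray is represented by its sequence of vertices, beginning at its first vertex.\<close>

definition rays :: "'a set \<Rightarrow> 'a set set \<Rightarrow> (nat \<Rightarrow> 'a) set" where
  "rays V E = {r. range r \<subseteq> V \<and> inj r \<and> (\<forall>n. {r n, r (Suc n)} \<in> E)}"

definition separates :: "'a set \<Rightarrow> 'a set set \<Rightarrow> 'a set \<Rightarrow> 'a set \<Rightarrow> 'a set \<Rightarrow> bool" where
  "separates V E S A B \<longleftrightarrow> \<not> (\<exists>a\<in>A - S. \<exists>b\<in>B - S. (a, b) \<in> (adj_minus V E S)\<^sup>*)"

definition end_equiv :: "'a set \<Rightarrow> 'a set set \<Rightarrow> ((nat \<Rightarrow> 'a) \<times> (nat \<Rightarrow> 'a)) set" where
  "end_equiv V E = {(r, r'). r \<in> rays V E \<and> r' \<in> rays V E \<and>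
     \<not> (\<exists>S. finite S \<and> S \<subseteq> V \<and> separates V E S (range r) (range r'))}"

definition vertex_ends :: "'a set \<Rightarrow> 'a set set \<Rightarrow> (nat \<Rightarrow> 'a) set set" where
  "vertex_ends V E = rays V E // end_equiv V E"

definition end_comp :: "'a set \<Rightarrow> 'a set set \<Rightarrow> 'a set \<Rightarrow> (nat \<Rightarrow> 'a) set \<Rightarrow> 'a set" where
  "end_comp V E S \<omega> = (THE C. C \<in> comps_minus V E S \<and> (\<exists>r\<in>\<omega>. range r \<subseteq> C))"

datatype 'a mpoint = Pt "'a point" | VEnd "(nat \<Rightarrow> 'a) set"

text \<open>Images in \<open>MTOP\<close> of open subsets of the interior of an edge.\<close>

definition mtop_edge_opens :: "'a set \<Rightarrow> 'a set set \<Rightarrow> 'a mpoint set set" where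
  "mtop_edge_opens V E =
     {Pt ` edge_point u v ` T | u v T. {u, v} \<in> E \<and> open T \<and> T \<subseteq> {0<..<1}}"

definition open_star :: "'a set \<Rightarrow> 'a set set \<Rightarrow> 'a \<Rightarrow> real \<Rightarrow> 'a point set" where
  "open_star V E v \<epsilon> = {p \<in> points V E. 1 - p v < \<epsilon>}"

text \<open>
  The three parts are the component as a subset of the 1-complex, the inner points of edges
  between \<open>S\<close> and the component that are close to the component, and the ends of the component.
\<close>

definition end_nbhd ::
    "'a set \<Rightarrow> 'a set set \<Rightarrow> 'a set \<Rightarrow> (nat \<Rightarrow> 'a) set \<Rightarrow> real \<Rightarrow> 'a mpoint set" where
  "end_nbhd V E S \<omega> \<epsilon> =
     (let C = end_comp V E S \<omega> in
        Pt ` {p \<in> points V E. supp p \<subseteq> C} \<union>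
        Pt ` {p \<in> points V E. \<exists>s\<in>S. \<exists>c\<in>C. {s, c} \<in> E \<and> supp p = {s, c} \<and> 1 - p c < \<epsilon>} \<union>
        VEnd ` {\<omega>' \<in> vertex_ends V E. \<exists>r\<in>\<omega>'. range r \<subseteq> C})"

definition MTOP :: "'a set \<Rightarrow> 'a set set \<Rightarrow> 'a mpoint topology" where
  "MTOP V E = topology_generated_by
     (mtop_edge_opens V E \<union>
      {Pt ` open_star V E v \<epsilon> | v \<epsilon>. v \<in> V \<and> 0 < \<epsilon> \<and> \<epsilon> < 1} \<union>
      {end_nbhd V E S \<omega> \<epsilon> | S \<omega> \<epsilon>.
         finite S \<and> S \<subseteq> V \<and> \<omega> \<in> vertex_ends V E \<and> 0 < \<epsilon>})"

end

theory Submission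
  imports Defs
begin

text \<open>
Give the vertex \<open>v i\<close> the weight \<open>w (v i) = l i\<close>, so that an edge \<open>{x, y}\<close> has length
  \<open>(w x + w y) / 2\<close>, and let \<open>d\<close> be the distance induced by these lengths. The weights control
  \<open>d\<close> from both sides.

  From below: every edge at \<open>v\<close> has length at least \<open>w v / 2\<close>. If \<open>S\<close> is a finite set of vertices
  and \<open>C\<close> a component of \<open>G - S\<close>, then every edge leaving \<open>C\<close> ends in \<open>S\<close>, so the lengths of these
  edges are bounded away from 0, even if there are infinitely many of them. Hence the sum of the
  barycentric coordinates in \<open>C\<close> is, up to a factor, 1-Lipschitz for \<open>d\<close> (\<open>component_bound\<close>). The
  same holds for a single coordinate (\<open>coordinate_bound\<close>). It follows that the open stars and the
  basic neighbourhoods of vertex-ends are open in the metric, and that vertex-ends, being separated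
  by finite sets, have positive distance from each other and from the points of \<open>G\<close>.

  From above: a path avoiding \<open>S\<close> is at most as long as the sum of the weights outside \<open>S\<close>, so two
  vertices in one component of \<open>G - S\<close> are at most that far apart (\<open>component_diameter\<close>). By
  summability this bound is arbitrarily small for suitable finite \<open>S\<close>. It follows that rays are
  Cauchy sequences, that equivalent rays have the same limit, and that a metric ball around a
  vertex-end contains a basic neighbourhood of it (\<open>ball_contains_MTOP_open\<close>).

  What remains is that the points of \<open>G\<close> and the vertex-ends exhaust the completion
  (\<open>cauchy_has_limit\<close>). Each barycentric coordinate converges along a Cauchy sequence. If some limit
  is positive, then the sequence converges to a vertex or to an inner point of an edge. Otherwise the
  sequence leaves the neighbourhood of every finite vertex set \<open>S\<close>, is asymptotic to a sequence of
  vertices, and for each \<open>S\<close> this sequence is eventually in one component of \<open>G - S\<close>. A ray that is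
  eventually in all these components (\<open>ray_through_components\<close>) represents the limit.

  The distance is an infimum over topological arcs, and two facts about arcs are needed. The triangle
  inequality (\<open>dist_len_triangle\<close>) holds because the length of an arc is the sum over all edges of
  the scaled Lebesgue measure of its intersection with the edge (\<open>arc_length_path\<close>), which is
  subadditive. All lower bounds come from \<open>dist_len_Lipschitz\<close>: a function that is Lipschitz along
  every edge is Lipschitz for \<open>d\<close>.
\<close>

section \<open>Extended nonnegative reals\<close>

lemma infsum_ennreal_le:
  fixes f :: "'b \<Rightarrow> ennreal"
  assumes "\<And>F. finite F \<Longrightarrow> F \<subseteq> A \<Longrightarrow> sum f F \<le> c"
  shows "infsum f A \<le> c"
  by (subst nonneg_infsum_complete) (auto intro!: SUP_least assms)

lemma sum_le_infsum_ennreal: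
  fixes f :: "'b \<Rightarrow> ennreal"
  assumes "finite F" "F \<subseteq> A"
  shows "sum f F \<le> infsum f A"
  by (subst nonneg_infsum_complete) (auto intro!: SUP_upper assms)

lemma infsum_Sigma_ennreal:
  fixes f :: "'b \<times> 'c \<Rightarrow> ennreal"
  shows "infsum f (Sigma A B) = (\<Sum>\<^sub>\<infinity>x\<in>A. \<Sum>\<^sub>\<infinity>y\<in>B x. f (x, y))"
proof (rule antisym)
  show "infsum f (Sigma A B) \<le> (\<Sum>\<^sub>\<infinity>x\<in>A. \<Sum>\<^sub>\<infinity>y\<in>B x. f (x, y))"
  proof (rule infsum_ennreal_le)
    fix F assume F: "finite F" "F \<subseteq> Sigma A B"
    have "F = Sigma (fst ` F) (\<lambda>x. {y. (x, y) \<in> F})"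
      by force
    then have "sum f F = (\<Sum>(x, y)\<in>Sigma (fst ` F) (\<lambda>x. {y. (x, y) \<in> F}). f (x, y))"
      by simp
    also have "\<dots> = (\<Sum>x\<in>fst ` F. \<Sum>y\<in>{y. (x, y) \<in> F}. f (x, y))"
    proof (rule sum.Sigma[symmetric])
      show "\<forall>x\<in>fst ` F. finite {y. (x, y) \<in> F}"
      proof
        fix x
        have "{y. (x, y) \<in> F} \<subseteq> snd ` F" by force
        then show "finite {y. (x, y) \<in> F}" using F(1) finite_subset by blast
      qed
    qed (use F in auto)
    also have "\<dots> \<le> (\<Sum>x\<in>fst ` F. \<Sum>\<^sub>\<infinity>y\<in>B x. f (x, y))"
    proof (intro sum_mono sum_le_infsum_ennreal)
      fix x
      have "{y. (x, y) \<in> F} \<subseteq> snd ` F" by force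
      then show "finite {y. (x, y) \<in> F}" using F(1) finite_subset by blast
    qed (use F in auto)
    also have "\<dots> \<le> (\<Sum>\<^sub>\<infinity>x\<in>A. \<Sum>\<^sub>\<infinity>y\<in>B x. f (x, y))"
      by (rule sum_le_infsum_ennreal) (use F in auto)
    finally show "sum f F \<le> (\<Sum>\<^sub>\<infinity>x\<in>A. \<Sum>\<^sub>\<infinity>y\<in>B x. f (x, y))" .
  qed
next
  show "(\<Sum>\<^sub>\<infinity>x\<in>A. \<Sum>\<^sub>\<infinity>y\<in>B x. f (x, y)) \<le> infsum f (Sigma A B)"
  proof (rule infsum_ennreal_le)
    fix H assume H: "finite H" "H \<subseteq> A"
    have "(\<Sum>x\<in>H. \<Sum>\<^sub>\<infinity>y\<in>B x. f (x, y)) = infsum f (Sigma H B)"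
      using H(1)
    proof induction
      case (insert x H)
      have "Sigma (insert x H) B = Pair x ` B x \<union> Sigma H B" by auto
      moreover have "infsum f (Pair x ` B x \<union> Sigma H B) = infsum f (Pair x ` B x) + infsum f (Sigma H B)"
        using insert by (intro infsum_Un_disjoint nonneg_summable_on_complete) auto
      moreover have "infsum f (Pair x ` B x) = (\<Sum>\<^sub>\<infinity>y\<in>B x. f (x, y))"
        by (subst infsum_reindex) (auto simp: o_def inj_on_def)
      ultimately show ?case using insert by simp
    qed auto
    also have "\<dots> \<le> infsum f (Sigma A B)"
      by (rule infsum_mono_neutral) (use H in \<open>auto intro: nonneg_summable_on_complete\<close>)
    finally show "(\<Sum>x\<in>H. \<Sum>\<^sub>\<infinity>y\<in>B x. f (x, y)) \<le> infsum f (Sigma A B)" .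
  qed
qed

lemma emeasure_UN_le_infsum:
  assumes "countable K" "\<And>k. k \<in> K \<Longrightarrow> A k \<in> sets M"
  shows "emeasure M (\<Union>k\<in>K. A k) \<le> (\<Sum>\<^sub>\<infinity>k\<in>K. emeasure M (A k))"
proof (cases "finite K")
  case True
  then show ?thesis using assms by (auto intro: emeasure_subadditive_finite)
next
  case False
  define g where "g = from_nat_into K"
  have g: "bij_betw g UNIV K" using False assms(1) g_def bij_betw_from_nat_into by blast
  then have gK: "\<And>n. g n \<in> K" using bij_betwE by blast
  have "(\<Union>k\<in>K. A k) = (\<Union>n. A (g n))" using g by (auto simp: bij_betw_def)
  also have "emeasure M \<dots> \<le> (\<Sum>n. emeasure M (A (g n)))"
    by (rule emeasure_subadditive_countably) (use gK assms(2) in auto)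
  also have "\<dots> \<le> (\<Sum>\<^sub>\<infinity>k\<in>K. emeasure M (A k))"
  proof (rule suminf_le_const)
    fix n
    have "(\<Sum>i<n. emeasure M (A (g i))) = (\<Sum>k\<in>g ` {..<n}. emeasure M (A k))"
      by (subst sum.reindex) (use g in \<open>auto simp: bij_betw_def inj_on_def\<close>)
    also have "\<dots> \<le> (\<Sum>\<^sub>\<infinity>k\<in>K. emeasure M (A k))"
      by (rule sum_le_infsum_ennreal) (use gK in auto)
    finally show "(\<Sum>i<n. emeasure M (A (g i))) \<le> (\<Sum>\<^sub>\<infinity>k\<in>K. emeasure M (A k))" .
  qed auto
  finally show ?thesis .
qed

lemma le_INF_add_INF:
  fixes f :: "'b \<Rightarrow> ennreal" and g :: "'c \<Rightarrow> ennreal"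
  assumes "\<And>p q. p \<in> A \<Longrightarrow> q \<in> B \<Longrightarrow> c \<le> f p + g q"
  shows "c \<le> (INF p\<in>A. f p) + (INF q\<in>B. g q)"
proof (rule ennreal_le_epsilon)
  fix \<epsilon> :: real
  assume fin: "(INF p\<in>A. f p) + (INF q\<in>B. g q) < top" and \<epsilon>: "0 < \<epsilon>"
  have less: "x < x + ennreal (\<epsilon> / 2)" if "x < top" for x
    using that \<epsilon> by (cases x) (auto simp: ennreal_plus[symmetric] ennreal_less_iff simp del: ennreal_plus)
  have "(INF p\<in>A. f p) < (INF p\<in>A. f p) + ennreal (\<epsilon> / 2)"
    by (rule less) (use fin in auto)
  then obtain p where p: "p \<in> A" "f p < (INF p\<in>A. f p) + ennreal (\<epsilon> / 2)"
    unfolding INF_less_iff by blast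
  have "(INF q\<in>B. g q) < (INF q\<in>B. g q) + ennreal (\<epsilon> / 2)"
    by (rule less) (use fin in auto)
  then obtain q where q: "q \<in> B" "g q < (INF q\<in>B. g q) + ennreal (\<epsilon> / 2)"
    unfolding INF_less_iff by blast
  have "c \<le> f p + g q" using assms p q by blast
  also have "\<dots> \<le> ((INF p\<in>A. f p) + ennreal (\<epsilon> / 2)) + ((INF q\<in>B. g q) + ennreal (\<epsilon> / 2))"
    using p q by (intro add_mono) auto
  also have "\<dots> = (INF p\<in>A. f p) + (INF q\<in>B. g q) + (ennreal (\<epsilon> / 2) + ennreal (\<epsilon> / 2))"
    by (simp add: ac_simps)
  also have "ennreal (\<epsilon> / 2) + ennreal (\<epsilon> / 2) = ennreal \<epsilon>"
    using \<epsilon> by (simp add: ennreal_plus[symmetric] del: ennreal_plus)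
  finally show "c \<le> (INF p\<in>A. f p) + (INF q\<in>B. g q) + ennreal \<epsilon>" .
qed

lemma ennreal_positive_real:
  assumes "(0::ennreal) < a"
  obtains \<epsilon> :: real where "0 < \<epsilon>" "ennreal \<epsilon> < a"
proof (cases a)
  case (real r)
  then have "0 < r" using assms by simp
  then show ?thesis using that[of "r / 2"] real by (simp add: ennreal_less_iff)
next
  case top
  then show ?thesis using that[of 1] by simp
qed

lemma tendsto_zero_ennrealI:
  fixes f :: "nat \<Rightarrow> ennreal"
  assumes "\<And>\<epsilon>::real. 0 < \<epsilon> \<Longrightarrow> \<forall>\<^sub>F n in sequentially. f n \<le> ennreal \<epsilon>"
  shows "f \<longlonglongrightarrow> 0"
proof (rule order_tendstoI)
  fix a :: ennreal assume "0 < a"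
  then obtain \<epsilon> :: real where \<epsilon>: "0 < \<epsilon>" "ennreal \<epsilon> < a" by (rule ennreal_positive_real)
  show "\<forall>\<^sub>F n in sequentially. f n < a"
    using assms[OF \<epsilon>(1)] by (rule eventually_mono) (use \<epsilon>(2) in simp)
qed simp

section \<open>Arcs\<close>

lemma arcI:
  assumes ab: "a \<le> b" and g: "continuous_map (top_of_set {a..b}) X g"
    and inj: "inj_on g {a..b}"
  shows "g ` {a..b} \<in> arcs_between X (g a) (g (b::real))"
proof (cases "a = b")
  case True
  then show ?thesis by (auto simp: arcs_between_def)
next
  case False
  define r where "r = (\<lambda>t. a + (b - a) * t)"
  have ab': "a < b" using ab False by auto
  have bd: "0 \<le> (b - a) * t \<and> (b - a) * t \<le> b - a" if "0 \<le> t" "t \<le> 1" for t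
    using that ab mult_left_le[of t "b - a"] by auto
  have r: "r ` {0..1} = {a..b}"
  proof
    show "r ` {0..1} \<subseteq> {a..b}" using bd by (force simp: r_def)
    show "{a..b} \<subseteq> r ` {0..1}"
    proof
      fix s assume "s \<in> {a..b}"
      then have "r ((s - a) / (b - a)) = s" "(s - a) / (b - a) \<in> {0..1}"
        using ab' by (auto simp: r_def)
      then show "s \<in> r ` {0..1}" by force
    qed
  qed
  have "continuous_map (top_of_set {0..1}) (top_of_set {a..b}) r"
    using r by (auto simp: continuous_map_in_subtopology r_def intro!: continuous_intros)
  then have "pathin X (g \<circ> r)"
    unfolding pathin_def using continuous_map_compose g by blast
  moreover have "inj_on (g \<circ> r) {0..1}"
  proof (rule comp_inj_on)
    show "inj_on r {0..1}" using ab' by (auto simp: inj_on_def r_def)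
    show "inj_on g (r ` {0..1})" using inj r by simp
  qed
  moreover have "(g \<circ> r) ` {0..1} = g ` {a..b}" by (simp only: image_comp[symmetric] r)
  moreover have "(g \<circ> r) 0 = g a" "(g \<circ> r) 1 = g b" by (auto simp: r_def)
  ultimately show ?thesis unfolding arcs_between_def
    by (intro UnI1 CollectI exI[of _ "g \<circ> r"]) auto
qed

lemma arcs_between_cases:
  assumes "P \<in> arcs_between X x y" "x \<in> topspace X"
  obtains a b :: real and g where "a \<le> b" "continuous_map (top_of_set {a..b}) X g"
    "inj_on g {a..b}" "g a = x" "g b = y" "P = g ` {a..b}"
proof (cases "x = y \<and> P = {x}")
  case True
  then show ?thesis using assms(2) by (intro that[of 0 0 "\<lambda>_. x"]) auto
next
  case False
  then show ?thesis using assms that[of 0 1] by (auto simp: arcs_between_def pathin_def split: if_splits)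
qed

lemma arcs_between_path:
  assumes "P \<in> arcs_between X x y" "x \<in> topspace X"
  obtains g where "pathin X g" "g 0 = x" "g 1 = y" "P = g ` {0..1}"
proof (cases "x = y \<and> P = {x}")
  case True
  then show ?thesis using assms(2) by (intro that[of "\<lambda>_. x"]) (auto simp: image_constant_conv)
next
  case False
  then show ?thesis using assms that by (auto simp: arcs_between_def split: if_splits)
qed

lemma arcs_between_sym: "arcs_between X x y \<subseteq> arcs_between X y x"
proof
  fix P assume "P \<in> arcs_between X x y"
  then consider g where "pathin X g" "inj_on g {0..1}" "g 0 = x" "g 1 = y" "P = g ` {0..1}"
    | "x = y" "P = {x}"
    by (auto simp: arcs_between_def split: if_splits)
  then show "P \<in> arcs_between X y x"
  proof cases
    case 1
    have im: "(\<lambda>t::real. 1 - t) ` {0..1} = {0..1}"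
      by (auto intro!: image_eqI[where x="1 - _"])
    have "continuous_map (top_of_set {0..1}) (top_of_set {0..1}) (\<lambda>t::real. 1 - t)"
      by (auto simp: continuous_map_in_subtopology intro!: continuous_intros)
    then have "pathin X (g \<circ> (\<lambda>t. 1 - t))"
      using 1(1) continuous_map_compose unfolding pathin_def by blast
    moreover have "inj_on (g \<circ> (\<lambda>t. 1 - t)) {0..1}"
      using 1(2) im by (intro comp_inj_on) (auto simp: inj_on_def)
    moreover have "(g \<circ> (\<lambda>t. 1 - t)) ` {0..1} = P"
      by (simp only: image_comp[symmetric] im 1(5))
    ultimately show ?thesis using 1 unfolding arcs_between_def
      by (intro UnI1 CollectI exI[of _ "g \<circ> (\<lambda>t. 1 - t)"]) auto
  qed (auto simp: arcs_between_def)
qed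

text \<open>The first point of \<open>P\<close> that lies on \<open>Q\<close> is where one changes from \<open>P\<close> to \<open>Q\<close>: the part of \<open>P\<close>
  before it is disjoint from \<open>Q\<close>, so the resulting path is injective.\<close>

lemma arcs_between_join:
  assumes X: "Hausdorff_space X" and x: "x \<in> topspace X" and y: "y \<in> topspace X"
    and P: "P \<in> arcs_between X x y" and Q: "Q \<in> arcs_between X y z"
  obtains R where "R \<in> arcs_between X x z" "R \<subseteq> P \<union> Q"
proof -
  obtain a b :: real and g where g: "a \<le> b" "continuous_map (top_of_set {a..b}) X g"
    "inj_on g {a..b}" "g a = x" "g b = y" "P = g ` {a..b}"
    by (rule arcs_between_cases[OF P x]) (erule (5) that)
  obtain c d :: real and h where h: "c \<le> d" "continuous_map (top_of_set {c..d}) X h"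
    "inj_on h {c..d}" "h c = y" "h d = z" "Q = h ` {c..d}"
    by (rule arcs_between_cases[OF Q y]) (erule (5) that)
  have "compactin X Q"
    unfolding h(6) by (rule image_compactin[OF _ h(2)]) (auto simp: compactin_subtopology)
  then have clQ: "closedin X Q" using X compactin_imp_closedin by blast
  define A where "A = {t \<in> {a..b}. g t \<in> Q}"
  have "closedin (top_of_set {a..b}) A"
    using closedin_continuous_map_preimage[OF g(2) clQ] by (simp add: A_def)
  then have "compact A" using closedin_compact compact_Icc by blast
  moreover have "h c \<in> Q" using h(1,6) by simp
  then have "b \<in> A" using g(1,5) h(4) by (simp add: A_def)
  then have "A \<noteq> {}" by blast
  ultimately obtain t0 where t0: "t0 \<in> A" "\<And>t. t \<in> A \<Longrightarrow> t0 \<le> t"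
    using compact_attains_inf[of A] by metis
  obtain s0 where s0: "s0 \<in> {c..d}" "g t0 = h s0" using t0(1) h(6) by (auto simp: A_def)
  have t0ab: "a \<le> t0" "t0 \<le> b" using t0 by (auto simp: A_def)
  define m where "m = t0 + (d - s0)"
  define k where "k = (\<lambda>t. if t \<le> t0 then g t else h (s0 + (t - t0)))"
  have before: "g t \<notin> Q" if "a \<le> t" "t < t0" for t
    using t0(2)[of t] that t0ab by (force simp: A_def)
  have kh: "k t = h (s0 + (t - t0))" if "t0 \<le> t" for t
    using that s0 by (auto simp: k_def)
  have "k ` {a..m} \<in> arcs_between X (k a) (k m)"
  proof (rule arcI)
    show "a \<le> m" using t0ab s0 by (auto simp: m_def)
    have "{a..m} \<inter> {x \<in> topspace (top_of_set {a..m}). x \<le> t0} = {a..t0}"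
      "{a..m} \<inter> {x \<in> topspace (top_of_set {a..m}). t0 \<le> x} = {t0..m}"
      using t0ab s0 by (auto simp: m_def)
    then have sub: "subtopology (top_of_set {a..m}) {x \<in> topspace (top_of_set {a..m}). x \<le> t0} = top_of_set {a..t0}"
      "subtopology (top_of_set {a..m}) {x \<in> topspace (top_of_set {a..m}). t0 \<le> x} = top_of_set {t0..m}"
      by (simp_all add: subtopology_subtopology)
    show "continuous_map (top_of_set {a..m}) X k"
      unfolding k_def
    proof (rule continuous_map_cases_le)
      show "continuous_map (subtopology (top_of_set {a..m}) {x \<in> topspace (top_of_set {a..m}). x \<le> t0}) X g"
        unfolding sub by (rule continuous_map_from_subtopology_mono[OF g(2)]) (use t0ab in auto)
      have "continuous_map (top_of_set {t0..m}) (top_of_set {c..d}) (\<lambda>t. s0 + (t - t0))"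
        using s0 by (auto simp: continuous_map_in_subtopology m_def intro!: continuous_intros)
      from continuous_map_compose[OF this h(2)]
      show "continuous_map (subtopology (top_of_set {a..m}) {x \<in> topspace (top_of_set {a..m}). t0 \<le> x}) X
                 (\<lambda>t. h (s0 + (t - t0)))"
        unfolding sub o_def .
    qed (use s0 in auto)
    show "inj_on k {a..m}"
    proof (rule linorder_inj_onI')
      fix s t assume st: "s \<in> {a..m}" "t \<in> {a..m}" "s < t"
      consider "t \<le> t0" | "s < t0" "t0 < t" | "t0 \<le> s" using st by linarith
      then show "k s \<noteq> k t"
      proof cases
        case 1
        then show ?thesis using st t0ab inj_onD[OF g(3), of s t] by (auto simp: k_def)
      next
        case 2
        then have "h (s0 + (t - t0)) \<in> Q" using h(6) st s0 by (auto simp: m_def)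
        then show ?thesis using before[of s] 2 st by (auto simp: k_def)
      next
        case 3
        then show ?thesis using st s0 inj_onD[OF h(3), of "s0 + (s - t0)" "s0 + (t - t0)"]
          by (auto simp: kh m_def)
      qed
    qed
  qed
  moreover have "k a = x" using g t0ab by (auto simp: k_def)
  moreover have "k m = z" using kh[of m] s0 h(5) by (auto simp: m_def)
  moreover have "k t \<in> P \<union> Q" if "t \<in> {a..m}" for t
  proof (cases "t \<le> t0")
    case True
    then show ?thesis using that t0ab by (simp add: k_def g(6))
  next
    case False
    then have "s0 + (t - t0) \<in> {c..d}" using that s0(1) by (simp add: m_def)
    then show ?thesis using False by (simp add: k_def h(6))
  qed
  ultimately show ?thesis using that[of "k ` {a..m}"] by (simp add: image_subset_iff)
qed

section \<open>The 1-complex\<close>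

lemma edge_point_ends:
  assumes "u \<noteq> v"
  shows "edge_point u v 0 = vertex_point u" "edge_point u v 1 = vertex_point v"
  using assms by (auto simp: edge_point_def vertex_point_def)

lemma edge_point_swap: "u \<noteq> v \<Longrightarrow> edge_point u v t = edge_point v u (1 - t)"
  by (auto simp: edge_point_def)

lemma edge_point_apply:
  assumes "u \<noteq> v"
  shows "edge_point u v t v = t" "edge_point u v t u = 1 - t"
  using assms by (auto simp: edge_point_def)

lemma supp_edge_point: "u \<noteq> v \<Longrightarrow> 0 < t \<Longrightarrow> t < 1 \<Longrightarrow> supp (edge_point u v t) = {u, v}"
  by (auto simp: edge_point_def supp_def)

lemma supp_edge_point_subset: "supp (edge_point u v t) \<subseteq> {u, v}"
  by (auto simp: edge_point_def supp_def)

lemma supp_vertex_point [simp]: "supp (vertex_point v) = {v}"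
  by (auto simp: vertex_point_def supp_def)

locale graph_complex =
  fixes V :: "'a set" and E :: "'a set set"
  assumes ugraph: "ugraph V E"
begin

lemma edgeD:
  assumes "{u, v} \<in> E"
  shows "u \<in> V" "v \<in> V" "u \<noteq> v"
  using assms ugraph by (auto simp: ugraph_def)

lemma edge_cases:
  assumes "e \<in> E"
  obtains u v where "e = {u, v}" "u \<noteq> v"
  using assms ugraph by (auto simp: ugraph_def card_2_iff)

lemma vertex_point_in_points [simp]: "v \<in> V \<Longrightarrow> vertex_point v \<in> points V E"
  by (auto simp: points_def) (auto simp: vertex_point_def)

lemma edge_point_in_points:
  assumes "{u, v} \<in> E" "0 \<le> t" "t \<le> 1"
  shows "edge_point u v t \<in> points V E"
proof -
  note uv = edgeD[OF assms(1)]
  consider "t = 0" | "t = 1" | "0 < t" "t < 1" using assms by linarith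
  then show ?thesis
  proof cases
    case 3
    then have "supp (edge_point u v t) = {u, v}" using uv supp_edge_point by metis
    then show ?thesis using assms uv by (auto simp: points_def edge_point_def)
  qed (use uv edge_point_ends[OF uv(3)] in auto)
qed

lemma points_cases:
  assumes "p \<in> points V E"
  obtains (vertex) v where "v \<in> V" "p = vertex_point v"
    | (inner) u v t where "{u, v} \<in> E" "u \<noteq> v" "0 < t" "t < 1" "p = edge_point u v t"
proof -
  have p: "\<And>w. 0 \<le> p w" "sum p (supp p) = 1" "supp p \<in> E \<or> (\<exists>v\<in>V. supp p = {v})"
    using assms by (auto simp: points_def)
  from p(3) show ?thesis
  proof
    assume "supp p \<in> E"
    then obtain u v where uv: "supp p = {u, v}" "u \<noteq> v" using edge_cases by metis
    then have "p u + p v = 1" using p(2) by simp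
    moreover have "p u > 0" "p v > 0"
      using uv p(1)[of u] p(1)[of v] by (auto simp: supp_def order_less_le)
    moreover have "p = edge_point u v (p v)"
    proof
      fix w show "p w = edge_point u v (p v) w"
        using uv \<open>p u + p v = 1\<close> by (auto simp: edge_point_def supp_def)
    qed
    ultimately show ?thesis using inner[of u v "p v"] uv \<open>supp p \<in> E\<close> by auto
  next
    assume "\<exists>v\<in>V. supp p = {v}"
    then obtain v where v: "v \<in> V" "supp p = {v}" by blast
    then have "p v = 1" using p(2) by simp
    then have "p = vertex_point v" using v by (auto simp: vertex_point_def supp_def fun_eq_iff)
    then show ?thesis using vertex v by blast
  qed
qed

lemma edge_set_eq:
  assumes "{u, v} \<in> E"
  shows "edge_set V E {u, v} = edge_point u v ` {0..1}"
proof
  note uv = edgeD[OF assms]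
  show "edge_point u v ` {0..1} \<subseteq> edge_set V E {u, v}"
    using edge_point_in_points[OF assms] supp_edge_point_subset[of u v] by (auto simp: edge_set_def)
  show "edge_set V E {u, v} \<subseteq> edge_point u v ` {0..1}"
  proof
    fix p assume "p \<in> edge_set V E {u, v}"
    then have p: "p \<in> points V E" "supp p \<subseteq> {u, v}" by (auto simp: edge_set_def)
    from p(1) show "p \<in> edge_point u v ` {0..1}"
    proof (cases rule: points_cases)
      case (vertex w)
      then have "w = u \<or> w = v" using p by auto
      then have "p = edge_point u v 0 \<or> p = edge_point u v 1"
        using vertex edge_point_ends[OF uv(3)] by auto
      then show ?thesis by auto
    next
      case (inner a b t)
      then have "{a, b} = {u, v}" using p supp_edge_point[of a b t] by auto
      then have "p = edge_point u v t \<or> p = edge_point u v (1 - t)"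
        using inner edge_point_swap[of a b t] by (auto simp: doubleton_eq_iff)
      then show ?thesis using inner by auto
    qed
  qed
qed

lemma topspace_complex [simp]: "topspace (complex_top V E) = points V E"
proof
  have "complex_open V E (topspace (complex_top V E))"
    using openin_complex_top openin_topspace by metis
  then show "topspace (complex_top V E) \<subseteq> points V E" by (auto simp: complex_open_def)
  have "complex_open V E (points V E)"
    unfolding complex_open_def
  proof (intro conjI allI impI)
    fix u v assume "{u, v} \<in> E"
    then have "{t \<in> {0..1}. edge_point u v t \<in> points V E} = {0..1}"
      using edge_point_in_points by auto
    then show "openin (top_of_set {0..1}) {t \<in> {0..1}. edge_point u v t \<in> points V E}"
      by (metis openin_subtopology_self)
  qed simp
  then show "points V E \<subseteq> topspace (complex_top V E)"
    using openin_complex_top openin_subset by metis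
qed

lemma continuous_edge_point:
  assumes "{u, v} \<in> E"
  shows "continuous_map (top_of_set {0..1}) (complex_top V E) (edge_point u v)"
  using assms edge_point_in_points by (auto simp: continuous_map openin_complex_top complex_open_def)

lemma continuous_from_complex:
  fixes \<phi> :: "'a point \<Rightarrow> 'b::topological_space"
  assumes "\<And>u v. {u, v} \<in> E \<Longrightarrow> continuous_on {0..1} (\<phi> \<circ> edge_point u v)"
  shows "continuous_map (complex_top V E) euclidean \<phi>"
  unfolding continuous_map
proof (intro conjI allI impI)
  fix U :: "'b set" assume U: "openin euclidean U"
  show "openin (complex_top V E) {x \<in> topspace (complex_top V E). \<phi> x \<in> U}"
    unfolding openin_complex_top complex_open_def
  proof (intro conjI allI impI)
    fix u v assume uv: "{u, v} \<in> E"
    have "openin (top_of_set {0..1}) ({0..1} \<inter> (\<phi> \<circ> edge_point u v) -` U)"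
      using continuous_openin_preimage_gen[OF assms[OF uv]] U by simp
    also have "{0..1} \<inter> (\<phi> \<circ> edge_point u v) -` U =
        {t \<in> {0..1}. edge_point u v t \<in> {x \<in> topspace (complex_top V E). \<phi> x \<in> U}}"
      using edge_point_in_points[OF uv] by auto
    finally show "openin (top_of_set {0..1}) {t \<in> {0..1}. edge_point u v t \<in> {x \<in> topspace (complex_top V E). \<phi> x \<in> U}}" .
  qed auto
qed auto

lemma continuous_coordinate: "continuous_map (complex_top V E) euclideanreal (\<lambda>p. p w)"
proof (rule continuous_from_complex)
  fix u v assume "{u, v} \<in> E"
  show "continuous_on {0..1} ((\<lambda>p. p w) \<circ> edge_point u v)"
    by (cases "w = u"; cases "w = v") (auto simp: o_def edge_point_def intro!: continuous_intros)
qed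

lemma Hausdorff_complex: "Hausdorff_space (complex_top V E)"
  unfolding Hausdorff_space_def
proof (intro allI impI, elim conjE)
  fix x y :: "'a point"
  assume xy: "x \<in> topspace (complex_top V E)" "y \<in> topspace (complex_top V E)" "x \<noteq> y"
  then obtain w where w: "x w \<noteq> y w" by blast
  then obtain A B where AB: "open A" "open B" "x w \<in> A" "y w \<in> B" "A \<inter> B = {}"
    using hausdorff by metis
  let ?pre = "\<lambda>A. {p \<in> topspace (complex_top V E). p w \<in> A}"
  have "openin (complex_top V E) (?pre A)" "openin (complex_top V E) (?pre B)"
    using openin_continuous_map_preimage[OF continuous_coordinate[of w]] AB by auto
  then show "\<exists>U W. openin (complex_top V E) U \<and> openin (complex_top V E) W \<and> x \<in> U \<and> y \<in> W \<and> disjnt U W"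
    using AB xy by (intro exI[of _ "?pre A"] exI[of _ "?pre B"]) (auto simp: disjnt_iff)
qed

section \<open>The length of an arc\<close>

text \<open>The choice is the one made by \<open>edge_coord\<close>, so that \<open>edge_coord l e\<close> is \<open>l e\<close> times the parameter
  in the parametrization of \<open>e\<close> that ends in \<open>head e\<close>.\<close>

definition head :: "'a set \<Rightarrow> 'a" where
  "head e = (SOME u. u \<in> e)"

definition tail :: "'a set \<Rightarrow> 'a" where
  "tail e = (SOME u. u \<in> e \<and> u \<noteq> head e)"

definition param :: "'a set \<Rightarrow> real \<Rightarrow> 'a point" where
  "param e = edge_point (tail e) (head e)"

definition footprint :: "'a point set \<Rightarrow> 'a set \<Rightarrow> real set" where
  "footprint P e = {t \<in> {0..1}. param e t \<in> P}"

lemma edge_eq_tail_head: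
  assumes "e \<in> E"
  shows "e = {tail e, head e}" "tail e \<noteq> head e"
proof -
  obtain u v where uv: "e = {u, v}" "u \<noteq> v" using assms edge_cases by metis
  have h: "head e \<in> e" unfolding head_def by (rule someI_ex) (use uv in blast)
  then have "\<exists>w. w \<in> e \<and> w \<noteq> head e" using uv by (cases "head e = u") auto
  then have "tail e \<in> e \<and> tail e \<noteq> head e" unfolding tail_def by (rule someI_ex)
  with h uv show "e = {tail e, head e}" "tail e \<noteq> head e" by auto
qed

lemma tail_head_edge: "e \<in> E \<Longrightarrow> {tail e, head e} \<in> E"
  using edge_eq_tail_head(1) by metis

lemma param_head: "e \<in> E \<Longrightarrow> param e t (head e) = t"
  unfolding param_def using edge_point_apply edge_eq_tail_head(2) by metis

lemma edge_set_param: "e \<in> E \<Longrightarrow> edge_set V E e = param e ` {0..1}"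
  using edge_set_eq[OF tail_head_edge] edge_eq_tail_head(1) unfolding param_def by metis

lemma edge_coord_param: "e \<in> E \<Longrightarrow> edge_coord l e (param e t) = l e * t"
  using param_head by (simp add: edge_coord_def head_def)

lemma continuous_param:
  "e \<in> E \<Longrightarrow> continuous_map (top_of_set {0..1}) (complex_top V E) (param e)"
  unfolding param_def using continuous_edge_point tail_head_edge by blast

lemma inj_param: "e \<in> E \<Longrightarrow> inj (param e)"
  by (metis injI param_head)

text \<open>Connectedness transfers in both directions because the parametrization is continuous and
  its inverse is a barycentric coordinate, which is continuous on the whole 1-complex.\<close>

lemma half_edges_param:
  assumes e: "e \<in> E"
  shows "f \<in> half_edges V E e \<longleftrightarrow> (\<exists>T. T \<subseteq> {0..1} \<and> T \<noteq> {} \<and> connected T \<and> f = param e ` T)"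
proof
  assume f: "f \<in> half_edges V E e"
  define T where "T = (\<lambda>p. p (head e)) ` f"
  have f': "f \<noteq> {}" "f \<subseteq> param e ` {0..1}" "connectedin (complex_top V E) f"
    using f e by (auto simp: half_edges_def edge_set_param)
  have "connectedin euclideanreal T" unfolding T_def
    by (rule connectedin_continuous_map_image[OF continuous_coordinate f'(3)])
  moreover have "f = param e ` T"
    using f'(2) e by (force simp: T_def image_image param_head)
  moreover have "T \<subseteq> {0..1}" using f'(2) e by (auto simp: T_def param_head)
  moreover have "T \<noteq> {}" using f'(1) unfolding T_def by simp
  ultimately show "\<exists>T. T \<subseteq> {0..1} \<and> T \<noteq> {} \<and> connected T \<and> f = param e ` T"
    by (intro exI[of _ T]) simp
next
  assume "\<exists>T. T \<subseteq> {0..1} \<and> T \<noteq> {} \<and> connected T \<and> f = param e ` T"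
  then obtain T where T: "T \<subseteq> {0..1}" "T \<noteq> {}" "connected T" "f = param e ` T" by blast
  have "connectedin (top_of_set {0..1}) T" using T by (simp add: connectedin_subtopology)
  then have "connectedin (complex_top V E) f"
    using connectedin_continuous_map_image[OF continuous_param[OF e]] T by blast
  then show "f \<in> half_edges V E e" using T e by (auto simp: half_edges_def edge_set_param)
qed

lemma param_image_subset:
  assumes "T \<subseteq> {0..1}"
  shows "param e ` T \<subseteq> P \<longleftrightarrow> T \<subseteq> footprint P e"
  using assms by (auto simp: footprint_def)

text \<open>This moves the computation of lengths from the 1-complex to the real line.\<close>

lemma max_half_edges_eq:
  assumes e: "e \<in> E"
  shows "max_half_edges V E P e = (\<lambda>T. param e ` T) ` components (footprint P e)"
proof -
  have sub: "param e ` S \<subseteq> param e ` T \<longleftrightarrow> S \<subseteq> T" for S T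
    using inj_param[OF e] by (simp add: inj_image_subset_iff)
  have tr: "footprint P e \<subseteq> {0..1}" by (auto simp: footprint_def)
  have "f \<in> max_half_edges V E P e \<longleftrightarrow> (\<exists>T\<in>components (footprint P e). f = param e ` T)" for f
  proof
    assume "f \<in> max_half_edges V E P e"
    then have f: "f \<in> half_edges V E e" "f \<subseteq> P"
      and mx: "\<And>f'. f' \<in> half_edges V E e \<Longrightarrow> f \<subseteq> f' \<Longrightarrow> f' \<subseteq> P \<Longrightarrow> f' = f"
      by (auto simp: max_half_edges_def)
    obtain T where T: "T \<subseteq> {0..1}" "T \<noteq> {}" "connected T" "f = param e ` T"
      using f(1)[unfolded half_edges_param[OF e]] by metis
    have "T \<in> components (footprint P e)"
      unfolding in_components_maximal
    proof (intro conjI allI impI)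
      show "T \<subseteq> footprint P e" using T f(2) param_image_subset by metis
      fix D assume D: "D \<noteq> {} \<and> T \<subseteq> D \<and> D \<subseteq> footprint P e \<and> connected D"
      then have D': "D \<subseteq> {0..1}" using tr by blast
      have "param e ` D = f"
      proof (rule mx)
        show "param e ` D \<in> half_edges V E e" unfolding half_edges_param[OF e] using D D' by metis
        show "f \<subseteq> param e ` D" using D T by blast
        show "param e ` D \<subseteq> P" using D D' by (simp add: param_image_subset)
      qed
      then show "D = T" using T sub by blast
    qed (use T in auto)
    then show "\<exists>T\<in>components (footprint P e). f = param e ` T" using T by blast
  next
    assume "\<exists>T\<in>components (footprint P e). f = param e ` T"
    then obtain T where TC: "T \<in> components (footprint P e)" and fT: "f = param e ` T" by blast
    note T = TC[unfolded in_components_maximal, THEN conjunct1]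
      in_components_subset[OF TC] in_components_connected[OF TC] fT
    have mx: "D = T" if "D \<noteq> {}" "T \<subseteq> D" "D \<subseteq> footprint P e" "connected D" for D
      using TC that unfolding in_components_maximal by blast
    have T': "T \<subseteq> {0..1}" using T tr by blast
    show "f \<in> max_half_edges V E P e"
      unfolding max_half_edges_def
    proof (intro CollectI conjI ballI impI)
      show "f \<in> half_edges V E e" unfolding half_edges_param[OF e] using T T' by metis
      show "f \<subseteq> P" using T(2) T' by (simp add: T(4) param_image_subset)
      fix f' assume f': "f' \<in> half_edges V E e" "f \<subseteq> f' \<and> f' \<subseteq> P"
      then obtain D where D: "D \<subseteq> {0..1}" "D \<noteq> {}" "connected D" "f' = param e ` D"
        using f'(1)[unfolded half_edges_param[OF e]] by metis
      have "T \<subseteq> D" using D T f'(2) sub by blast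
      moreover have "D \<subseteq> footprint P e" using f'(2) by (simp add: D(4) param_image_subset[OF D(1)])
      ultimately show "f' = f" using mx D T by blast
    qed
  qed
  then show ?thesis by blast
qed

lemma half_edge_length_param:
  assumes e: "e \<in> E" and l: "0 \<le> l e" and ab: "a \<le> b"
  shows "half_edge_length l e (param e ` {a..b}) = l e * (b - a)"
proof -
  have im: "edge_coord l e ` param e ` {a..b} = (\<lambda>t. l e * t) ` {a..b}"
    using edge_coord_param[OF e] by (simp add: image_image)
  have "Sup ((\<lambda>t. l e * t) ` {a..b}) = l e * b"
    by (rule cSup_eq_maximum) (use l ab in \<open>auto intro: mult_left_mono\<close>)
  moreover have "Inf ((\<lambda>t. l e * t) ` {a..b}) = l e * a"
    by (rule cInf_eq_minimum) (use l ab in \<open>auto intro: mult_left_mono\<close>)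
  ultimately show ?thesis by (simp add: half_edge_length_def im algebra_simps)
qed

lemma compact_footprint:
  assumes "closedin (complex_top V E) P" "e \<in> E"
  shows "compact (footprint P e)"
proof -
  have "closedin (top_of_set {0..1}) {x \<in> topspace (top_of_set {0..1}). param e x \<in> P}"
    by (rule closedin_continuous_map_preimage[OF continuous_param[OF assms(2)] assms(1)])
  then have "closedin (top_of_set {0..1}) (footprint P e)" by (simp add: footprint_def)
  then show ?thesis using closedin_compact compact_Icc by blast
qed

lemma component_footprint:
  assumes "closedin (complex_top V E) P" "e \<in> E" "T \<in> components (footprint P e)"
  obtains a b where "a \<le> b" "T = {a..b}"
proof -
  have "compact T" "connected T" "T \<noteq> {}"
    using compact_components[OF compact_footprint[OF assms(1,2)] assms(3)] assms(3)
    by (simp_all add: in_components_connected in_components_nonempty)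
  then obtain a b where "T = {a..b}" using connected_compact_interval_1[of T] by blast
  then show ?thesis using that \<open>T \<noteq> {}\<close> by (metis atLeastatMost_empty_iff)
qed

lemma component_footprint_borel:
  assumes "closedin (complex_top V E) P" "e \<in> E" "T \<in> components (footprint P e)"
  shows "T \<in> sets lborel"
  using compact_components[OF compact_footprint[OF assms(1,2)] assms(3)] by (simp add: borel_compact)

text \<open>Measure replaces components here because it is monotone and subadditive in \<open>P\<close>, whereas the
  components of a union of two sets have no simple relation to those of the sets.\<close>

definition edge_length_in :: "('a set \<Rightarrow> real) \<Rightarrow> 'a point set \<Rightarrow> 'a set \<Rightarrow> ennreal" where
  "edge_length_in l P e = ennreal (l e) * emeasure lborel (footprint P e)"

lemma arc_length_components:
  assumes P: "closedin (complex_top V E) P" and l: "\<forall>e\<in>E. 0 \<le> l e"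
  shows "arc_length V E l P =
    (\<Sum>\<^sub>\<infinity>e\<in>E. \<Sum>\<^sub>\<infinity>T\<in>components (footprint P e). ennreal (l e) * emeasure lborel T)"
  unfolding arc_length_def infsum_Sigma_ennreal
proof (rule infsum_cong)
  fix e assume e: "e \<in> E"
  have inj: "inj_on (\<lambda>T. param e ` T) (components (footprint P e))"
    using inj_param[OF e] by (meson inj_image_eq_iff inj_onI)
  have "(\<Sum>\<^sub>\<infinity>f\<in>max_half_edges V E P e. ennreal (half_edge_length l e f)) =
      (\<Sum>\<^sub>\<infinity>T\<in>components (footprint P e). ennreal (half_edge_length l e (param e ` T)))"
    unfolding max_half_edges_eq[OF e] by (subst infsum_reindex[OF inj]) (simp add: o_def)
  also have "\<dots> = (\<Sum>\<^sub>\<infinity>T\<in>components (footprint P e). ennreal (l e) * emeasure lborel T)"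
  proof (rule infsum_cong)
    fix T assume "T \<in> components (footprint P e)"
    then obtain a b where "a \<le> b" "T = {a..b}" using component_footprint[OF P e] by metis
    then show "ennreal (half_edge_length l e (param e ` T)) = ennreal (l e) * emeasure lborel T"
      using half_edge_length_param[of e l a b] e l by (simp add: ennreal_mult)
  qed
  finally show "(\<Sum>\<^sub>\<infinity>y\<in>max_half_edges V E P e. case (e, y) of (e, f) \<Rightarrow> ennreal (half_edge_length l e f)) =
      (\<Sum>\<^sub>\<infinity>T\<in>components (footprint P e). ennreal (l e) * emeasure lborel T)" by simp
qed

text \<open>The components of the footprint are disjoint, so their measures add up to at most its measure.\<close>

lemma arc_length_le:
  assumes P: "closedin (complex_top V E) P" and l: "\<forall>e\<in>E. 0 \<le> l e"
  shows "arc_length V E l P \<le> (\<Sum>\<^sub>\<infinity>e\<in>E. edge_length_in l P e)"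
  unfolding arc_length_components[OF P l]
proof (rule infsum_mono)
  fix e assume e: "e \<in> E"
  show "(\<Sum>\<^sub>\<infinity>T\<in>components (footprint P e). ennreal (l e) * emeasure lborel T) \<le> edge_length_in l P e"
  proof (rule infsum_ennreal_le)
    fix F assume F: "finite F" "F \<subseteq> components (footprint P e)"
    have Fb: "F \<subseteq> sets lborel" using F(2) component_footprint_borel[OF P e] by blast
    have "disjoint_family_on (\<lambda>T. T) F"
      using F(2) pairwise_disjoint_components[of "footprint P e"]
      by (auto simp: disjoint_family_on_def pairwise_def disjnt_def)
    then have "(\<Sum>T\<in>F. emeasure lborel T) = emeasure lborel (\<Union>T\<in>F. T)"
      using F Fb by (intro sum_emeasure) auto
    also have "\<dots> \<le> emeasure lborel (footprint P e)"
    proof (rule emeasure_mono)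
      show "(\<Union>T\<in>F. T) \<subseteq> footprint P e" using F(2) in_components_subset by blast
      show "footprint P e \<in> sets lborel"
        using compact_footprint[OF P e] by (simp add: borel_compact)
    qed
    finally show "(\<Sum>T\<in>F. ennreal (l e) * emeasure lborel T) \<le> edge_length_in l P e"
      by (simp add: edge_length_in_def sum_distrib_left[symmetric] mult_left_mono)
  qed
qed (auto intro: nonneg_summable_on_complete)

text \<open>A path enters the open edge through countably many intervals of time, so all but countably
  many points of its footprint are covered by countably many components.\<close>

lemma footprint_path_cover:
  assumes g: "pathin (complex_top V E) g" and e: "e \<in> E"
  obtains Z K where "countable Z" "countable K" "K \<subseteq> components (footprint (g ` {0..1}) e)"
    "footprint (g ` {0..1}) e \<subseteq> Z \<union> \<Union>K"
proof -
  define c where "c = (\<lambda>p::'a point. p (head e))"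
  define c' where "c' = (\<lambda>p::'a point. p (tail e))"
  let ?T = "footprint (g ` {0..1}) e"
  have cont: "continuous_on {0..1} (\<lambda>\<tau>. g \<tau> w)" for w
    using pathin_compose[OF g continuous_coordinate[of w]] by (simp add: o_def path_def)
  \<comment> \<open>The times at which the path is inside the edge; its components are open intervals.\<close>
  define J where "J = {\<tau> \<in> {0<..<1}. 0 < c (g \<tau>) \<and> 0 < c' (g \<tau>)}"
  have "open ({\<tau> \<in> {0<..<1}. g \<tau> (head e) \<in> {0<..}} \<inter> {\<tau> \<in> {0<..<1}. g \<tau> (tail e) \<in> {0<..}})"
    by (intro open_Int; rule continuous_open_preimage[unfolded vimage_def Int_def, simplified])
      (auto intro: continuous_on_subset[OF cont])
  also have "({\<tau> \<in> {0<..<1}. g \<tau> (head e) \<in> {0<..}} \<inter> {\<tau> \<in> {0<..<1}. g \<tau> (tail e) \<in> {0<..}}) = J"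
    by (auto simp: J_def c_def c'_def)
  finally have J: "open J" .
  have gJ: "g \<tau> = param e (c (g \<tau>)) \<and> c (g \<tau>) \<in> ?T" if "\<tau> \<in> J" for \<tau>
  proof -
    have \<tau>: "0 < \<tau>" "\<tau> < 1" "0 < g \<tau> (head e)" "0 < g \<tau> (tail e)"
      using that by (auto simp: J_def c_def c'_def)
    have gp: "g \<tau> \<in> points V E" using path_image_subset_topspace[OF g] \<tau> by auto
    have "supp (g \<tau>) \<subseteq> e"
      using gp
    proof (cases rule: points_cases)
      case (vertex v)
      then show ?thesis using \<tau> edge_eq_tail_head[OF e] by (auto simp: vertex_point_def split: if_splits)
    next
      case (inner u v t)
      then have "head e \<in> {u, v}" "tail e \<in> {u, v}"
        using \<tau> by (auto simp: edge_point_def split: if_splits)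
      then show ?thesis using inner edge_eq_tail_head[OF e] supp_edge_point[of u v t] by auto
    qed
    then have "g \<tau> \<in> param e ` {0..1}" using gp edge_set_param[OF e] by (auto simp: edge_set_def)
    then obtain t where "t \<in> {0..1}" "g \<tau> = param e t" by blast
    moreover from this have "c (g \<tau>) = t" by (simp add: c_def param_head[OF e])
    moreover have "g \<tau> \<in> g ` {0..1}" using \<tau> by simp
    ultimately show ?thesis by (simp add: footprint_def)
  qed
  have cc: "countable (components J)"
  proof (rule countable_disjoint_open_subsets)
    show "pairwise disjnt (components J)"
      using pairwise_disjoint_components[of J] by (simp add: pairwise_def disjnt_def)
  qed (use J open_components in blast)
  have "\<exists>C. C \<in> components ?T \<and> (\<lambda>\<tau>. c (g \<tau>)) ` D \<subseteq> C" if D: "D \<in> components J" for D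
  proof (rule exists_component_superset)
    have DJ: "D \<subseteq> J" "D \<noteq> {}" using D in_components_subset in_components_nonempty by blast+
    then show "(\<lambda>\<tau>. c (g \<tau>)) ` D \<subseteq> ?T" "?T \<noteq> {}" using gJ by blast+
    have "D \<subseteq> {0..1}" using DJ by (auto simp: J_def)
    then have "continuous_on D (\<lambda>\<tau>. c (g \<tau>))"
      unfolding c_def using cont continuous_on_subset by blast
    then show "connected ((\<lambda>\<tau>. c (g \<tau>)) ` D)"
      using D in_components_connected connected_continuous_image by blast
  qed
  then obtain C where C: "\<And>D. D \<in> components J \<Longrightarrow> C D \<in> components ?T"
    "\<And>D. D \<in> components J \<Longrightarrow> (\<lambda>\<tau>. c (g \<tau>)) ` D \<subseteq> C D"
    by metis
  show ?thesis
  proof (rule that[of "{0, 1, c (g 0), c (g 1)}" "C ` components J"])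
    show "?T \<subseteq> {0, 1, c (g 0), c (g 1)} \<union> \<Union>(C ` components J)"
    proof
      fix t assume "t \<in> ?T"
      then obtain \<tau> where \<tau>: "\<tau> \<in> {0..1}" "g \<tau> = param e t" "0 \<le> t" "t \<le> 1"
        by (auto simp: footprint_def)
      then have t: "c (g \<tau>) = t" "c' (g \<tau>) = 1 - t"
        using e edge_eq_tail_head[OF e] by (auto simp: c_def c'_def param_def edge_point_def)
      show "t \<in> {0, 1, c (g 0), c (g 1)} \<union> \<Union>(C ` components J)"
      proof (cases "t = 0 \<or> t = 1 \<or> \<tau> = 0 \<or> \<tau> = 1")
        case True
        then show ?thesis using t by auto
      next
        case False
        then have "\<tau> \<in> J" using t \<tau> by (auto simp: J_def)
        then obtain D where "D \<in> components J" "\<tau> \<in> D" using Union_components by blast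
        then show ?thesis using C(2)[of D] t by blast
      qed
    qed
  qed (use cc C in auto)
qed

lemma closedin_path_image:
  "pathin (complex_top V E) g \<Longrightarrow> closedin (complex_top V E) (g ` {0..1})"
  using compactin_path_image compactin_imp_closedin Hausdorff_complex by blast

text \<open>For an arbitrary closed set the components may miss length, since the footprint can be a Cantor set
  of positive measure. For a path the countable cover excludes this.\<close>

lemma arc_length_path:
  assumes g: "pathin (complex_top V E) g" and l: "\<forall>e\<in>E. 0 \<le> l e"
  shows "arc_length V E l (g ` {0..1}) = (\<Sum>\<^sub>\<infinity>e\<in>E. edge_length_in l (g ` {0..1}) e)"
proof (rule antisym)
  let ?P = "g ` {0..1}"
  have P: "closedin (complex_top V E) ?P" using g by (rule closedin_path_image)
  show "arc_length V E l ?P \<le> (\<Sum>\<^sub>\<infinity>e\<in>E. edge_length_in l ?P e)"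
    using arc_length_le[OF P l] .
  show "(\<Sum>\<^sub>\<infinity>e\<in>E. edge_length_in l ?P e) \<le> arc_length V E l ?P"
    unfolding arc_length_components[OF P l]
  proof (rule infsum_mono)
    fix e assume e: "e \<in> E"
    obtain Z K where ZK: "countable Z" "countable K" "K \<subseteq> components (footprint ?P e)"
      "footprint ?P e \<subseteq> Z \<union> \<Union>K"
      using footprint_path_cover[OF g e] .
    have Kb: "T \<in> sets lborel" if "T \<in> K" for T
      using ZK(3) component_footprint_borel[OF P e] that by blast
    have Zb: "Z \<in> sets lborel" using countable_imp_null_set_lborel[OF ZK(1)] by blast
    have "emeasure lborel (footprint ?P e) \<le> emeasure lborel (Z \<union> (\<Union>T\<in>K. T))"
      using ZK Kb Zb by (intro emeasure_mono sets.Un sets.countable_UN') auto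
    also have "\<dots> \<le> emeasure lborel Z + emeasure lborel (\<Union>T\<in>K. T)"
      using ZK Kb Zb by (intro emeasure_subadditive sets.countable_UN') auto
    also have "\<dots> = emeasure lborel (\<Union>T\<in>K. T)"
      using ZK(1) by (simp add: emeasure_lborel_countable)
    also have "\<dots> \<le> (\<Sum>\<^sub>\<infinity>T\<in>K. emeasure lborel T)"
      by (rule emeasure_UN_le_infsum) (use ZK Kb in auto)
    also have "\<dots> \<le> (\<Sum>\<^sub>\<infinity>T\<in>components (footprint ?P e). emeasure lborel T)"
      by (rule infsum_mono_neutral) (use ZK in \<open>auto intro: nonneg_summable_on_complete\<close>)
    finally have le: "emeasure lborel (footprint ?P e) \<le> (\<Sum>\<^sub>\<infinity>T\<in>components (footprint ?P e). emeasure lborel T)" .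
    have "(\<Sum>\<^sub>\<infinity>T\<in>components (footprint ?P e). ennreal (l e) * emeasure lborel T) =
        ennreal (l e) * (\<Sum>\<^sub>\<infinity>T\<in>components (footprint ?P e). emeasure lborel T)"
      by (subst (1 2) nonneg_infsum_complete)
        (auto simp: SUP_mult_left_ennreal sum_distrib_left)
    then show "edge_length_in l ?P e \<le> (\<Sum>\<^sub>\<infinity>T\<in>components (footprint ?P e). ennreal (l e) * emeasure lborel T)"
      using le by (simp add: edge_length_in_def mult_left_mono)
  qed (auto intro: nonneg_summable_on_complete)
qed

end

section \<open>Completions\<close>

locale ext_pseudometric =
  fixes M :: "'b set" and d :: "'b \<Rightarrow> 'b \<Rightarrow> ennreal"
  assumes d_self: "x \<in> M \<Longrightarrow> d x x = 0"
    and d_sym: "x \<in> M \<Longrightarrow> y \<in> M \<Longrightarrow> d x y = d y x"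
    and d_triangle: "x \<in> M \<Longrightarrow> y \<in> M \<Longrightarrow> z \<in> M \<Longrightarrow> d x z \<le> d x y + d y z"
begin

lemma cauchy_seqs_in: "s \<in> cauchy_seqs M d \<Longrightarrow> s n \<in> M"
  by (auto simp: cauchy_seqs_def)

lemma cauchy_seqsD:
  assumes "s \<in> cauchy_seqs M d" "0 < \<epsilon>"
  shows "\<exists>N. \<forall>m\<ge>N. \<forall>n\<ge>N. d (s m) (s n) < \<epsilon>"
  using assms unfolding cauchy_seqs_def by simp

lemma cauchy_dist_convergent:
  assumes s: "s \<in> cauchy_seqs M d" and t: "t \<in> cauchy_seqs M d"
  obtains c where "(\<lambda>n. d (s n) (t n)) \<longlonglongrightarrow> c"
proof -
  define D where "D = (\<lambda>n. d (s n) (t n))"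
  note M = cauchy_seqs_in[OF s] cauchy_seqs_in[OF t]
  have "limsup D \<le> liminf D + ennreal \<epsilon>" if \<epsilon>: "\<epsilon> > 0" "liminf D < top" for \<epsilon> :: real
  proof -
    have \<epsilon>': "ennreal (\<epsilon> / 3) > 0" using \<epsilon> by simp
    obtain N1 where N1: "\<And>m n. m \<ge> N1 \<Longrightarrow> n \<ge> N1 \<Longrightarrow> d (s m) (s n) < ennreal (\<epsilon> / 3)"
      using cauchy_seqsD[OF s \<epsilon>'] by blast
    obtain N2 where N2: "\<And>m n. m \<ge> N2 \<Longrightarrow> n \<ge> N2 \<Longrightarrow> d (t m) (t n) < ennreal (\<epsilon> / 3)"
      using cauchy_seqsD[OF t \<epsilon>'] by blast
    define N where "N = max N1 N2"
    have step: "D n \<le> D m + ennreal (2 * \<epsilon> / 3)" if "m \<ge> N" "n \<ge> N" for m n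
    proof -
      have "D n \<le> d (s n) (s m) + (d (s m) (t m) + d (t m) (t n))"
        unfolding D_def using d_triangle[of "s n" "s m" "t n"] d_triangle[of "s m" "t m" "t n"] M
        by (meson add_left_mono order_trans)
      also have "\<dots> \<le> ennreal (\<epsilon> / 3) + (d (s m) (t m) + ennreal (\<epsilon> / 3))"
        using N1[of n m] N2[of m n] that by (intro add_mono) (auto simp: N_def)
      also have "\<dots> = D m + (ennreal (\<epsilon> / 3) + ennreal (\<epsilon> / 3))"
        by (simp add: D_def ac_simps)
      also have "ennreal (\<epsilon> / 3) + ennreal (\<epsilon> / 3) = ennreal (2 * \<epsilon> / 3)"
        using \<epsilon> by (simp add: ennreal_plus[symmetric] del: ennreal_plus)
      finally show ?thesis .
    qed
    have "\<exists>m\<ge>N. D m < liminf D + ennreal (\<epsilon> / 3)"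
    proof (rule ccontr)
      assume "\<not> ?thesis"
      then have "liminf D + ennreal (\<epsilon> / 3) \<le> liminf D"
        by (intro Liminf_bounded) (auto simp: eventually_sequentially not_less)
      then show False using \<epsilon> by (simp add: ennreal_add_left_cancel_le[of _ _ 0, simplified] less_top)
    qed
    then obtain m where m: "m \<ge> N" "D m < liminf D + ennreal (\<epsilon> / 3)" by blast
    have "limsup D \<le> D m + ennreal (2 * \<epsilon> / 3)"
      by (rule Limsup_bounded) (use step m in \<open>auto simp: eventually_sequentially\<close>)
    also have "\<dots> \<le> liminf D + ennreal (\<epsilon> / 3) + ennreal (2 * \<epsilon> / 3)"
      using m by (intro add_right_mono) simp
    also have "\<dots> = liminf D + ennreal \<epsilon>"
      using \<epsilon> by (simp add: add.assoc ennreal_plus[symmetric] del: ennreal_plus)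
    finally show ?thesis .
  qed
  then have "limsup D \<le> liminf D"
    by (cases "liminf D = top") (auto intro: ennreal_le_epsilon simp: less_top)
  then have "D \<longlonglongrightarrow> liminf D"
    using Liminf_le_Limsup[of sequentially D] by (intro Liminf_eq_Limsup) (auto intro: antisym)
  then show ?thesis using that unfolding D_def by blast
qed

lemma equiv_cauchy_equiv: "equiv (cauchy_seqs M d) (cauchy_equiv M d)"
proof (rule equivI)
  show "cauchy_equiv M d \<subseteq> cauchy_seqs M d \<times> cauchy_seqs M d"
    by (auto simp: cauchy_equiv_def)
  show "refl_on (cauchy_seqs M d) (cauchy_equiv M d)"
    by (auto simp: refl_on_def cauchy_equiv_def d_self cauchy_seqs_in)
  show "sym (cauchy_equiv M d)"
    by (auto simp: sym_def cauchy_equiv_def d_sym cauchy_seqs_in)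
  show "trans (cauchy_equiv M d)"
  proof (rule transI)
    fix s t u assume st: "(s, t) \<in> cauchy_equiv M d" and tu: "(t, u) \<in> cauchy_equiv M d"
    then have c: "s \<in> cauchy_seqs M d" "t \<in> cauchy_seqs M d" "u \<in> cauchy_seqs M d"
      and l: "(\<lambda>n. d (s n) (t n)) \<longlonglongrightarrow> 0" "(\<lambda>n. d (t n) (u n)) \<longlonglongrightarrow> 0"
      by (auto simp: cauchy_equiv_def)
    have "(\<lambda>n. d (s n) (t n) + d (t n) (u n)) \<longlonglongrightarrow> 0"
      using tendsto_add[OF l] by simp
    then have "(\<lambda>n. d (s n) (u n)) \<longlonglongrightarrow> 0"
      by (rule tendsto_sandwich[OF _ _ tendsto_const, rotated 2])
        (auto intro!: always_eventually d_triangle cauchy_seqs_in c)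
    then show "(s, u) \<in> cauchy_equiv M d" using c by (auto simp: cauchy_equiv_def)
  qed
qed

lemma limit_dist_le:
  assumes s: "(s, s') \<in> cauchy_equiv M d" and t: "(t, t') \<in> cauchy_equiv M d"
    and c: "(\<lambda>n. d (s n) (t n)) \<longlonglongrightarrow> c" and c': "(\<lambda>n. d (s' n) (t' n)) \<longlonglongrightarrow> c'"
  shows "c \<le> c'"
proof -
  have M: "s n \<in> M" "s' n \<in> M" "t n \<in> M" "t' n \<in> M" for n
    using s t by (auto simp: cauchy_equiv_def cauchy_seqs_in)
  have "(\<lambda>n. d (s n) (s' n)) \<longlonglongrightarrow> 0" "(\<lambda>n. d (t' n) (t n)) \<longlonglongrightarrow> 0"
    using s t d_sym[OF M(3) M(4)] by (auto simp: cauchy_equiv_def)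
  then have "(\<lambda>n. d (s n) (s' n) + (d (s' n) (t' n) + d (t' n) (t n))) \<longlonglongrightarrow> 0 + (c' + 0)"
    using c' by (intro tendsto_add) auto
  then have "c \<le> 0 + (c' + 0)"
  proof (rule tendsto_le[OF _ _ c, rotated])
    have "d (s n) (t n) \<le> d (s n) (s' n) + (d (s' n) (t' n) + d (t' n) (t n))" for n
      using d_triangle[of "s n" "s' n" "t n"] d_triangle[of "s' n" "t' n" "t n"] M
      by (meson add_left_mono order_trans)
    then show "\<forall>\<^sub>F n in sequentially. d (s n) (t n) \<le> d (s n) (s' n) + (d (s' n) (t' n) + d (t' n) (t n))"
      by simp
  qed simp
  then show ?thesis by simp
qed

lemma completion_dist_tendsto:
  assumes s: "s \<in> cauchy_seqs M d" and t: "t \<in> cauchy_seqs M d"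
  shows "(\<lambda>n. d (s n) (t n)) \<longlonglongrightarrow>
    completion_dist d (cauchy_equiv M d `` {s}) (cauchy_equiv M d `` {t})"
proof -
  obtain c where c: "(\<lambda>n. d (s n) (t n)) \<longlonglongrightarrow> c" using cauchy_dist_convergent[OF s t] .
  have refl: "(s, s) \<in> cauchy_equiv M d" "(t, t) \<in> cauchy_equiv M d"
    using s t by (auto simp: cauchy_equiv_def d_self cauchy_seqs_in)
  have "completion_dist d (cauchy_equiv M d `` {s}) (cauchy_equiv M d `` {t}) = c"
    unfolding completion_dist_def
  proof (rule the_equality)
    show "\<forall>s'\<in>cauchy_equiv M d `` {s}. \<forall>t'\<in>cauchy_equiv M d `` {t}. (\<lambda>n. d (s' n) (t' n)) \<longlonglongrightarrow> c"
    proof (intro ballI)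
      fix s' t' assume "s' \<in> cauchy_equiv M d `` {s}" "t' \<in> cauchy_equiv M d `` {t}"
      then have st: "(s, s') \<in> cauchy_equiv M d" "(t, t') \<in> cauchy_equiv M d" by auto
      then have st': "(s', s) \<in> cauchy_equiv M d" "(t', t) \<in> cauchy_equiv M d"
        using equiv_cauchy_equiv by (meson equivE symD)+
      obtain c' where c': "(\<lambda>n. d (s' n) (t' n)) \<longlonglongrightarrow> c'"
        using cauchy_dist_convergent st by (auto simp: cauchy_equiv_def)
      have "c = c'" using limit_dist_le[OF st c c'] limit_dist_le[OF st' c' c] by simp
      then show "(\<lambda>n. d (s' n) (t' n)) \<longlonglongrightarrow> c" using c' by simp
    qed
  next
    fix c' assume "\<forall>s'\<in>cauchy_equiv M d `` {s}. \<forall>t'\<in>cauchy_equiv M d `` {t}. (\<lambda>n. d (s' n) (t' n)) \<longlonglongrightarrow> c'"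
    then have "(\<lambda>n. d (s n) (t n)) \<longlonglongrightarrow> c'" using refl by blast
    then show "c' = c" using c LIMSEQ_unique by blast
  qed
  then show ?thesis using c by simp
qed

text \<open>If Cauchy sequences indexed by \<open>A\<close> represent each point of the completion exactly once, then the
  completion may be compared with a topology on \<open>A\<close> by pulling its distance back to \<open>A\<close>.\<close>

lemma homeomorphic_completion:
  fixes A :: "'c set" and rep :: "'c \<Rightarrow> nat \<Rightarrow> 'b"
  defines "emb \<equiv> \<lambda>a. cauchy_equiv M d `` {rep a}"
  assumes rep: "\<And>a. a \<in> A \<Longrightarrow> rep a \<in> cauchy_seqs M d"
    and rep_inj: "\<And>a b. a \<in> A \<Longrightarrow> b \<in> A \<Longrightarrow> (rep a, rep b) \<in> cauchy_equiv M d \<Longrightarrow> a = b"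
    and rep_surj: "\<And>s. s \<in> cauchy_seqs M d \<Longrightarrow> \<exists>a\<in>A. (s, rep a) \<in> cauchy_equiv M d"
    and Y: "\<And>U. openin Y U \<longleftrightarrow> emetric_open A (\<lambda>a b. completion_dist d (emb a) (emb b)) U"
  shows "\<exists>h. homeomorphic_map (emetric_top (completion M d) (completion_dist d)) Y h \<and>
             (\<forall>a\<in>A. h (emb a) = a)"
proof -
  let ?Z = "emetric_top (completion M d) (completion_dist d)"
  have top: "topspace (emetric_top B \<rho>) = B" for B :: "'x set" and \<rho>
  proof
    show "topspace (emetric_top B \<rho>) \<subseteq> B"
      by (metis openin_topspace openin_emetric_top emetric_open_def)
    have "emetric_open B \<rho> B" by (auto simp: emetric_open_def intro!: exI[of _ 1])
    then show "B \<subseteq> topspace (emetric_top B \<rho>)" using openin_emetric_top openin_subset by metis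
  qed
  have Yeq: "Y = emetric_top A (\<lambda>a b. completion_dist d (emb a) (emb b))"
    by (simp add: topology_eq Y openin_emetric_top)
  have bij: "bij_betw emb A (completion M d)"
    unfolding bij_betw_def
  proof
    show "inj_on emb A"
    proof (rule inj_onI)
      fix a b assume ab: "a \<in> A" "b \<in> A" "emb a = emb b"
      then have "(rep a, rep b) \<in> cauchy_equiv M d"
        unfolding emb_def using equiv_cauchy_equiv rep by (metis eq_equiv_class)
      then show "a = b" using rep_inj ab by blast
    qed
    show "emb ` A = completion M d"
    proof
      show "emb ` A \<subseteq> completion M d" using rep by (auto simp: emb_def completion_def quotientI)
      show "completion M d \<subseteq> emb ` A"
      proof
        fix B assume "B \<in> completion M d"
        then obtain s where s: "s \<in> cauchy_seqs M d" "B = cauchy_equiv M d `` {s}"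
          by (auto simp: completion_def quotient_def)
        then obtain a where "a \<in> A" "(s, rep a) \<in> cauchy_equiv M d" using rep_surj by blast
        then show "B \<in> emb ` A"
          using s equiv_class_eq[OF equiv_cauchy_equiv] by (auto simp: emb_def)
      qed
    qed
  qed
  define h where "h = inv_into A emb"
  have h: "h (emb a) = a" if "a \<in> A" for a
    using bij that by (simp add: h_def bij_betw_def)
  have hA: "h x \<in> A" "emb (h x) = x" if "x \<in> completion M d" for x
    using bij that by (auto simp: h_def bij_betw_def inv_into_into f_inv_into_f)
  have embA: "emb a \<in> completion M d" if "a \<in> A" for a
    using bij that by (auto simp: bij_betw_def)
  have "homeomorphic_maps ?Z Y h emb"
    unfolding homeomorphic_maps_def Yeq continuous_map top
  proof (intro conjI allI impI ballI)
    show "h ` completion M d \<subseteq> A" using hA by auto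
    show "emb ` A \<subseteq> completion M d" using embA by auto
  next
    fix U assume U: "openin (emetric_top A (\<lambda>a b. completion_dist d (emb a) (emb b))) U"
    show "openin ?Z {x \<in> completion M d. h x \<in> U}"
      unfolding openin_emetric_top emetric_open_def
    proof (intro conjI ballI)
      fix x assume x: "x \<in> {x \<in> completion M d. h x \<in> U}"
      then obtain \<epsilon> where \<epsilon>: "\<epsilon> > 0" "{b \<in> A. completion_dist d (emb (h x)) (emb b) < \<epsilon>} \<subseteq> U"
        using U unfolding openin_emetric_top emetric_open_def by blast
      have "{y \<in> completion M d. completion_dist d x y < \<epsilon>} \<subseteq> {x \<in> completion M d. h x \<in> U}"
      proof (intro subsetI CollectI conjI)
        fix y assume y: "y \<in> {y \<in> completion M d. completion_dist d x y < \<epsilon>}"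
        then have "h y \<in> {b \<in> A. completion_dist d (emb (h x)) (emb b) < \<epsilon>}"
          using x hA by auto
        then show "h y \<in> U" using \<epsilon> by blast
      qed auto
      then show "\<exists>\<epsilon>>0. {y \<in> completion M d. completion_dist d x y < \<epsilon>} \<subseteq> {x \<in> completion M d. h x \<in> U}"
        using \<epsilon>(1) by blast
    qed auto
  next
    fix U assume U: "openin ?Z U"
    show "openin (emetric_top A (\<lambda>a b. completion_dist d (emb a) (emb b))) {a \<in> A. emb a \<in> U}"
      unfolding openin_emetric_top emetric_open_def
    proof (intro conjI ballI)
      fix a assume a: "a \<in> {a \<in> A. emb a \<in> U}"
      then obtain \<epsilon> where \<epsilon>: "\<epsilon> > 0" "{y \<in> completion M d. completion_dist d (emb a) y < \<epsilon>} \<subseteq> U"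
        using U unfolding openin_emetric_top emetric_open_def by blast
      then have "{b \<in> A. completion_dist d (emb a) (emb b) < \<epsilon>} \<subseteq> {a \<in> A. emb a \<in> U}"
        using embA by auto
      then show "\<exists>\<epsilon>>0. {b \<in> A. completion_dist d (emb a) (emb b) < \<epsilon>} \<subseteq> {a \<in> A. emb a \<in> U}"
        using \<epsilon>(1) by blast
    qed auto
  qed (use h hA in auto)
  then have "homeomorphic_map ?Z Y h" using homeomorphic_map_maps by blast
  then show ?thesis using h by blast
qed

end

context graph_complex
begin

section \<open>The distance\<close>

lemma dist_len_sym: "dist_len V E l x y = dist_len V E l y x"
  unfolding dist_len_def
  using arcs_between_sym[of "complex_top V E" x y] arcs_between_sym[of "complex_top V E" y x]
  by (simp add: subset_antisym)

lemma dist_len_self: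
  assumes "\<forall>e\<in>E. 0 \<le> l e" "x \<in> points V E"
  shows "dist_len V E l x x = 0"
proof -
  have "closedin (complex_top V E) {x}"
    using assms by (intro closedin_Hausdorff_singleton Hausdorff_complex) auto
  from arc_length_le[OF this assms(1)]
  have "arc_length V E l {x} \<le> (\<Sum>\<^sub>\<infinity>e\<in>E. edge_length_in l {x} e)" .
  also have "\<dots> = (\<Sum>\<^sub>\<infinity>e\<in>E. 0)"
  proof (rule infsum_cong)
    fix e assume e: "e \<in> E"
    have "footprint {x} e \<subseteq> {x (head e)}"
      by (auto simp: footprint_def param_head[OF e])
    then have "countable (footprint {x} e)" by (meson countable_finite finite.simps finite_subset)
    then show "edge_length_in l {x} e = 0"
      by (simp add: edge_length_in_def emeasure_lborel_countable)
  qed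
  finally have "arc_length V E l {x} = 0" by simp
  moreover have "dist_len V E l x x \<le> arc_length V E l {x}"
    unfolding dist_len_def by (rule INF_lower) (simp add: arcs_between_def)
  ultimately show ?thesis by simp
qed

lemma dist_len_triangle:
  assumes l: "\<forall>e\<in>E. 0 \<le> l e" and xyz: "x \<in> points V E" "y \<in> points V E" "z \<in> points V E"
  shows "dist_len V E l x z \<le> dist_len V E l x y + dist_len V E l y z"
  unfolding dist_len_def[of V E l x y] dist_len_def[of V E l y z]
proof (rule le_INF_add_INF)
  let ?X = "complex_top V E"
  fix P Q assume PQ: "P \<in> arcs_between ?X x y" "Q \<in> arcs_between ?X y z"
  obtain R where R: "R \<in> arcs_between ?X x z" "R \<subseteq> P \<union> Q"
    using arcs_between_join[OF Hausdorff_complex _ _ PQ] xyz by auto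
  have X: "x \<in> topspace ?X" "y \<in> topspace ?X" using xyz by auto
  obtain g where g: "pathin ?X g" "P = g ` {0..1}"
    using arcs_between_path[OF PQ(1) X(1)] by metis
  obtain h where h: "pathin ?X h" "Q = h ` {0..1}"
    using arcs_between_path[OF PQ(2) X(2)] by metis
  obtain k where k: "pathin ?X k" "R = k ` {0..1}"
    using arcs_between_path[OF R(1) X(1)] by metis
  have cl: "closedin ?X P" "closedin ?X Q"
    using closedin_path_image g h by auto
  have "dist_len V E l x z \<le> arc_length V E l R"
    unfolding dist_len_def using R(1) by (rule INF_lower)
  also have "\<dots> = (\<Sum>\<^sub>\<infinity>e\<in>E. edge_length_in l R e)"
    using arc_length_path[OF k(1) l] k(2) by simp
  also have "\<dots> \<le> (\<Sum>\<^sub>\<infinity>e\<in>E. edge_length_in l P e + edge_length_in l Q e)"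
  proof (rule infsum_mono)
    fix e assume e: "e \<in> E"
    have b: "footprint P e \<in> sets lborel" "footprint Q e \<in> sets lborel"
      using compact_footprint[OF cl(1) e] compact_footprint[OF cl(2) e] by (auto simp: borel_compact)
    have "footprint R e \<subseteq> footprint P e \<union> footprint Q e"
      using R(2) by (auto simp: footprint_def)
    then have "emeasure lborel (footprint R e) \<le> emeasure lborel (footprint P e \<union> footprint Q e)"
      using b by (intro emeasure_mono) auto
    also have "\<dots> \<le> emeasure lborel (footprint P e) + emeasure lborel (footprint Q e)"
      using b by (intro emeasure_subadditive)
    finally show "edge_length_in l R e \<le> edge_length_in l P e + edge_length_in l Q e"
      unfolding edge_length_in_def by (simp add: distrib_left[symmetric] mult_left_mono)
  qed (auto intro: nonneg_summable_on_complete)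
  also have "\<dots> = (\<Sum>\<^sub>\<infinity>e\<in>E. edge_length_in l P e) + (\<Sum>\<^sub>\<infinity>e\<in>E. edge_length_in l Q e)"
    by (rule infsum_add) (auto intro: nonneg_summable_on_complete)
  also have "\<dots> = arc_length V E l P + arc_length V E l Q"
    using arc_length_path[OF g(1) l] arc_length_path[OF h(1) l] g(2) h(2) by simp
  finally show "dist_len V E l x z \<le> arc_length V E l P + arc_length V E l Q" .
qed

text \<open>The segment between two points of an edge meets every other edge in vertices only, which do not
  contribute to the length.\<close>

lemma dist_len_edge_le:
  assumes uv: "{u, v} \<in> E" and l: "\<forall>e\<in>E. 0 \<le> l e" and st: "0 \<le> s" "s \<le> 1" "0 \<le> t" "t \<le> 1"
  shows "dist_len V E l (edge_point u v s) (edge_point u v t) \<le> ennreal (l {u, v} * \<bar>s - t\<bar>)"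
proof -
  have *: "dist_len V E l (edge_point u v s) (edge_point u v t) \<le> ennreal (l {u, v} * (t - s))"
    if st: "0 \<le> s" "s \<le> t" "t \<le> 1" for s t
  proof -
    let ?X = "complex_top V E"
    define P where "P = edge_point u v ` {s..t}"
    have cont: "continuous_map (top_of_set {s..t}) ?X (edge_point u v)"
      by (rule continuous_map_from_subtopology_mono[OF continuous_edge_point[OF uv]]) (use st in auto)
    have "inj_on (edge_point u v) {s..t}"
      by (rule inj_on_inverseI[where g = "\<lambda>p. p v"]) (simp add: edge_point_apply edgeD[OF uv])
    then have P: "P \<in> arcs_between ?X (edge_point u v s) (edge_point u v t)"
      unfolding P_def using arcI[OF st(2) cont] by blast
    have "compactin ?X P" unfolding P_def
      by (rule image_compactin[OF _ cont]) (auto simp: compactin_subtopology)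
    then have cl: "closedin ?X P" using compactin_imp_closedin[OF Hausdorff_complex] by blast
    have fp: "edge_length_in l P e \<le> (if e = {u, v} then ennreal (l {u, v} * (t - s)) else 0)" if e: "e \<in> E" for e
    proof (cases "e = {u, v}")
      case True
      have "footprint P e \<subseteq> {s..t} \<or> footprint P e \<subseteq> {1 - t..1 - s}"
      proof (cases "head e = v")
        case True
        have "footprint P e \<subseteq> {s..t}"
        proof
          fix r assume "r \<in> footprint P e"
          then obtain r' where r': "r' \<in> {s..t}" "param e r = edge_point u v r'"
            by (auto simp: footprint_def P_def)
          then have "r = r'" using param_head[OF e, of r] True edge_point_apply[OF edgeD(3)[OF uv]] by simp
          then show "r \<in> {s..t}" using r' by simp
        qed
        then show ?thesis ..
      next
        case False
        then have hu: "head e = u" using edge_eq_tail_head(1)[OF e] \<open>e = {u, v}\<close> by auto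
        have "footprint P e \<subseteq> {1 - t..1 - s}"
        proof
          fix r assume "r \<in> footprint P e"
          then obtain r' where r': "r' \<in> {s..t}" "param e r = edge_point u v r'"
            by (auto simp: footprint_def P_def)
          then have "r = 1 - r'" using param_head[OF e, of r] hu edge_point_apply[OF edgeD(3)[OF uv]] by simp
          then show "r \<in> {1 - t..1 - s}" using r' by simp
        qed
        then show ?thesis ..
      qed
      then have "emeasure lborel (footprint P e) \<le> ennreal (t - s)"
      proof
        assume "footprint P e \<subseteq> {s..t}"
        then have "emeasure lborel (footprint P e) \<le> emeasure lborel {s..t}"
          by (intro emeasure_mono) auto
        then show ?thesis using st by simp
      next
        assume "footprint P e \<subseteq> {1 - t..1 - s}"
        then have "emeasure lborel (footprint P e) \<le> emeasure lborel {1 - t..1 - s}"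
          by (intro emeasure_mono) auto
        then show ?thesis using st by simp
      qed
      then have "edge_length_in l P e \<le> ennreal (l e) * ennreal (t - s)"
        unfolding edge_length_in_def by (rule mult_left_mono) simp
      also have "\<dots> = ennreal (l e * (t - s))" using l e st by (simp add: ennreal_mult)
      finally show ?thesis using True by simp
    next
      case False
      have "footprint P e \<subseteq> {0, 1}"
      proof (rule subsetI, rule ccontr)
        fix r assume r: "r \<in> footprint P e" "r \<notin> {0, 1}"
        then have r': "0 < r" "r < 1" "param e r \<in> P" by (auto simp: footprint_def)
        then have "supp (param e r) = e"
          using supp_edge_point[of "tail e" "head e" r] edge_eq_tail_head[OF e] by (simp add: param_def)
        moreover obtain q where "param e r = edge_point u v q" using r'(3) by (auto simp: P_def)
        then have "supp (param e r) \<subseteq> {u, v}" by (simp only: supp_edge_point_subset)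
        ultimately have "{tail e, head e} \<subseteq> {u, v}" using edge_eq_tail_head[OF e] by simp
        then have "{tail e, head e} = {u, v}" using edge_eq_tail_head(2)[OF e] by auto
        then show False using False edge_eq_tail_head(1)[OF e] by simp
      qed
      then have "countable (footprint P e)" by (meson countable_finite finite.simps finite_subset)
      then show ?thesis using False by (simp add: edge_length_in_def emeasure_lborel_countable)
    qed
    have "dist_len V E l (edge_point u v s) (edge_point u v t) \<le> arc_length V E l P"
      unfolding dist_len_def using P by (rule INF_lower)
    also have "\<dots> \<le> (\<Sum>\<^sub>\<infinity>e\<in>E. edge_length_in l P e)"
      by (rule arc_length_le[OF cl l])
    also have "\<dots> \<le> ennreal (l {u, v} * (t - s))"
    proof (rule infsum_ennreal_le)
      fix F assume F: "finite F" "F \<subseteq> E"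
      have "(\<Sum>e\<in>F. edge_length_in l P e) \<le> (\<Sum>e\<in>F. if e = {u, v} then ennreal (l {u, v} * (t - s)) else 0)"
        using F fp by (intro sum_mono) blast
      also have "\<dots> \<le> ennreal (l {u, v} * (t - s))" using F by (simp add: sum.delta)
      finally show "(\<Sum>e\<in>F. edge_length_in l P e) \<le> ennreal (l {u, v} * (t - s))" .
    qed
    finally show ?thesis .
  qed
  show ?thesis
  proof (cases "s \<le> t")
    case True
    then have "\<bar>s - t\<bar> = t - s" by simp
    then show ?thesis using *[OF st(1) True st(4)] by (simp only:)
  next
    case False
    then have "\<bar>s - t\<bar> = s - t" "t \<le> s" by auto
    then show ?thesis using *[OF st(3) \<open>t \<le> s\<close> st(2)] dist_len_sym[of l "edge_point u v s"]
      by (simp only:)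
  qed
qed

text \<open>The image of an arc under \<open>\<phi>\<close> contains the interval between \<open>\<phi> x\<close> and \<open>\<phi> y\<close>. Up to a null
  set it is covered by the images of countably many maximal half-edges, and the image of a half-edge
  is no longer than the half-edge itself.\<close>

lemma dist_len_Lipschitz:
  assumes V: "countable V" and l: "\<forall>e\<in>E. 0 \<le> l e" and x: "x \<in> points V E"
    and lip: "\<And>u v s t. \<lbrakk>{u, v} \<in> E; 0 \<le> s; s \<le> 1; 0 \<le> t; t \<le> 1\<rbrakk> \<Longrightarrow>
      \<bar>\<phi> (edge_point u v s) - \<phi> (edge_point u v t)\<bar> \<le> l {u, v} * \<bar>s - t\<bar>"
  shows "ennreal \<bar>\<phi> x - \<phi> y\<bar> \<le> dist_len V E l x y"
  unfolding dist_len_def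
proof (rule INF_greatest)
  let ?X = "complex_top V E"
  fix P assume P: "P \<in> arcs_between ?X x y"
  obtain g where g: "pathin ?X g" "g 0 = x" "g 1 = y" "P = g ` {0..1}"
    using arcs_between_path[OF P] x by auto
  have cl: "closedin ?X P" using closedin_path_image g by auto
  have PV: "P \<subseteq> points V E" using closedin_subset[OF cl] by simp
  have contedge: "continuous_on {0..1} (\<phi> \<circ> edge_point u v)" if uv: "{u, v} \<in> E" for u v
  proof (rule lipschitz_on_continuous_on)
    show "(l {u, v})-lipschitz_on {0..1} (\<phi> \<circ> edge_point u v)"
      by (rule lipschitz_onI) (use lip[OF uv] l uv in \<open>auto simp: dist_real_def\<close>)
  qed
  then have cont\<phi>: "continuous_map ?X euclideanreal \<phi>" by (rule continuous_from_complex)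
  have contparam: "continuous_on {0..1} (\<phi> \<circ> param e)" if "e \<in> E" for e
    using contedge[OF tail_head_edge[OF that]] by (simp add: param_def)
  have lipparam: "\<bar>\<phi> (param e s) - \<phi> (param e t)\<bar> \<le> l e * \<bar>s - t\<bar>"
    if "e \<in> E" "0 \<le> s" "s \<le> 1" "0 \<le> t" "t \<le> 1" for e s t
    using lip[OF tail_head_edge[OF that(1)] that(2-)] edge_eq_tail_head(1)[OF that(1)]
    by (simp add: param_def)
  have "\<forall>e\<in>E. \<exists>Z K. countable Z \<and> countable K \<and> K \<subseteq> components (footprint P e) \<and> footprint P e \<subseteq> Z \<union> \<Union>K"
    using footprint_path_cover[OF g(1)] unfolding g(4) by metis
  then obtain Z K where ZK: "\<And>e. e \<in> E \<Longrightarrow> countable (Z e)" "\<And>e. e \<in> E \<Longrightarrow> countable (K e)"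
    "\<And>e. e \<in> E \<Longrightarrow> K e \<subseteq> components (footprint P e)"
    "\<And>e. e \<in> E \<Longrightarrow> footprint P e \<subseteq> Z e \<union> \<Union>(K e)" by metis
  have cE: "countable E"
  proof (rule countable_subset)
    show "E \<subseteq> {e. finite e \<and> e \<subseteq> V}" using ugraph by (auto simp: ugraph_def intro: card_ge_0_finite)
    show "countable {e. finite e \<and> e \<subseteq> V}" using V by (rule countable_Collect_finite_subset)
  qed
  define N where "N = \<phi> ` vertex_point ` V \<union> (\<Union>e\<in>E. (\<lambda>t. \<phi> (param e t)) ` Z e)"
  have cN: "countable N" unfolding N_def using V cE ZK(1) by auto
  define A where "A = (\<lambda>(e, T). \<phi> ` param e ` T)"
  have cover: "\<phi> ` P \<subseteq> N \<union> (\<Union>k\<in>Sigma E K. A k)"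
  proof
    fix r assume "r \<in> \<phi> ` P"
    then obtain p where p: "p \<in> P" "r = \<phi> p" by blast
    then have "p \<in> points V E" using PV by blast
    then show "r \<in> N \<union> (\<Union>k\<in>Sigma E K. A k)"
    proof (cases rule: points_cases)
      case (vertex v)
      then show ?thesis using p by (auto simp: N_def)
    next
      case (inner u v t)
      let ?e = "{u, v}"
      have "p \<in> edge_set V E ?e" using inner edge_set_eq[of u v] by auto
      then obtain s where s: "s \<in> {0..1}" "p = param ?e s" using edge_set_param[OF inner(1)] by blast
      then have "s \<in> footprint P ?e" using p by (auto simp: footprint_def)
      then consider "s \<in> Z ?e" | T where "T \<in> K ?e" "s \<in> T" using ZK(4)[OF inner(1)] by blast
      then show ?thesis
      proof cases
        case 1
        then show ?thesis using inner(1) p(2) s(2) unfolding N_def by blast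
      next
        case 2
        then have "r \<in> A (?e, T)" using s p by (simp add: A_def)
        then show ?thesis using 2 inner(1) by blast
      qed
    qed
  qed
  have A: "A (e, T) \<in> sets lborel \<and> emeasure lborel (A (e, T)) \<le> ennreal (l e) * emeasure lborel T"
    if e: "e \<in> E" and T: "T \<in> K e" for e T
  proof -
    have TC: "T \<in> components (footprint P e)" using ZK(3)[OF e] T by blast
    then obtain a b where ab: "a \<le> b" "T = {a..b}" using component_footprint[OF cl e] by metis
    have "T \<subseteq> {0..1}" using in_components_subset[OF TC] by (auto simp: footprint_def)
    then have T01: "0 \<le> a" "b \<le> 1" using ab by auto
    have AT: "A (e, T) = (\<phi> \<circ> param e) ` {a..b}" by (simp add: A_def ab image_comp o_def image_image)
    have "compact (A (e, T))" unfolding AT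
      by (intro compact_continuous_image compact_Icc continuous_on_subset[OF contparam[OF e]])
        (use T01 in auto)
    moreover have "A (e, T) \<noteq> {}" unfolding AT using ab by simp
    ultimately obtain m where m: "m \<in> A (e, T)" "\<forall>r\<in>A (e, T). m \<le> r"
      using compact_attains_inf[of "A (e, T)"] by metis
    then obtain t0 where t0: "t0 \<in> {a..b}" "m = \<phi> (param e t0)" unfolding AT by auto
    have "A (e, T) \<subseteq> {m..m + l e * (b - a)}"
    proof
      fix r assume r: "r \<in> A (e, T)"
      then obtain t where t: "t \<in> {a..b}" "r = \<phi> (param e t)" unfolding AT by auto
      have "\<bar>r - m\<bar> \<le> l e * \<bar>t - t0\<bar>" using lipparam[OF e, of t t0] t t0 T01 by auto
      also have "\<dots> \<le> l e * (b - a)" using t t0 l e by (intro mult_left_mono) auto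
      finally show "r \<in> {m..m + l e * (b - a)}" using m r by auto
    qed
    then have "emeasure lborel (A (e, T)) \<le> emeasure lborel {m..m + l e * (b - a)}"
      by (intro emeasure_mono) auto
    also have "\<dots> = ennreal (l e) * emeasure lborel T" using l e ab by (simp add: ennreal_mult)
    finally show ?thesis using \<open>compact (A (e, T))\<close> by (simp add: borel_compact)
  qed
  have "connectedin euclideanreal (\<phi> ` P)"
    using connectedin_continuous_map_image[OF cont\<phi>] connectedin_path_image[OF g(1)] g(4) by blast
  then have "connected (\<phi> ` P)" by simp
  moreover have "min (\<phi> x) (\<phi> y) \<in> \<phi> ` P" "max (\<phi> x) (\<phi> y) \<in> \<phi> ` P"
    using g by (auto simp: min_def max_def intro!: imageI)
  ultimately have sub: "{min (\<phi> x) (\<phi> y)..max (\<phi> x) (\<phi> y)} \<subseteq> \<phi> ` P"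
    by (rule connected_contains_Icc)
  have Nb: "N \<in> null_sets lborel" using countable_imp_null_set_lborel[OF cN] .
  have cS: "countable (Sigma E K)" using cE ZK(2) by (intro countable_SIGMA) auto
  have Ab: "A k \<in> sets lborel" if "k \<in> Sigma E K" for k using A that by auto
  have UAb: "(\<Union>k\<in>Sigma E K. A k) \<in> sets lborel"
    using cS Ab by (intro sets.countable_UN') auto
  have "ennreal \<bar>\<phi> x - \<phi> y\<bar> = emeasure lborel {min (\<phi> x) (\<phi> y)..max (\<phi> x) (\<phi> y)}"
    by (auto simp: min_def max_def abs_if)
  also have "\<dots> \<le> emeasure lborel ((\<Union>k\<in>Sigma E K. A k) \<union> N)"
  proof (rule emeasure_mono)
    show "{min (\<phi> x) (\<phi> y)..max (\<phi> x) (\<phi> y)} \<subseteq> (\<Union>k\<in>Sigma E K. A k) \<union> N" using sub cover by blast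
  qed (use Nb UAb in auto)
  also have "\<dots> = emeasure lborel (\<Union>k\<in>Sigma E K. A k)"
    using Nb UAb by (rule emeasure_Un_null_set[rotated])
  also have "\<dots> \<le> (\<Sum>\<^sub>\<infinity>k\<in>Sigma E K. emeasure lborel (A k))"
    by (rule emeasure_UN_le_infsum[OF cS Ab])
  also have "\<dots> \<le> (\<Sum>\<^sub>\<infinity>k\<in>Sigma E (\<lambda>e. components (footprint P e)). case k of (e, T) \<Rightarrow> ennreal (l e) * emeasure lborel T)"
    by (rule infsum_mono_neutral) (use ZK(3) A in \<open>auto intro: nonneg_summable_on_complete\<close>)
  also have "\<dots> = arc_length V E l P"
    unfolding arc_length_components[OF cl l] infsum_Sigma_ennreal by simp
  finally show "ennreal \<bar>\<phi> x - \<phi> y\<bar> \<le> arc_length V E l P" .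
qed

end

section \<open>Components and vertex-ends\<close>

context graph_complex
begin

definition eventually_in :: "(nat \<Rightarrow> 'a) \<Rightarrow> 'a set \<Rightarrow> bool" where
  "eventually_in r C \<longleftrightarrow> (\<forall>\<^sub>F n in sequentially. r n \<in> C)"

lemma sym_adj_minus: "sym (adj_minus V E S)"
  by (auto simp: sym_def adj_minus_def insert_commute)

lemma reach_sym: "(x, y) \<in> (adj_minus V E S)\<^sup>* \<Longrightarrow> (y, x) \<in> (adj_minus V E S)\<^sup>*"
  using sym_rtrancl[OF sym_adj_minus] by (rule symD)

lemma reach_mono: "S \<subseteq> S' \<Longrightarrow> (x, y) \<in> (adj_minus V E S')\<^sup>* \<Longrightarrow> (x, y) \<in> (adj_minus V E S)\<^sup>*"
  by (erule rtrancl_mono[THEN subsetD, rotated]) (auto simp: adj_minus_def)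

lemma comps_minusI: "x \<in> V - S \<Longrightarrow> (adj_minus V E S)\<^sup>* `` {x} \<in> comps_minus V E S"
  by (auto simp: comps_minus_def)

lemma comps_minus_reach:
  assumes C: "C \<in> comps_minus V E S" and x: "x \<in> C"
  shows "y \<in> C \<longleftrightarrow> (x, y) \<in> (adj_minus V E S)\<^sup>*"
proof -
  obtain z where z: "C = (adj_minus V E S)\<^sup>* `` {z}" using C by (auto simp: comps_minus_def)
  then have "(z, x) \<in> (adj_minus V E S)\<^sup>*" using x by simp
  then show ?thesis unfolding z by (meson Image_singleton_iff reach_sym rtrancl_trans)
qed

lemma comps_minus_unique:
  assumes "C \<in> comps_minus V E S" "D \<in> comps_minus V E S" "x \<in> C" "x \<in> D"
  shows "C = D"
  using comps_minus_reach[OF assms(1,3)] comps_minus_reach[OF assms(2,4)] by blast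

lemma comps_minus_subset:
  assumes "C \<in> comps_minus V E S"
  shows "C \<subseteq> V - S"
proof
  fix y assume y: "y \<in> C"
  obtain z where z: "z \<in> V - S" "C = (adj_minus V E S)\<^sup>* `` {z}" using assms by (auto simp: comps_minus_def)
  then have "(z, y) \<in> (adj_minus V E S)\<^sup>*" using y by simp
  then show "y \<in> V - S" using z(1) by (induction) (auto simp: adj_minus_def)
qed

lemma comps_minus_boundary:
  assumes C: "C \<in> comps_minus V E S" and x: "x \<in> C" and xy: "{x, y} \<in> E" and y: "y \<notin> C"
  shows "y \<in> S"
proof (rule ccontr)
  assume "y \<notin> S"
  then have "(x, y) \<in> adj_minus V E S"
    using comps_minus_subset[OF C] x xy edgeD[OF xy] by (auto simp: adj_minus_def)
  then show False using comps_minus_reach[OF C x] y by blast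
qed

lemma raysD:
  assumes "r \<in> rays V E"
  shows "r n \<in> V" "inj r" "{r n, r (Suc n)} \<in> E"
  using assms by (auto simp: rays_def)

lemma ray_tail: "r \<in> rays V E \<Longrightarrow> (\<lambda>n. r (n + N)) \<in> rays V E"
  by (auto simp: rays_def intro!: injI dest: injD)

lemma eventually_notin_finite:
  assumes "inj r" "finite S"
  shows "\<forall>\<^sub>F n in sequentially. r n \<notin> S"
proof -
  have "finite (r -` S)" using assms finite_vimageI by blast
  then obtain N where N: "\<And>n. r n \<in> S \<Longrightarrow> n \<le> N" unfolding finite_nat_set_iff_bounded_le by auto
  have "r n \<notin> S" if "Suc N \<le> n" for n using N[of n] that by auto
  then show ?thesis unfolding eventually_sequentially by blast
qed

lemma ray_reach:
  assumes r: "r \<in> rays V E" and N: "\<And>n. N \<le> n \<Longrightarrow> r n \<notin> S" and "N \<le> n"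
  shows "(r N, r n) \<in> (adj_minus V E S)\<^sup>*"
  using \<open>N \<le> n\<close>
proof (induction n rule: dec_induct)
  case (step n)
  have "(r n, r (Suc n)) \<in> adj_minus V E S"
    using N[of n] N[of "Suc n"] step(1) raysD(1,3)[OF r, of n] raysD(1)[OF r, of "Suc n"]
    by (auto simp: adj_minus_def)
  then show ?case using step(3) by (rule rtrancl_into_rtrancl[rotated])
qed simp

lemma ray_component:
  assumes r: "r \<in> rays V E" and S: "finite S"
  obtains C where "C \<in> comps_minus V E S" "eventually_in r C"
proof -
  obtain N where N: "\<And>n. N \<le> n \<Longrightarrow> r n \<notin> S"
    using eventually_notin_finite[OF raysD(2)[OF r] S] unfolding eventually_sequentially by blast
  show ?thesis
  proof (rule that)
    show "(adj_minus V E S)\<^sup>* `` {r N} \<in> comps_minus V E S"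
      by (rule comps_minusI) (use N raysD(1)[OF r] in auto)
    show "eventually_in r ((adj_minus V E S)\<^sup>* `` {r N})"
      unfolding eventually_in_def eventually_sequentially
      by (rule exI[of _ N]) (use ray_reach[OF r N] in simp)
  qed
qed

lemma eventually_in_meet:
  assumes "eventually_in r C" "eventually_in r D"
  obtains n where "r n \<in> C" "r n \<in> D"
  using eventually_happens'[OF sequentially_bot eventually_conj[OF assms[unfolded eventually_in_def]]] by blast

lemma eventually_in_unique:
  assumes "C \<in> comps_minus V E S" "D \<in> comps_minus V E S" "eventually_in r C" "eventually_in r D"
  shows "C = D"
  using eventually_in_meet[OF assms(3,4)] comps_minus_unique[OF assms(1,2)] by metis

text \<open>That \<open>S\<close> does not separate the rays only gives a connection between some of their vertices. To
  connect their tails, \<open>S\<close> is enlarged by the initial segments that precede the tails.\<close>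

lemma end_equiv_same_component:
  assumes rr: "(r, r') \<in> end_equiv V E" and S: "finite S" "S \<subseteq> V"
    and C: "C \<in> comps_minus V E S" and rC: "eventually_in r C"
  shows "eventually_in r' C"
proof -
  have r: "r \<in> rays V E" and r': "r' \<in> rays V E" using rr by (auto simp: end_equiv_def)
  obtain C' where C': "C' \<in> comps_minus V E S" "eventually_in r' C'" using ray_component[OF r' S(1)] .
  obtain N where N: "\<And>n. N \<le> n \<Longrightarrow> r n \<in> C"
    using rC unfolding eventually_in_def eventually_sequentially by blast
  obtain N' where N': "\<And>n. N' \<le> n \<Longrightarrow> r' n \<in> C'"
    using C'(2) unfolding eventually_in_def eventually_sequentially by blast
  \<comment> \<open>The connection below avoids \<open>S'\<close>, so it starts and ends on the tails.\<close>
  define S' where "S' = S \<union> r ` {..<N} \<union> r' ` {..<N'}"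
  have "finite S'" "S' \<subseteq> V" using S raysD(1)[OF r] raysD(1)[OF r'] by (auto simp: S'_def)
  then have "\<not> separates V E S' (range r) (range r')" using rr by (auto simp: end_equiv_def)
  then obtain i j where ij: "r i \<notin> S'" "r' j \<notin> S'" "(r i, r' j) \<in> (adj_minus V E S')\<^sup>*"
    unfolding separates_def by blast
  have "N \<le> i" "N' \<le> j" using ij(1,2) by (auto simp: S'_def not_less[symmetric])
  then have "r i \<in> C" "r' j \<in> C'" using N N' by auto
  moreover have "(r i, r' j) \<in> (adj_minus V E S)\<^sup>*"
    by (rule reach_mono[OF _ ij(3)]) (auto simp: S'_def)
  ultimately have "r' j \<in> C" using comps_minus_reach[OF C] by blast
  then have "C = C'" using comps_minus_unique[OF C C'(1)] \<open>r' j \<in> C'\<close> by blast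
  then show ?thesis using C' by simp
qed

lemma end_equivI:
  assumes r: "r \<in> rays V E" "r' \<in> rays V E"
    and C: "\<And>S. finite S \<Longrightarrow> S \<subseteq> V \<Longrightarrow> \<exists>C\<in>comps_minus V E S. eventually_in r C \<and> eventually_in r' C"
  shows "(r, r') \<in> end_equiv V E"
  unfolding end_equiv_def
proof (intro CollectI case_prodI conjI notI, goal_cases)
  case 3
  then obtain S where S: "finite S" "S \<subseteq> V" "separates V E S (range r) (range r')" by blast
  obtain C where C: "C \<in> comps_minus V E S" "eventually_in r C" "eventually_in r' C"
    using C[OF S(1,2)] by blast
  obtain n where n: "r n \<in> C" using eventually_in_meet[OF C(2,2)] .
  obtain m where m: "r' m \<in> C" using eventually_in_meet[OF C(3,3)] .
  have "(r n, r' m) \<in> (adj_minus V E S)\<^sup>*" using comps_minus_reach[OF C(1) n] m by blast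
  moreover have "r n \<notin> S" "r' m \<notin> S" using comps_minus_subset[OF C(1)] n m by auto
  ultimately show False using S(3) unfolding separates_def by blast
qed (use r in auto)

lemma equiv_end_equiv: "equiv (rays V E) (end_equiv V E)"
proof (rule equivI)
  show "end_equiv V E \<subseteq> rays V E \<times> rays V E" by (auto simp: end_equiv_def)
  show "refl_on (rays V E) (end_equiv V E)"
  proof (rule refl_onI)
    fix r assume r: "r \<in> rays V E"
    then show "(r, r) \<in> end_equiv V E"
      by (rule end_equivI[OF r]) (metis r ray_component)
  qed
  show "sym (end_equiv V E)"
  proof (rule symI)
    fix r r' assume rr: "(r, r') \<in> end_equiv V E"
    then have r: "r \<in> rays V E" "r' \<in> rays V E" by (auto simp: end_equiv_def)
    show "(r', r) \<in> end_equiv V E"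
      by (rule end_equivI[OF r(2,1)]) (metis r(1) ray_component end_equiv_same_component[OF rr])
  qed
  show "trans (end_equiv V E)"
  proof (rule transI)
    fix r r' r'' assume rr: "(r, r') \<in> end_equiv V E" "(r', r'') \<in> end_equiv V E"
    then have r: "r \<in> rays V E" "r'' \<in> rays V E" by (auto simp: end_equiv_def)
    show "(r, r'') \<in> end_equiv V E"
      by (rule end_equivI[OF r]) (metis r(1) ray_component end_equiv_same_component[OF rr(1)] end_equiv_same_component[OF rr(2)])
  qed
qed

lemma vertex_endsD:
  assumes \<omega>: "\<omega> \<in> vertex_ends V E"
  shows "\<exists>r. r \<in> \<omega>" "r \<in> \<omega> \<Longrightarrow> r \<in> rays V E" "r \<in> \<omega> \<Longrightarrow> r' \<in> \<omega> \<longleftrightarrow> (r, r') \<in> end_equiv V E"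
proof -
  obtain r0 where r0: "r0 \<in> rays V E" "\<omega> = end_equiv V E `` {r0}"
    using \<omega> by (auto simp: vertex_ends_def quotient_def)
  have refl: "(r0, r0) \<in> end_equiv V E" using equiv_end_equiv r0(1) by (meson equivE refl_onD)
  then show "\<exists>r. r \<in> \<omega>" using r0 by auto
  show "r \<in> \<omega> \<Longrightarrow> r \<in> rays V E" using r0 by (auto simp: end_equiv_def)
  show "r \<in> \<omega> \<Longrightarrow> r' \<in> \<omega> \<longleftrightarrow> (r, r') \<in> end_equiv V E"
    unfolding r0(2) Image_singleton_iff using equiv_end_equiv by (meson equivE symD transD)
qed

lemma vertex_ends_eqI:
  assumes "\<omega> \<in> vertex_ends V E" "\<omega>' \<in> vertex_ends V E" "r \<in> \<omega>" "r' \<in> \<omega>'" "(r, r') \<in> end_equiv V E"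
  shows "\<omega> = \<omega>'"
proof -
  have "r' \<in> \<omega>" using vertex_endsD(3)[OF assms(1,3)] assms(5) by blast
  then show ?thesis using vertex_endsD(3)[OF assms(1), of r'] vertex_endsD(3)[OF assms(2,4)] by blast
qed

text \<open>A tail of a ray is equivalent to the ray, so whether an end has a ray in \<open>C\<close> can be read off
  from any of its rays.\<close>

lemma end_ray_in_iff:
  assumes \<omega>: "\<omega> \<in> vertex_ends V E" and r: "r \<in> \<omega>" and S: "finite S" "S \<subseteq> V"
    and C: "C \<in> comps_minus V E S"
  shows "(\<exists>r'\<in>\<omega>. range r' \<subseteq> C) \<longleftrightarrow> eventually_in r C"
proof
  assume "\<exists>r'\<in>\<omega>. range r' \<subseteq> C"
  then obtain r' where r': "r' \<in> \<omega>" "range r' \<subseteq> C" by blast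
  then have "\<forall>n. r' n \<in> C" by blast
  then have "eventually_in r' C" by (simp add: eventually_in_def)
  moreover have "(r', r) \<in> end_equiv V E" using vertex_endsD(3)[OF \<omega> r'(1)] r by blast
  ultimately show "eventually_in r C" using end_equiv_same_component[OF _ S C] by blast
next
  assume rC: "eventually_in r C"
  then obtain N where N: "\<And>n. N \<le> n \<Longrightarrow> r n \<in> C"
    unfolding eventually_in_def eventually_sequentially by blast
  let ?r = "\<lambda>n. r (n + N)"
  have ray: "r \<in> rays V E" using vertex_endsD(2)[OF \<omega> r] .
  have "(r, ?r) \<in> end_equiv V E"
  proof (rule end_equivI[OF ray ray_tail[OF ray]])
    fix S :: "'a set" assume "finite S" "S \<subseteq> V"
    then obtain D where D: "D \<in> comps_minus V E S" "eventually_in r D" using ray_component[OF ray] by metis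
    then have "eventually_in ?r D"
      unfolding eventually_in_def using eventually_sequentially_seg[of "\<lambda>n. r n \<in> D" N] by simp
    then show "\<exists>C\<in>comps_minus V E S. eventually_in r C \<and> eventually_in ?r C" using D by blast
  qed
  then have "?r \<in> \<omega>" using vertex_endsD(3)[OF \<omega> r] by blast
  then show "\<exists>r'\<in>\<omega>. range r' \<subseteq> C" using N by (intro bexI[of _ ?r]) auto
qed

lemma end_comp:
  assumes \<omega>: "\<omega> \<in> vertex_ends V E" and r: "r \<in> \<omega>" and S: "finite S" "S \<subseteq> V"
  shows "end_comp V E S \<omega> \<in> comps_minus V E S" "eventually_in r (end_comp V E S \<omega>)"
proof -
  obtain C where C: "C \<in> comps_minus V E S" "eventually_in r C"
    using ray_component[OF vertex_endsD(2)[OF \<omega> r] S(1)] .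
  have "end_comp V E S \<omega> = C"
    unfolding end_comp_def
  proof (rule the_equality)
    show "C \<in> comps_minus V E S \<and> (\<exists>r\<in>\<omega>. range r \<subseteq> C)"
      using C end_ray_in_iff[OF \<omega> r S C(1)] by blast
    fix D assume "D \<in> comps_minus V E S \<and> (\<exists>r\<in>\<omega>. range r \<subseteq> D)"
    then have "D \<in> comps_minus V E S" "eventually_in r D"
      using end_ray_in_iff[OF \<omega> r S, of D] by auto
    then show "D = C" using C eventually_in_unique by metis
  qed
  then show "end_comp V E S \<omega> \<in> comps_minus V E S" "eventually_in r (end_comp V E S \<omega>)" using C by auto
qed

text \<open>Let a component of \<open>G - S k\<close> be given for each \<open>k\<close>, decreasing in \<open>k\<close>. From a vertex of the
  \<open>k\<close>-th component that is outside the next one, a step along a shortest path inside the \<open>k\<close>-th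
  component to the next one either enters a later component or shortens the distance to the next
  one. Iterating such steps gives a walk that never repeats a vertex.\<close>

lemma ray_through_components:
  assumes C: "\<And>k. C k \<in> comps_minus V E (S k)" and dec: "\<And>k. C (Suc k) \<subseteq> C k"
    and Sex: "\<And>x. x \<in> V \<Longrightarrow> \<exists>k. x \<in> S k"
  obtains r where "r \<in> rays V E" "\<And>k. eventually_in r (C k)"
proof -
  have CV: "C k \<subseteq> V - S k" for k using comps_minus_subset[OF C] .
  have Cne: "C k \<noteq> {}" for k using C[of k] by (auto simp: comps_minus_def)
  have anti: "C m \<subseteq> C n" if "n \<le> m" for m n
    by (rule lift_Suc_antimono_le[of C, OF dec that])
  \<comment> \<open>The index of the last component that contains \<open>x\<close>.\<close>
  define lev where "lev = (\<lambda>x. LEAST k. x \<notin> C (Suc k))"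
  have lev: "x \<in> C (lev x)" "x \<notin> C (Suc (lev x))" if x: "x \<in> C 0" for x
  proof -
    obtain k where "x \<in> S k" using Sex[of x] CV[of 0] x by blast
    then have "x \<notin> C k" using CV by blast
    then have "x \<notin> C (Suc k)" using dec by blast
    then show "x \<notin> C (Suc (lev x))" unfolding lev_def by (rule LeastI)
    show "x \<in> C (lev x)"
    proof (cases "lev x")
      case (Suc j)
      then have "j < lev x" by simp
      then have "\<not> x \<notin> C (Suc j)" unfolding lev_def by (rule not_less_Least)
      then show ?thesis using Suc by simp
    qed (use that in simp)
  qed
  have lev_ge: "k \<le> lev x" if "x \<in> C k" for x k
  proof (rule ccontr)
    assume "\<not> k \<le> lev x"
    then have "C k \<subseteq> C (Suc (lev x))" using anti by simp
    moreover have "x \<in> C 0" using that anti[of 0 k] by blast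
    ultimately show False using lev(2)[of x] that by blast
  qed
  \<comment> \<open>The distance of \<open>x\<close> from the next component, measured inside the component at level \<open>lev x\<close>.\<close>
  define far where "far = (\<lambda>x. LEAST m. \<exists>z\<in>C (Suc (lev x)). (x, z) \<in> adj_minus V E (S (lev x)) ^^ m)"
  define better where "better = (\<lambda>x y. lev x < lev y \<or> lev x = lev y \<and> far y < far x)"
  have step: "\<exists>y. y \<in> C 0 \<and> {x, y} \<in> E \<and> better x y" if x: "x \<in> C 0" for x
  proof -
    let ?k = "lev x"
    let ?A = "adj_minus V E (S ?k)"
    obtain z where z: "z \<in> C (Suc ?k)" using Cne by blast
    then have "z \<in> C ?k" using dec by blast
    then have "(x, z) \<in> ?A\<^sup>*" using comps_minus_reach[OF C lev(1)[OF x]] by blast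
    then obtain m where "(x, z) \<in> ?A ^^ m" using rtrancl_imp_relpow by metis
    then have ex: "\<exists>m. \<exists>z\<in>C (Suc ?k). (x, z) \<in> ?A ^^ m" using z by blast
    have "\<exists>z\<in>C (Suc ?k). (x, z) \<in> ?A ^^ far x"
      unfolding far_def by (rule LeastI_ex[OF ex])
    then obtain z' where z': "z' \<in> C (Suc ?k)" "(x, z') \<in> ?A ^^ far x" by blast
    have "far x \<noteq> 0"
    proof
      assume "far x = 0"
      then have "x = z'" using z'(2) by simp
      then show False using z'(1) lev(2)[OF x] by simp
    qed
    then obtain m where m: "far x = Suc m" using not0_implies_Suc by blast
    then obtain y where y: "(x, y) \<in> ?A" "(y, z') \<in> ?A ^^ m" using z'(2) relpow_Suc_D2 by metis
    have "(x, y) \<in> ?A\<^sup>*" using y(1) by blast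
    then have yC: "y \<in> C ?k" using comps_minus_reach[OF C lev(1)[OF x]] by blast
    have "better x y"
    proof (cases "lev y = ?k")
      case True
      then have "far y \<le> m" unfolding far_def using y(2) z'(1) by (intro Least_le) auto
      then show ?thesis using True m by (simp add: better_def)
    next
      case False
      then show ?thesis using lev_ge[OF yC] by (simp add: better_def)
    qed
    moreover have "y \<in> C 0" using yC anti[of 0 ?k] by blast
    ultimately show ?thesis using y(1) by (auto simp: adj_minus_def)
  qed
  obtain x0 where "x0 \<in> C 0" using Cne by blast
  then obtain r where r: "\<And>n. r n \<in> C 0" "\<And>n. {r n, r (Suc n)} \<in> E \<and> better (r n) (r (Suc n))"
    using dependent_nat_choice[of "\<lambda>_ x. x \<in> C 0" "\<lambda>_ x y. {x, y} \<in> E \<and> better x y"] step by blast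
  have trans: "better x z" if "better x y" "better y z" for x y z
    using that by (auto simp: better_def)
  have mono: "better (r m) (r n)" if "m < n" for m n
    using that by (induction rule: less_Suc_induct) (use r(2) trans in blast)+
  have "inj r"
  proof (rule linorder_injI)
    fix m n :: nat assume "m < n"
    then show "r m \<noteq> r n" using mono[of m n] by (auto simp: better_def)
  qed
  then have ray: "r \<in> rays V E" using r CV by (auto simp: rays_def)
  have levmono: "lev (r m) \<le> lev (r n)" if "m \<le> n" for m n
    using mono[of m n] that by (cases "m = n") (auto simp: better_def)
  have "\<exists>n. k \<le> lev (r n)" for k
  proof (induction k)
    case (Suc k)
    then obtain N where N: "k \<le> lev (r N)" by blast
    show ?case
    proof (rule ccontr)
      assume no: "\<not> ?thesis"
      have eq: "lev (r n) = k" if "N \<le> n" for n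
        using no levmono[OF that] N by (metis le_antisym not_less_eq_eq order_trans)
      have "far (r (N + i)) + i \<le> far (r N)" for i
      proof (induction i)
        case (Suc i)
        have "better (r (N + i)) (r (N + Suc i))" using r(2)[of "N + i"] by simp
        then have "far (r (N + Suc i)) < far (r (N + i))" using eq[of "N + i"] eq[of "N + Suc i"]
          by (auto simp: better_def)
        then show ?case using Suc by simp
      qed simp
      from this[of "Suc (far (r N))"] show False by simp
    qed
  qed simp
  then have "eventually_in r (C k)" for k
  proof -
    obtain N where N: "k \<le> lev (r N)" using \<open>\<And>k. \<exists>n. k \<le> lev (r n)\<close> by blast
    have "r n \<in> C k" if "N \<le> n" for n
      using lev(1)[OF r(1)[of n]] levmono[OF that] N anti by (meson order_trans subsetD)
    then show ?thesis unfolding eventually_in_def eventually_sequentially by blast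
  qed
  then show ?thesis using that ray by blast
qed

end

section \<open>Distances in a graph with vertex weights\<close>

text \<open>The indicator function of \<open>C\<close> on the vertices, extended linearly over the edges.\<close>

definition mass :: "'a set \<Rightarrow> 'a point \<Rightarrow> real" where
  "mass C p = (\<Sum>w\<in>supp p. if w \<in> C then p w else 0)"

lemma mass_vertex_point [simp]: "mass C (vertex_point v) = (if v \<in> C then 1 else 0)"
  by (simp add: mass_def) (simp add: vertex_point_def)

lemma mass_edge_point:
  assumes "u \<noteq> v"
  shows "mass C (edge_point u v t) = (if u \<in> C then 1 - t else 0) + (if v \<in> C then t else 0)"
proof -
  have "mass C (edge_point u v t) = (\<Sum>w\<in>{u, v}. if w \<in> C then edge_point u v t w else 0)"
    unfolding mass_def
  proof (rule sum.mono_neutral_left)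
    show "\<forall>i\<in>{u, v} - supp (edge_point u v t). (if i \<in> C then edge_point u v t i else 0) = 0"
      by (auto simp: supp_def)
  qed (use supp_edge_point_subset[of u v t] in auto)
  then show ?thesis using assms by (simp add: edge_point_apply)
qed

text \<open>The enumeration of the vertices enters only through the weights of the vertices.\<close>

locale weighted_graph = graph_complex V E for V :: "'a set" and E +
  fixes w :: "'a \<Rightarrow> real" and l :: "'a set \<Rightarrow> real"
  assumes w_pos: "v \<in> V \<Longrightarrow> 0 < w v"
    and w_summable: "w summable_on V"
    and l_eq: "{u, v} \<in> E \<Longrightarrow> l {u, v} = (w u + w v) / 2"
begin

abbreviation d :: "'a point \<Rightarrow> 'a point \<Rightarrow> ennreal" where
  "d \<equiv> dist_len V E l"

definition total :: real where
  "total = infsum w V"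

lemma countable_V: "countable V"
proof -
  have "{x \<in> V. w x \<noteq> 0} = V" using w_pos by force
  then show ?thesis using summable_countable_real[OF w_summable] by simp
qed

lemma w_le_total: "v \<in> V \<Longrightarrow> w v \<le> total"
  unfolding total_def using finite_sum_le_infsum[OF w_summable, of "{v}"] w_pos by (simp add: less_imp_le)

lemma total_pos: "v \<in> V \<Longrightarrow> 0 < total"
  using w_le_total w_pos by force

lemma l_pos: "{u, v} \<in> E \<Longrightarrow> 0 < l {u, v}"
  using l_eq[of u v] w_pos[of u] w_pos[of v] edgeD[of u v] by simp

lemma l_nonneg: "\<forall>e\<in>E. 0 \<le> l e"
proof
  fix e assume "e \<in> E"
  then show "0 \<le> l e" using l_pos edge_cases by (metis less_imp_le)
qed

lemma l_le_total: "{u, v} \<in> E \<Longrightarrow> l {u, v} \<le> total"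
  using l_eq[of u v] w_le_total[of u] w_le_total[of v] edgeD[of u v] by simp

lemma half_w_le_l:
  assumes "{u, v} \<in> E"
  shows "w u / 2 \<le> l {u, v}" "w v / 2 \<le> l {u, v}"
  using l_eq[OF assms] w_pos[of u] w_pos[of v] edgeD[OF assms] by auto

lemma small_tail:
  assumes "0 < \<epsilon>"
  obtains S where "finite S" "S \<subseteq> V" "\<And>F. finite F \<Longrightarrow> F \<subseteq> V - S \<Longrightarrow> sum w F \<le> \<epsilon>"
proof -
  obtain S where S: "finite S" "S \<subseteq> V" "dist (sum w S) (infsum w V) \<le> \<epsilon>"
    using infsum_finite_approximation[OF w_summable assms] by blast
  show ?thesis
  proof (rule that[OF S(1,2)])
    fix F assume F: "finite F" "F \<subseteq> V - S"
    have "sum w S + sum w F = sum w (S \<union> F)"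
      using F S by (subst sum.union_disjoint) auto
    also have "\<dots> \<le> infsum w V"
      using F S w_pos by (intro finite_sum_le_infsum w_summable) (auto simp: less_imp_le)
    finally show "sum w F \<le> \<epsilon>" using S(3) by (simp add: dist_real_def)
  qed
qed

lemmas d_self = dist_len_self[OF l_nonneg]
lemmas d_triangle = dist_len_triangle[OF l_nonneg]
lemmas d_sym = dist_len_sym[of l]
lemmas d_edge_le = dist_len_edge_le[OF _ l_nonneg]
lemmas d_Lipschitz = dist_len_Lipschitz[OF countable_V l_nonneg]

subsection \<open>Lower bounds\<close>

text \<open>Along an edge \<open>mass C\<close> is constant unless exactly one end of the edge is in \<open>C\<close>.\<close>

lemma mass_bound:
  assumes x: "x \<in> points V E" and \<delta>: "0 \<le> \<delta>"
    and cut: "\<And>u v. {u, v} \<in> E \<Longrightarrow> u \<in> C \<Longrightarrow> v \<notin> C \<Longrightarrow> \<delta> \<le> l {u, v}"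
  shows "ennreal (\<delta> * \<bar>mass C x - mass C y\<bar>) \<le> d x y"
proof -
  have "ennreal \<bar>\<delta> * mass C x - \<delta> * mass C y\<bar> \<le> d x y"
  proof (rule d_Lipschitz[OF x])
    fix u v s t assume uv: "{u, v} \<in> E" and st: "0 \<le> s" "(s::real) \<le> 1" "0 \<le> t" "(t::real) \<le> 1"
    note m = mass_edge_point[OF edgeD(3)[OF uv]]
    have "\<bar>\<delta> * mass C (edge_point u v s) - \<delta> * mass C (edge_point u v t)\<bar> =
        \<delta> * \<bar>mass C (edge_point u v s) - mass C (edge_point u v t)\<bar>"
      using \<delta> by (simp add: right_diff_distrib[symmetric] abs_mult)
    also have "\<dots> \<le> l {u, v} * \<bar>s - t\<bar>"
    proof (cases "u \<in> C \<longleftrightarrow> v \<in> C")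
      case True
      then show ?thesis using l_pos[OF uv] by (simp add: m)
    next
      case False
      then have "\<bar>mass C (edge_point u v s) - mass C (edge_point u v t)\<bar> = \<bar>s - t\<bar>"
        by (auto simp: m)
      moreover have "\<delta> \<le> l {u, v}"
        using False cut[of u v] cut[of v u] uv by (auto simp: insert_commute)
      ultimately show ?thesis by (simp add: mult_right_mono)
    qed
    finally show "\<bar>\<delta> * mass C (edge_point u v s) - \<delta> * mass C (edge_point u v t)\<bar> \<le> l {u, v} * \<bar>s - t\<bar>" .
  qed
  then show ?thesis using \<delta> by (simp add: right_diff_distrib[symmetric] abs_mult)
qed

lemma mass_singleton:
  assumes "p \<in> points V E"
  shows "mass {v} p = p v"
  using assms
proof (cases rule: points_cases)
  case (vertex u)
  then have "mass {v} p = (if u = v then 1 else 0)" by simp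
  then show ?thesis using vertex by (auto simp: vertex_point_def)
next
  case (inner a b t)
  then have "mass {v} p = (if a = v then 1 - t else 0) + (if b = v then t else 0)"
    by (simp add: mass_edge_point)
  then show ?thesis using inner by (auto simp: edge_point_def)
qed

lemma coordinate_bound:
  assumes x: "x \<in> points V E" and y: "y \<in> points V E" and v: "v \<in> V"
  shows "ennreal (w v / 2 * \<bar>x v - y v\<bar>) \<le> d x y"
proof -
  have "ennreal (w v / 2 * \<bar>mass {v} x - mass {v} y\<bar>) \<le> d x y"
    by (rule mass_bound[OF x]) (use half_w_le_l w_pos[OF v] in auto)
  then show ?thesis using x y by (simp add: mass_singleton)
qed

text \<open>The edges leaving \<open>C\<close> all end in the finite set \<open>S\<close>, so half the minimal weight in \<open>S\<close> bounds their
  lengths from below.\<close>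

lemma component_bound:
  assumes S: "finite S" "S \<subseteq> V"
  obtains \<delta> where "0 < \<delta>" "\<And>C x y. C \<in> comps_minus V E S \<Longrightarrow> x \<in> points V E \<Longrightarrow>
    ennreal (\<delta> * \<bar>mass C x - mass C y\<bar>) \<le> d x y"
proof -
  define \<delta> where "\<delta> = Min (insert 1 ((\<lambda>s. w s / 2) ` S))"
  have pos: "0 < \<delta>" using S w_pos by (auto simp: \<delta>_def)
  have le: "\<delta> \<le> w s / 2" if "s \<in> S" for s
    unfolding \<delta>_def by (rule Min_le) (use S that in auto)
  show ?thesis
  proof (rule that[OF pos])
    fix C x y assume C: "C \<in> comps_minus V E S" and x: "x \<in> points V E"
    show "ennreal (\<delta> * \<bar>mass C x - mass C y\<bar>) \<le> d x y"
    proof (rule mass_bound[OF x])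
      fix u v assume uv: "{u, v} \<in> E" "u \<in> C" "v \<notin> C"
      then have "v \<in> S" using comps_minus_boundary[OF C] by blast
      then show "\<delta> \<le> l {u, v}" using le[of v] half_w_le_l(2)[OF uv(1)] by simp
    qed (use pos in simp)
  qed
qed

text \<open>The tent function of the edge \<open>{u, v}\<close>, which vanishes on all other edges. It keeps apart inner
  points of different edges at \<open>v\<close>: the coordinates at the other ends of these edges give no uniform
  bound, since the weights there may tend to 0.\<close>

lemma inner_edge_bound:
  assumes x: "x \<in> points V E" and uv: "{u, v} \<in> E"
  shows "ennreal \<bar>l {u, v} * min (x u) (x v) - l {u, v} * min (y u) (y v)\<bar> \<le> d x y"
proof (rule d_Lipschitz[OF x])
  fix a b s t assume ab: "{a, b} \<in> E" and st: "0 \<le> s" "(s::real) \<le> 1" "0 \<le> t" "(t::real) \<le> 1"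
  let ?f = "\<lambda>p. min (p u) (p v)"
  note nuv = edgeD(3)[OF uv] and nab = edgeD(3)[OF ab]
  have "\<bar>l {u, v} * ?f (edge_point a b s) - l {u, v} * ?f (edge_point a b t)\<bar> =
      l {u, v} * \<bar>?f (edge_point a b s) - ?f (edge_point a b t)\<bar>"
    using l_pos[OF uv] by (simp add: right_diff_distrib[symmetric] abs_mult)
  also have "\<dots> \<le> l {a, b} * \<bar>s - t\<bar>"
  proof (cases "{a, b} = {u, v}")
    case True
    then have "?f (edge_point a b r) = min r (1 - r)" for r
      using nab by (auto simp: doubleton_eq_iff edge_point_def)
    then have "\<bar>?f (edge_point a b s) - ?f (edge_point a b t)\<bar> \<le> \<bar>s - t\<bar>" by auto
    then show ?thesis using True l_pos[OF ab] by (simp add: mult_left_mono)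
  next
    case False
    then have "?f (edge_point a b r) = 0" if "0 \<le> r" "r \<le> 1" for r
      using nuv that by (auto simp: edge_point_def doubleton_eq_iff min_def)
    then show ?thesis using st l_pos[OF ab] by simp
  qed
  finally show "\<bar>l {u, v} * ?f (edge_point a b s) - l {u, v} * ?f (edge_point a b t)\<bar> \<le> l {a, b} * \<bar>s - t\<bar>" .
qed

lemma d_pos:
  assumes x: "x \<in> points V E" and y: "y \<in> points V E" and xy: "x \<noteq> y"
  shows "0 < d x y"
proof -
  have "\<exists>v\<in>V. x v \<noteq> y v"
  proof (rule ccontr)
    assume no: "\<not> ?thesis"
    have zero: "p v = 0" if "p \<in> points V E" "v \<notin> V" for p v
      using that(1)
    proof (cases rule: points_cases)
      case (inner a b t)
      then show ?thesis using edgeD[of a b] that(2) by (auto simp: edge_point_def)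
    qed (use that in \<open>auto simp: vertex_point_def\<close>)
    then have "x v = y v" for v using zero[OF x, of v] zero[OF y, of v] no by (cases "v \<in> V") auto
    then show False using xy by blast
  qed
  then obtain v where v: "v \<in> V" "x v \<noteq> y v" by blast
  then have "0 < w v / 2 * \<bar>x v - y v\<bar>" using w_pos by simp
  then have "0 < ennreal (w v / 2 * \<bar>x v - y v\<bar>)" by (simp only: ennreal_less_zero_iff)
  also have "\<dots> \<le> d x y" using coordinate_bound[OF x y v(1)] .
  finally show ?thesis .
qed

subsection \<open>Upper bounds\<close>

lemma d_vertex_le:
  assumes p: "p \<in> points V E" and c: "p c \<noteq> 0"
  shows "p = vertex_point c \<or>
    (\<exists>b. {b, c} \<in> E \<and> b \<noteq> c \<and> supp p = {b, c} \<and> p b = 1 - p c \<and> 0 < p c \<and> p c < 1 \<and>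
         d p (vertex_point c) \<le> ennreal (l {b, c} * (1 - p c)))"
  using p
proof (cases rule: points_cases)
  case (vertex v)
  then show ?thesis using c by (auto simp: vertex_point_def split: if_splits)
next
  case (inner a b t)
  have "\<exists>a t. {a, c} \<in> E \<and> 0 < t \<and> t < 1 \<and> p = edge_point a c t"
  proof (cases "c = b")
    case False
    then have "c = a" using inner c by (auto simp: edge_point_def split: if_splits)
    then have "{b, c} \<in> E \<and> 0 < 1 - t \<and> 1 - t < 1 \<and> p = edge_point b c (1 - t)"
      using inner edge_point_swap[of a b t] by (auto simp: insert_commute)
    then show ?thesis by blast
  qed (use inner in blast)
  then obtain a t where a: "{a, c} \<in> E" "0 < t" "t < 1" "p = edge_point a c t" by blast
  have ne: "a \<noteq> c" using edgeD(3)[OF a(1)] .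
  have "d p (vertex_point c) = d (edge_point a c t) (edge_point a c 1)"
    using edge_point_ends[OF ne] a by simp
  also have "\<dots> \<le> ennreal (l {a, c} * \<bar>t - 1\<bar>)"
    using a by (intro d_edge_le) auto
  finally have "d p (vertex_point c) \<le> ennreal (l {a, c} * (1 - p c))"
    using a edge_point_apply[OF ne] by (simp add: abs_if)
  then show ?thesis using a ne edge_point_apply[OF ne] supp_edge_point[OF ne a(2,3)] by auto
qed

lemma d_edge_vertices: "{x, y} \<in> E \<Longrightarrow> d (vertex_point x) (vertex_point y) \<le> ennreal (l {x, y})"
  using d_edge_le[of x y 0 1] edge_point_ends[of x y] edgeD[of x y] by simp

text \<open>An edge costs half the weight of each of its ends. Along a path without repeated vertices
  the ends cost half their weight and the inner vertices their full weight. The induction keeps the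
  set \<open>F\<close> of all vertices reached so far, with the bound for every vertex of \<open>F\<close>: a walk that returns
  to \<open>F\<close> then needs no new estimate, and no path has to be made simple.\<close>

lemma reach_distance:
  assumes xy: "(x, y) \<in> (adj_minus V E S)\<^sup>*" and x: "x \<in> V - S"
  shows "\<exists>F. finite F \<and> F \<subseteq> V - S \<and> x \<in> F \<and> y \<in> F \<and>
    (\<forall>u\<in>F. d (vertex_point x) (vertex_point u) \<le> ennreal (sum w F - (w x + w u) / 2))"
  using xy
proof (induction rule: rtrancl_induct)
  case base
  show ?case using x d_self by (intro exI[of _ "{x}"]) auto
next
  case (step y z)
  then obtain F where F: "finite F" "F \<subseteq> V - S" "x \<in> F" "y \<in> F"
    "\<And>u. u \<in> F \<Longrightarrow> d (vertex_point x) (vertex_point u) \<le> ennreal (sum w F - (w x + w u) / 2)"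
    by blast
  have yz: "y \<in> V - S" "z \<in> V - S" "{y, z} \<in> E" using step(2) by (auto simp: adj_minus_def)
  show ?case
  proof (cases "z \<in> F")
    case True
    then show ?thesis using F by blast
  next
    case False
    have wz: "0 < w z" using w_pos yz by blast
    have wy: "(w x + w y) / 2 \<le> sum w F"
    proof (cases "x = y")
      case True
      then show ?thesis using F w_pos member_le_sum[of x F w] by (auto simp: less_imp_le subset_iff)
    next
      case False
      then have "w x + w y = sum w {x, y}" by simp
      also have "\<dots> \<le> sum w F" using F w_pos by (intro sum_mono2) (auto simp: less_imp_le subset_iff)
      finally show ?thesis using w_pos[of x] w_pos[of y] x yz by simp
    qed
    have "d (vertex_point x) (vertex_point u) \<le> ennreal (sum w (insert z F) - (w x + w u) / 2)"
      if u: "u \<in> insert z F" for u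
    proof (cases "u = z")
      case True
      have "d (vertex_point x) (vertex_point z) \<le> d (vertex_point x) (vertex_point y) + d (vertex_point y) (vertex_point z)"
        using x yz by (intro d_triangle) auto
      also have "\<dots> \<le> ennreal (sum w F - (w x + w y) / 2) + ennreal ((w y + w z) / 2)"
        using F(5)[OF F(4)] d_edge_vertices[OF yz(3)] l_eq[OF yz(3)] by (intro add_mono) auto
      also have "\<dots> = ennreal (sum w F - (w x + w y) / 2 + (w y + w z) / 2)"
        using wy wz w_pos[of y] yz by (intro ennreal_plus[symmetric]) auto
      also have "sum w F - (w x + w y) / 2 + (w y + w z) / 2 = sum w (insert z F) - (w x + w z) / 2"
        using F False by (simp add: field_simps)
      finally show ?thesis using True by simp
    next
      case False
      then have "u \<in> F" using u by simp
      then have "d (vertex_point x) (vertex_point u) \<le> ennreal (sum w F - (w x + w u) / 2)" by (rule F(5))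
      also have "\<dots> \<le> ennreal (sum w (insert z F) - (w x + w u) / 2)"
        using F \<open>z \<notin> F\<close> wz by (intro ennreal_leI) simp
      finally show ?thesis .
    qed
    then show ?thesis using F yz by (intro exI[of _ "insert z F"]) auto
  qed
qed

lemma component_diameter:
  fixes \<epsilon> :: real
  assumes tail: "\<And>F. finite F \<Longrightarrow> F \<subseteq> V - S \<Longrightarrow> sum w F \<le> \<epsilon>"
    and C: "C \<in> comps_minus V E S" and xy: "x \<in> C" "y \<in> C"
  shows "d (vertex_point x) (vertex_point y) \<le> ennreal \<epsilon>"
proof -
  have x: "x \<in> V - S" using comps_minus_subset[OF C] xy by blast
  have "(x, y) \<in> (adj_minus V E S)\<^sup>*" using comps_minus_reach[OF C xy(1)] xy(2) by blast
  from reach_distance[OF this x] obtain F where F: "finite F" "F \<subseteq> V - S" "y \<in> F"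
    and le: "\<forall>u\<in>F. d (vertex_point x) (vertex_point u) \<le> ennreal (sum w F - (w x + w u) / 2)"
    by (elim exE conjE)
  have "0 < w x" "0 < w y" using w_pos x F by auto
  then have "0 \<le> (w x + w y) / 2" by simp
  then have "sum w F - (w x + w y) / 2 \<le> \<epsilon>"
    using tail[OF F(1,2)] by (smt (verit))
  then show ?thesis using bspec[OF le F(3)] by (meson ennreal_leI order_trans)
qed

end

section \<open>The metric on points and vertex-ends\<close>

text \<open>A Cauchy sequence that represents \<open>a\<close> in the completion: a constant one, or the vertices of a ray.\<close>

definition ptseq :: "'a mpoint \<Rightarrow> nat \<Rightarrow> 'a point" where
  "ptseq a = (case a of Pt x \<Rightarrow> \<lambda>_. x | VEnd \<omega> \<Rightarrow> \<lambda>n. vertex_point ((SOME r. r \<in> \<omega>) n))"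

context weighted_graph
begin

definition mspace :: "'a mpoint set" where
  "mspace = Pt ` points V E \<union> VEnd ` vertex_ends V E"

lemma mspace_cases:
  assumes "a \<in> mspace"
  obtains (Pt) x where "x \<in> points V E" "a = Pt x" "ptseq a = (\<lambda>_. x)"
    | (VEnd) \<omega> r where "\<omega> \<in> vertex_ends V E" "a = VEnd \<omega>" "r \<in> \<omega>" "r \<in> rays V E"
        "ptseq a = (\<lambda>n. vertex_point (r n))"
proof -
  consider x where "x \<in> points V E" "a = Pt x" | \<omega> where "\<omega> \<in> vertex_ends V E" "a = VEnd \<omega>"
    using assms by (auto simp: mspace_def)
  then show ?thesis
  proof cases
    case 1
    then show ?thesis using Pt by (simp add: ptseq_def)
  next
    case 2
    have "(SOME r. r \<in> \<omega>) \<in> \<omega>" using vertex_endsD(1)[OF 2(1)] by (rule someI_ex)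
    then show ?thesis using VEnd[OF 2] vertex_endsD(2)[OF 2(1)] 2(2) by (simp add: ptseq_def)
  qed
qed

lemma ptseq_in_points: "a \<in> mspace \<Longrightarrow> ptseq a n \<in> points V E"
  by (erule mspace_cases) (auto simp: raysD(1))

sublocale ext_pseudometric "points V E" d
  by unfold_locales (auto intro: d_self d_triangle d_sym)

lemma ptseq_cauchy:
  assumes "a \<in> mspace"
  shows "ptseq a \<in> cauchy_seqs (points V E) d"
proof -
  have "\<exists>N. \<forall>m\<ge>N. \<forall>n\<ge>N. d (ptseq a m) (ptseq a n) < \<epsilon>" if \<epsilon>: "0 < \<epsilon>" for \<epsilon>
    using assms
  proof (cases rule: mspace_cases)
    case (Pt x)
    then show ?thesis using \<epsilon> by (simp add: d_self)
  next
    case (VEnd \<omega> r)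
    obtain \<epsilon>' :: real where \<epsilon>': "0 < \<epsilon>'" "ennreal \<epsilon>' < \<epsilon>" using ennreal_positive_real[OF \<epsilon>] .
    obtain S where S: "finite S" "S \<subseteq> V" "\<And>F. finite F \<Longrightarrow> F \<subseteq> V - S \<Longrightarrow> sum w F \<le> \<epsilon>'"
      using small_tail[OF \<epsilon>'(1)] by blast
    obtain C where C: "C \<in> comps_minus V E S" "eventually_in r C" using ray_component[OF VEnd(4) S(1)] .
    obtain N where N: "\<And>n. N \<le> n \<Longrightarrow> r n \<in> C"
      using C(2) unfolding eventually_in_def eventually_sequentially by blast
    have "d (ptseq a m) (ptseq a n) < \<epsilon>" if "N \<le> m" "N \<le> n" for m n
    proof -
      have "d (ptseq a m) (ptseq a n) \<le> ennreal \<epsilon>'"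
        unfolding VEnd(5) by (rule component_diameter[OF S(3) C(1)]) (use N that in auto)
      then show ?thesis using \<epsilon>'(2) by simp
    qed
    then show ?thesis by blast
  qed
  then show ?thesis using ptseq_in_points[OF assms] by (auto simp: cauchy_seqs_def)
qed

definition rho :: "'a mpoint \<Rightarrow> 'a mpoint \<Rightarrow> ennreal" where
  "rho a b = lim (\<lambda>n. d (ptseq a n) (ptseq b n))"

lemma rho_tendsto:
  assumes "a \<in> mspace" "b \<in> mspace"
  shows "(\<lambda>n. d (ptseq a n) (ptseq b n)) \<longlonglongrightarrow> rho a b"
proof -
  obtain c where "(\<lambda>n. d (ptseq a n) (ptseq b n)) \<longlonglongrightarrow> c"
    using cauchy_dist_convergent[OF ptseq_cauchy ptseq_cauchy] assms by blast
  then show ?thesis unfolding rho_def using limI by metis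
qed

lemma rho_less:
  "a \<in> mspace \<Longrightarrow> b \<in> mspace \<Longrightarrow> rho a b < \<eta> \<Longrightarrow> \<forall>\<^sub>F n in sequentially. d (ptseq a n) (ptseq b n) < \<eta>"
  using order_tendstoD(2)[OF rho_tendsto] .

lemma rho_le:
  assumes "a \<in> mspace" "b \<in> mspace" "\<forall>\<^sub>F n in sequentially. d (ptseq a n) (ptseq b n) \<le> \<eta>"
  shows "rho a b \<le> \<eta>"
  using tendsto_upperbound[OF rho_tendsto[OF assms(1,2)] assms(3)] by simp

section \<open>Open sets of MTOP are metrically open\<close>

text \<open>The common part of the proofs that stars and neighbourhoods of ends are metrically open: both are
  described by a lower bound on \<open>mass C\<close>, for \<open>C\<close> a single vertex or a component.\<close>

lemma mass_open:
  assumes \<delta>: "0 < \<delta>" "\<And>x y. x \<in> points V E \<Longrightarrow> y \<in> points V E \<Longrightarrow> ennreal (\<delta> * \<bar>mass C x - mass C y\<bar>) \<le> d x y"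
    and a: "a \<in> mspace" "\<forall>\<^sub>F n in sequentially. \<kappa>' \<le> mass C (ptseq a n)" and \<kappa>: "\<kappa> < \<kappa>'"
  shows "\<exists>\<eta>>0. \<forall>b\<in>mspace. rho a b < \<eta> \<longrightarrow> (\<forall>\<^sub>F n in sequentially. \<kappa> < mass C (ptseq b n))"
proof (intro exI conjI ballI impI)
  show "0 < ennreal (\<delta> * (\<kappa>' - \<kappa>))" using \<delta> \<kappa> by simp
  fix b assume b: "b \<in> mspace" "rho a b < ennreal (\<delta> * (\<kappa>' - \<kappa>))"
  show "\<forall>\<^sub>F n in sequentially. \<kappa> < mass C (ptseq b n)"
    using rho_less[OF a(1) b] a(2)
  proof eventually_elim
    case (elim n)
    have "ennreal (\<delta> * \<bar>mass C (ptseq a n) - mass C (ptseq b n)\<bar>) < ennreal (\<delta> * (\<kappa>' - \<kappa>))"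
      using \<delta>(2)[OF ptseq_in_points[OF a(1)] ptseq_in_points[OF b(1)]] elim(1) by (rule le_less_trans)
    then have "\<delta> * \<bar>mass C (ptseq a n) - mass C (ptseq b n)\<bar> < \<delta> * (\<kappa>' - \<kappa>)"
      using \<delta>(1) by (subst (asm) ennreal_less_iff) auto
    then have "\<bar>mass C (ptseq a n) - mass C (ptseq b n)\<bar> < \<kappa>' - \<kappa>" using \<delta>(1) by simp
    then show ?case using elim(2) by (simp add: abs_less_iff)
  qed
qed

text \<open>No vertex-end is near \<open>v\<close>, because a ray is at \<open>v\<close> at most once.\<close>

lemma star_open:
  assumes v: "v \<in> V" and \<epsilon>: "0 < \<epsilon>" "\<epsilon> < 1"
  shows "emetric_open mspace rho (Pt ` open_star V E v \<epsilon>)"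
  unfolding emetric_open_def
proof (intro conjI ballI)
  show "Pt ` open_star V E v \<epsilon> \<subseteq> mspace" by (auto simp: mspace_def open_star_def)
  fix a assume "a \<in> Pt ` open_star V E v \<epsilon>"
  then obtain x where x: "x \<in> points V E" "1 - x v < \<epsilon>" "a = Pt x" by (auto simp: open_star_def)
  have a: "a \<in> mspace" using x by (simp add: mspace_def)
  have "\<exists>\<eta>>0. \<forall>b\<in>mspace. rho a b < \<eta> \<longrightarrow> (\<forall>\<^sub>F n in sequentially. 1 - \<epsilon> < mass {v} (ptseq b n))"
  proof (rule mass_open[OF _ _ a])
    show "0 < w v / 2" using w_pos[OF v] by simp
    show "ennreal (w v / 2 * \<bar>mass {v} x - mass {v} y\<bar>) \<le> d x y"
      if "x \<in> points V E" "y \<in> points V E" for x y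
      using coordinate_bound[OF that v] that by (simp add: mass_singleton)
    show "\<forall>\<^sub>F n in sequentially. x v \<le> mass {v} (ptseq a n)"
      using x by (simp add: ptseq_def mass_singleton)
    show "1 - \<epsilon> < x v" using x by simp
  qed
  then obtain \<eta> where \<eta>: "0 < \<eta>"
    "\<And>b. b \<in> mspace \<Longrightarrow> rho a b < \<eta> \<Longrightarrow> \<forall>\<^sub>F n in sequentially. 1 - \<epsilon> < mass {v} (ptseq b n)" by blast
  have "b \<in> Pt ` open_star V E v \<epsilon>" if b: "b \<in> mspace" "rho a b < \<eta>" for b
    using b(1)
  proof (cases rule: mspace_cases)
    case (Pt y)
    then show ?thesis using \<eta>(2)[OF b] by (simp add: mass_singleton open_star_def)
  next
    case (VEnd \<omega> r)
    have "\<forall>\<^sub>F n in sequentially. r n \<notin> {v}"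
      by (rule eventually_notin_finite[OF raysD(2)[OF VEnd(4)]]) simp
    then have "\<forall>\<^sub>F n in sequentially. False"
      using \<eta>(2)[OF b] unfolding VEnd(5)
      by (rule eventually_elim2) (use \<epsilon> in auto)
    then show ?thesis by simp
  qed
  then show "\<exists>\<eta>>0. {b \<in> mspace. rho a b < \<eta>} \<subseteq> Pt ` open_star V E v \<epsilon>" using \<eta>(1) by blast
qed

text \<open>A point whose coordinates at \<open>u\<close> and at \<open>v\<close> are both positive is an inner point of the edge
  \<open>{u, v}\<close>; in particular it is not a vertex, and so no vertex of a ray.\<close>

lemma edge_interior_open:
  assumes uv: "{u, v} \<in> E" and T: "open T" "T \<subseteq> {0<..<1}"
  shows "emetric_open mspace rho (Pt ` edge_point u v ` T)"
  unfolding emetric_open_def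
proof (intro conjI ballI)
  note ne = edgeD(3)[OF uv]
  show "Pt ` edge_point u v ` T \<subseteq> mspace"
    using T(2) edge_point_in_points[OF uv] by (force simp: mspace_def)
  fix a assume "a \<in> Pt ` edge_point u v ` T"
  then obtain t where t: "t \<in> T" "a = Pt (edge_point u v t)" by blast
  have t01: "0 < t" "t < 1" using t T by auto
  let ?x = "edge_point u v t"
  have x: "?x \<in> points V E" using edge_point_in_points[OF uv] t01 by simp
  have a: "a \<in> mspace" using x t by (simp add: mspace_def)
  obtain e where e: "0 < e" "ball t e \<subseteq> T" using T(1) t(1) open_contains_ball by blast
  \<comment> \<open>Moving the coordinates by less than \<open>\<kappa>\<close> keeps them positive and the parameter in \<open>T\<close>.\<close>
  define \<kappa> where "\<kappa> = min e (min t (1 - t))"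
  define \<delta> where "\<delta> = min (w u) (w v) / 2"
  have \<kappa>: "0 < \<kappa>" "\<kappa> \<le> e" "\<kappa> \<le> t" "\<kappa> \<le> 1 - t" using e t01 by (auto simp: \<kappa>_def)
  have \<delta>: "0 < \<delta>" "\<delta> \<le> w u / 2" "\<delta> \<le> w v / 2" using w_pos edgeD[OF uv] by (auto simp: \<delta>_def)
  have near: "\<bar>?x z - y z\<bar> < \<kappa>" if "d ?x y < ennreal (\<delta> * \<kappa>)" "y \<in> points V E" "z = u \<or> z = v" for y z
  proof (rule ccontr)
    assume "\<not> \<bar>?x z - y z\<bar> < \<kappa>"
    moreover have "\<delta> \<le> w z / 2" using \<delta> that(3) by auto
    ultimately have "\<delta> * \<kappa> \<le> w z / 2 * \<bar>?x z - y z\<bar>" using \<delta>(1) \<kappa>(1) by (intro mult_mono) auto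
    then have "ennreal (\<delta> * \<kappa>) \<le> ennreal (w z / 2 * \<bar>?x z - y z\<bar>)" by (rule ennreal_leI)
    also have "\<dots> \<le> d ?x y" by (rule coordinate_bound[OF x that(2)]) (use that(3) edgeD[OF uv] in auto)
    finally show False using that(1) by simp
  qed
  have xuv: "?x u = 1 - t" "?x v = t" using edge_point_apply[OF ne] by auto
  have "b \<in> Pt ` edge_point u v ` T" if b: "b \<in> mspace" "rho a b < ennreal (\<delta> * \<kappa>)" for b
  proof -
    have ev: "\<forall>\<^sub>F n in sequentially. d ?x (ptseq b n) < ennreal (\<delta> * \<kappa>)"
      using rho_less[OF a b] t by (simp add: ptseq_def)
    then obtain n where n: "d ?x (ptseq b n) < ennreal (\<delta> * \<kappa>)"
      using eventually_happens'[OF sequentially_bot] by blast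
    let ?y = "ptseq b n"
    have y: "?y \<in> points V E" using ptseq_in_points[OF b(1)] .
    have yu: "0 < ?y u" and yv: "0 < ?y v" "\<bar>t - ?y v\<bar> < e"
      using near[OF n y, of u] near[OF n y, of v] xuv \<kappa> by auto
    have yeq: "?y = edge_point u v (?y v)"
      using y
    proof (cases rule: points_cases)
      case (vertex q)
      then show ?thesis using yu yv ne by (auto simp: vertex_point_def split: if_splits)
    next
      case (inner p q s)
      then have "u \<in> {p, q}" "v \<in> {p, q}" using yu yv by (auto simp: edge_point_def split: if_splits)
      then show ?thesis using inner ne by (auto simp: edge_point_def)
    qed
    have yT: "?y v \<in> T" using e(2) yv by (auto simp: dist_real_def)
    show ?thesis
      using b(1)
    proof (cases rule: mspace_cases)
      case (Pt z)
      then show ?thesis using yeq yT by auto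
    next
      case (VEnd \<omega> r)
      then show ?thesis using yu yv ne by (auto simp: vertex_point_def split: if_splits)
    qed
  qed
  then have "{b \<in> mspace. rho a b < ennreal (\<delta> * \<kappa>)} \<subseteq> Pt ` edge_point u v ` T" by blast
  moreover have "0 < ennreal (\<delta> * \<kappa>)" using \<delta>(1) \<kappa>(1) by simp
  ultimately show "\<exists>\<eta>>0. {b \<in> mspace. rho a b < \<eta>} \<subseteq> Pt ` edge_point u v ` T" by blast
qed

lemma end_nbhd_subset: "end_nbhd V E S \<omega> \<epsilon> \<subseteq> mspace"
  by (auto simp: end_nbhd_def mspace_def Let_def)

text \<open>The two kinds of points in the neighbourhood are treated alike by \<open>mass\<close>: it is 1 on the component
  and \<open>p c\<close> on an edge from \<open>S\<close> to a vertex \<open>c\<close> of the component. For \<open>\<epsilon> > 1\<close>, positivity excludes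
  the points that are neither in the component nor inside such an edge.\<close>

lemma Pt_in_end_nbhd:
  assumes \<omega>: "\<omega> \<in> vertex_ends V E" and S: "finite S" "S \<subseteq> V" and \<epsilon>: "0 < \<epsilon>"
    and p: "p \<in> points V E"
  shows "Pt p \<in> end_nbhd V E S \<omega> \<epsilon> \<longleftrightarrow> 0 < mass (end_comp V E S \<omega>) p \<and> 1 - \<epsilon> < mass (end_comp V E S \<omega>) p"
proof -
  obtain r where r: "r \<in> \<omega>" using vertex_endsD(1)[OF \<omega>] by blast
  define C where "C = end_comp V E S \<omega>"
  have C: "C \<in> comps_minus V E S" unfolding C_def by (rule end_comp(1)[OF \<omega> r S])
  have CS: "c \<in> C \<Longrightarrow> c \<notin> S" for c using comps_minus_subset[OF C] by blast
  have mem: "Pt p \<in> end_nbhd V E S \<omega> \<epsilon> \<longleftrightarrow>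
      supp p \<subseteq> C \<or> (\<exists>s\<in>S. \<exists>c\<in>C. {s, c} \<in> E \<and> supp p = {s, c} \<and> 1 - p c < \<epsilon>)"
    using p by (auto simp: end_nbhd_def Let_def C_def)
  have "\<dots> \<longleftrightarrow> 0 < mass C p \<and> 1 - \<epsilon> < mass C p"
    using p
  proof (cases rule: points_cases)
    case (vertex v)
    then show ?thesis using \<epsilon> CS by (auto dest: edgeD(3))
  next
    case (inner u v t)
    have supp: "supp p = {u, v}" using inner supp_edge_point by simp
    have m: "mass C p = (if u \<in> C then 1 - t else 0) + (if v \<in> C then t else 0)"
      unfolding inner(5) by (rule mass_edge_point[OF inner(2)])
    have puv: "p u = 1 - t" "p v = t" using inner edge_point_apply by auto
    have vS: "v \<in> S" if "u \<in> C" "v \<notin> C" using comps_minus_boundary[OF C that(1) inner(1) that(2)] .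
    have vu: "{v, u} \<in> E" using inner(1) by (simp add: insert_commute)
    have uS: "u \<in> S" if "v \<in> C" "u \<notin> C" using comps_minus_boundary[OF C that(1) vu that(2)] .
    have "(\<exists>s\<in>S. \<exists>c\<in>C. {s, c} \<in> E \<and> supp p = {s, c} \<and> 1 - p c < \<epsilon>) \<longleftrightarrow>
        u \<in> S \<and> v \<in> C \<and> 1 - t < \<epsilon> \<or> v \<in> S \<and> u \<in> C \<and> t < \<epsilon>" (is "?L \<longleftrightarrow> ?R")
    proof
      assume ?L
      then obtain s c where sc: "s \<in> S" "c \<in> C" "{u, v} = {s, c}" "1 - p c < \<epsilon>" unfolding supp by blast
      then consider "s = u" "c = v" | "s = v" "c = u" by (metis doubleton_eq_iff)
      then show ?R using sc puv by cases simp_all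
    next
      assume ?R
      then show ?L
      proof
        assume "u \<in> S \<and> v \<in> C \<and> 1 - t < \<epsilon>"
        then show ?L using inner(1) supp puv by (intro bexI[of _ u] bexI[of _ v]) auto
      next
        assume "v \<in> S \<and> u \<in> C \<and> t < \<epsilon>"
        then show ?L using vu supp puv by (intro bexI[of _ v] bexI[of _ u]) auto
      qed
    qed
    then show ?thesis
      using inner(3,4) \<epsilon> CS[of u] CS[of v] vS uS unfolding m supp
      by (cases "u \<in> C"; cases "v \<in> C") auto
  qed
  then show ?thesis using mem unfolding C_def by simp
qed

lemma VEnd_in_end_nbhd:
  assumes \<omega>: "\<omega> \<in> vertex_ends V E" and S: "finite S" "S \<subseteq> V"
    and \<omega>': "\<omega>' \<in> vertex_ends V E" "r \<in> \<omega>'"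
  shows "VEnd \<omega>' \<in> end_nbhd V E S \<omega> \<epsilon> \<longleftrightarrow> eventually_in r (end_comp V E S \<omega>)"
proof -
  obtain r0 where r0: "r0 \<in> \<omega>" using vertex_endsD(1)[OF \<omega>] by blast
  have "VEnd \<omega>' \<in> end_nbhd V E S \<omega> \<epsilon> \<longleftrightarrow> (\<exists>r\<in>\<omega>'. range r \<subseteq> end_comp V E S \<omega>)"
    using \<omega>'(1) by (simp add: end_nbhd_def Let_def image_iff)
  then show ?thesis
    unfolding end_ray_in_iff[OF \<omega>' S end_comp(1)[OF \<omega> r0 S]] .
qed

lemma end_nbhd_open:
  assumes \<omega>: "\<omega> \<in> vertex_ends V E" and S: "finite S" "S \<subseteq> V" and \<epsilon>: "0 < \<epsilon>"
  shows "emetric_open mspace rho (end_nbhd V E S \<omega> \<epsilon>)"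
  unfolding emetric_open_def
proof (intro conjI ballI)
  show "end_nbhd V E S \<omega> \<epsilon> \<subseteq> mspace" by (rule end_nbhd_subset)
  fix a assume aN: "a \<in> end_nbhd V E S \<omega> \<epsilon>"
  then have a: "a \<in> mspace" using end_nbhd_subset by blast
  define C where "C = end_comp V E S \<omega>"
  define \<kappa> where "\<kappa> = max 0 (1 - \<epsilon>)"
  obtain r0 where r0: "r0 \<in> \<omega>" using vertex_endsD(1)[OF \<omega>] by blast
  have C: "C \<in> comps_minus V E S" unfolding C_def by (rule end_comp(1)[OF \<omega> r0 S])
  obtain \<delta> where \<delta>: "0 < \<delta>" "\<And>x y. x \<in> points V E \<Longrightarrow> ennreal (\<delta> * \<bar>mass C x - mass C y\<bar>) \<le> d x y"
    using component_bound[OF S] C by metis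
  have "\<exists>\<kappa>'>\<kappa>. \<forall>\<^sub>F n in sequentially. \<kappa>' \<le> mass C (ptseq a n)"
    using a
  proof (cases rule: mspace_cases)
    case (Pt x)
    then show ?thesis using aN Pt_in_end_nbhd[OF \<omega> S \<epsilon> Pt(1)]
      by (intro exI[of _ "mass C x"]) (auto simp: \<kappa>_def C_def)
  next
    case (VEnd \<omega>' r)
    then have "eventually_in r C" using aN VEnd_in_end_nbhd[OF \<omega> S VEnd(1,3)] by (simp add: C_def)
    then show ?thesis using \<epsilon> unfolding VEnd(5) eventually_in_def
      by (intro exI[of _ 1]) (auto simp: \<kappa>_def elim: eventually_mono)
  qed
  then obtain \<kappa>' where "\<kappa> < \<kappa>'" "\<forall>\<^sub>F n in sequentially. \<kappa>' \<le> mass C (ptseq a n)" by blast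
  from mass_open[OF \<delta> a this(2,1)]
  obtain \<eta> where \<eta>: "0 < \<eta>"
    "\<And>b. b \<in> mspace \<Longrightarrow> rho a b < \<eta> \<Longrightarrow> \<forall>\<^sub>F n in sequentially. \<kappa> < mass C (ptseq b n)" by blast
  have "b \<in> end_nbhd V E S \<omega> \<epsilon>" if b: "b \<in> mspace" "rho a b < \<eta>" for b
    using b(1)
  proof (cases rule: mspace_cases)
    case (Pt y)
    then show ?thesis using \<eta>(2)[OF b] Pt_in_end_nbhd[OF \<omega> S \<epsilon> Pt(1)] by (simp add: \<kappa>_def C_def)
  next
    case (VEnd \<omega>' r)
    have "eventually_in r C"
      using \<eta>(2)[OF b] unfolding VEnd(5) eventually_in_def
      by (rule eventually_mono) (auto simp: \<kappa>_def split: if_splits)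
    then show ?thesis using VEnd_in_end_nbhd[OF \<omega> S VEnd(1,3)] VEnd(2) by (simp add: C_def)
  qed
  then show "\<exists>\<eta>>0. {b \<in> mspace. rho a b < \<eta>} \<subseteq> end_nbhd V E S \<omega> \<epsilon>" using \<eta>(1) by blast
qed

lemma MTOP_imp_emetric_open:
  assumes "openin (MTOP V E) U"
  shows "emetric_open mspace rho U"
proof (rule generate_topology_on_coarsest[OF istopology_emetric_open])
  show "generate_topology_on (mtop_edge_opens V E \<union>
      {Pt ` open_star V E v \<epsilon> | v \<epsilon>. v \<in> V \<and> 0 < \<epsilon> \<and> \<epsilon> < 1} \<union>
      {end_nbhd V E S \<omega> \<epsilon> | S \<omega> \<epsilon>. finite S \<and> S \<subseteq> V \<and> \<omega> \<in> vertex_ends V E \<and> 0 < \<epsilon>}) U"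
    using assms by (simp add: MTOP_def openin_topology_generated_by_iff)
qed (auto simp: mtop_edge_opens_def intro: star_open edge_interior_open end_nbhd_open)

section \<open>Metric balls contain basic open sets of MTOP\<close>

lemma MTOP_star: "v \<in> V \<Longrightarrow> 0 < \<epsilon> \<Longrightarrow> \<epsilon> < 1 \<Longrightarrow> openin (MTOP V E) (Pt ` open_star V E v \<epsilon>)"
  unfolding MTOP_def by (rule topology_generated_by_Basis) blast

lemma MTOP_edge_interior:
  "{u, v} \<in> E \<Longrightarrow> open T \<Longrightarrow> T \<subseteq> {0<..<1} \<Longrightarrow> openin (MTOP V E) (Pt ` edge_point u v ` T)"
  unfolding MTOP_def by (rule topology_generated_by_Basis) (auto simp: mtop_edge_opens_def)

lemma MTOP_end_nbhd:
  "\<omega> \<in> vertex_ends V E \<Longrightarrow> finite S \<Longrightarrow> S \<subseteq> V \<Longrightarrow> 0 < \<epsilon> \<Longrightarrow> openin (MTOP V E) (end_nbhd V E S \<omega> \<epsilon>)"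
  unfolding MTOP_def by (rule topology_generated_by_Basis) blast

lemma rho_Pt_le:
  assumes "x \<in> points V E" "y \<in> points V E" "d x y \<le> \<eta>"
  shows "rho (Pt x) (Pt y) \<le> \<eta>"
  by (rule rho_le) (use assms in \<open>auto simp: mspace_def ptseq_def\<close>)

text \<open>All edges have length at most \<open>total\<close>, which turns the radius of a star into a bound on the
  distance. For a vertex-end, \<open>S\<close> is chosen such that the component has diameter at most \<open>\<eta> / 2\<close>, and
  \<open>\<epsilon>\<close> such that the inner points near it on edges to \<open>S\<close> are within \<open>\<eta> / 2\<close> of it.\<close>

lemma ball_contains_MTOP_open:
  assumes a: "a \<in> mspace" and \<eta>: "0 < (\<eta>::real)"
  shows "\<exists>W. openin (MTOP V E) W \<and> a \<in> W \<and> W \<subseteq> mspace \<and> (\<forall>b\<in>W. rho a b \<le> ennreal \<eta>)"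
  using a
proof (cases rule: mspace_cases)
  case (Pt x)
  from Pt(1) show ?thesis
  proof (cases rule: points_cases)
    case (vertex v)
    define \<epsilon> where "\<epsilon> = min (1 / 2) (\<eta> / total)"
    have tot: "0 < total" using total_pos vertex by blast
    have \<epsilon>: "0 < \<epsilon>" "\<epsilon> < 1" "total * \<epsilon> \<le> \<eta>"
      using \<eta> tot by (auto simp: \<epsilon>_def min_def field_simps)
    have "rho a (Pt p) \<le> ennreal \<eta>" if p: "p \<in> open_star V E v \<epsilon>" for p
    proof -
      have pp: "p \<in> points V E" "1 - p v < \<epsilon>" using p by (auto simp: open_star_def)
      then have "p v \<noteq> 0" using \<epsilon>(2) by auto
      from d_vertex_le[OF pp(1) this] have "d p x \<le> ennreal \<eta>"
      proof (elim disjE exE conjE)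
        assume "p = vertex_point v"
        then show ?thesis using vertex d_self by simp
      next
        fix b assume b: "{b, v} \<in> E" "p v < 1" "d p (vertex_point v) \<le> ennreal (l {b, v} * (1 - p v))"
        have "l {b, v} * (1 - p v) \<le> total * \<epsilon>"
          using b(2) pp l_le_total[OF b(1)] tot by (intro mult_mono) auto
        then have "ennreal (l {b, v} * (1 - p v)) \<le> ennreal \<eta>" using \<epsilon>(3) by (intro ennreal_leI) simp
        then show ?thesis using b(3) vertex by (simp add: order_trans)
      qed
      then show ?thesis using rho_Pt_le[OF Pt(1) pp(1)] Pt(2) dist_len_sym[of l p x] by simp
    qed
    moreover have "a \<in> Pt ` open_star V E v \<epsilon>"
      using Pt vertex \<epsilon> by (auto simp: open_star_def vertex_point_def)
    moreover have "Pt ` open_star V E v \<epsilon> \<subseteq> mspace" by (auto simp: open_star_def mspace_def)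
    ultimately show ?thesis using MTOP_star[OF vertex(1) \<epsilon>(1,2)] by (intro exI[of _ "Pt ` open_star V E v \<epsilon>"]) auto
  next
    case (inner u v t)
    define \<kappa> where "\<kappa> = \<eta> / l {u, v}"
    have lp: "0 < l {u, v}" using l_pos inner by blast
    then have \<kappa>: "0 < \<kappa>" "l {u, v} * \<kappa> = \<eta>" using \<eta> by (auto simp: \<kappa>_def)
    define T where "T = ball t \<kappa> \<inter> {0<..<1}"
    have T: "open T" "T \<subseteq> {0<..<1}" "t \<in> T" using inner \<kappa> by (auto simp: T_def)
    have "rho a (Pt (edge_point u v s)) \<le> ennreal \<eta>" if s: "s \<in> T" for s
    proof -
      have s': "0 < s" "s < 1" "\<bar>t - s\<bar> \<le> \<kappa>" using s by (auto simp: T_def dist_real_def)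
      have "d x (edge_point u v s) \<le> ennreal (l {u, v} * \<bar>t - s\<bar>)"
        unfolding inner(5) by (rule d_edge_le) (use inner s' in auto)
      also have "\<dots> \<le> ennreal \<eta>"
        using s' lp \<kappa>(2) mult_left_mono[of "\<bar>t - s\<bar>" \<kappa> "l {u, v}"] by (intro ennreal_leI) simp
      finally show ?thesis using rho_Pt_le[OF Pt(1)] edge_point_in_points[OF inner(1)] s' Pt(2) by simp
    qed
    moreover have "Pt ` edge_point u v ` T \<subseteq> mspace"
      using T(2) edge_point_in_points[OF inner(1)] by (force simp: mspace_def)
    moreover have "a \<in> Pt ` edge_point u v ` T" using Pt(2) inner(5) T(3) by blast
    ultimately show ?thesis using MTOP_edge_interior[OF inner(1) T(1,2)]
      by (intro exI[of _ "Pt ` edge_point u v ` T"]) auto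
  qed
next
  case (VEnd \<omega> r)
  have tot: "0 < total" using total_pos raysD(1)[OF VEnd(4), of 0] by blast
  define \<epsilon> where "\<epsilon> = \<eta> / (2 * total)"
  have \<epsilon>: "0 < \<epsilon>" "total * \<epsilon> = \<eta> / 2" using \<eta> tot by (auto simp: \<epsilon>_def)
  have \<eta>2: "0 < \<eta> / 2" using \<eta> by simp
  obtain S where S: "finite S" "S \<subseteq> V" and tail: "\<And>F. finite F \<Longrightarrow> F \<subseteq> V - S \<Longrightarrow> sum w F \<le> \<eta> / 2"
    using small_tail[OF \<eta>2] by blast
  define C where "C = end_comp V E S \<omega>"
  have C: "C \<in> comps_minus V E S" "eventually_in r C"
    unfolding C_def using end_comp[OF VEnd(1,3) S] by auto
  have CV: "C \<subseteq> V - S" using comps_minus_subset[OF C(1)] .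
  have to_C: "rho a (Pt p) \<le> ennreal \<eta>"
    if p: "p \<in> points V E" and c: "c \<in> C" and pc: "d p (vertex_point c) \<le> ennreal (\<eta> / 2)" for p c
  proof (rule rho_le)
    show "\<forall>\<^sub>F n in sequentially. d (ptseq a n) (ptseq (Pt p) n) \<le> ennreal \<eta>"
      using C(2) unfolding eventually_in_def
    proof (rule eventually_mono)
      fix n assume rn: "r n \<in> C"
      have "d (vertex_point (r n)) p \<le> d (vertex_point (r n)) (vertex_point c) + d (vertex_point c) p"
        by (rule d_triangle) (use rn c CV p in auto)
      also have "\<dots> \<le> ennreal (\<eta> / 2) + ennreal (\<eta> / 2)"
        using component_diameter[OF tail C(1) rn c] pc dist_len_sym[of l p] by (intro add_mono) auto
      also have "\<dots> = ennreal \<eta>" using \<eta> by (simp add: ennreal_plus[symmetric] del: ennreal_plus)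
      finally show "d (ptseq a n) (ptseq (Pt p) n) \<le> ennreal \<eta>" unfolding VEnd(5) by (simp add: ptseq_def)
    qed
  qed (use a p in \<open>auto simp: mspace_def\<close>)
  have "rho a b \<le> ennreal \<eta>" if b: "b \<in> end_nbhd V E S \<omega> \<epsilon>" for b
  proof -
    have bm: "b \<in> mspace" using b end_nbhd_subset by blast
    then show ?thesis
    proof (cases rule: mspace_cases)
      case (Pt p)
      from b[unfolded Pt(2)] consider "supp p \<subseteq> C"
        | s c where "s \<in> S" "c \<in> C" "supp p = {s, c}" "1 - p c < \<epsilon>"
        by (auto simp: end_nbhd_def Let_def C_def)
      then show ?thesis
      proof cases
        case 1
        have "supp p \<noteq> {}"
          using Pt(1) by (cases rule: points_cases) (auto simp: supp_edge_point)
        then obtain c where c: "c \<in> supp p" by blast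
        then have "p c \<noteq> 0" by (simp add: supp_def)
        from d_vertex_le[OF Pt(1) this] have "d p (vertex_point c) \<le> ennreal (\<eta> / 2)"
        proof (elim disjE exE conjE)
          assume "p = vertex_point c"
          then show ?thesis using d_self[OF Pt(1)] by simp
        next
          fix b assume b: "{b, c} \<in> E" "b \<noteq> c" "supp p = {b, c}" "0 < p c" "p c < 1"
            "d p (vertex_point c) \<le> ennreal (l {b, c} * (1 - p c))"
          have bc: "{b, c} \<subseteq> V - S" using b(3) 1 CV by blast
          have "l {b, c} * (1 - p c) \<le> l {b, c}" using b l_pos[OF b(1)] by (intro mult_left_le) auto
          also have "\<dots> \<le> w b + w c" using l_eq[OF b(1)] w_pos[of b] w_pos[of c] bc by simp
          also have "\<dots> \<le> \<eta> / 2" using tail[of "{b, c}"] bc b(2) by simp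
          finally have "ennreal (l {b, c} * (1 - p c)) \<le> ennreal (\<eta> / 2)" by (rule ennreal_leI)
          then show ?thesis using b(6) by (rule order_trans[rotated])
        qed
        then show ?thesis using to_C[OF Pt(1)] c 1 Pt(2) by blast
      next
        case 2
        then have "p c \<noteq> 0" by (auto simp: supp_def)
        from d_vertex_le[OF Pt(1) this] have "d p (vertex_point c) \<le> ennreal (\<eta> / 2)"
        proof (elim disjE exE conjE)
          assume "p = vertex_point c"
          then show ?thesis using d_self[OF Pt(1)] by simp
        next
          fix b assume b: "{b, c} \<in> E" "p c < 1" "d p (vertex_point c) \<le> ennreal (l {b, c} * (1 - p c))"
          have "l {b, c} * (1 - p c) \<le> total * \<epsilon>"
            using b(2) 2 l_le_total[OF b(1)] tot by (intro mult_mono) auto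
          then have "ennreal (l {b, c} * (1 - p c)) \<le> ennreal (\<eta> / 2)" using \<epsilon>(2) by (intro ennreal_leI) simp
          then show ?thesis using b(3) by (rule order_trans[rotated])
        qed
        then show ?thesis using to_C[OF Pt(1) 2(2)] Pt(2) by blast
      qed
    next
      case (VEnd \<omega>' r')
      have "eventually_in r' C"
        using b VEnd_in_end_nbhd[OF \<open>\<omega> \<in> vertex_ends V E\<close> S VEnd(1,3)] VEnd(2) by (simp add: C_def)
      then have "\<forall>\<^sub>F n in sequentially. r n \<in> C \<and> r' n \<in> C"
        using C(2) unfolding eventually_in_def by (simp add: eventually_conj)
      then have "\<forall>\<^sub>F n in sequentially. d (ptseq a n) (ptseq b n) \<le> ennreal \<eta>"
      proof (rule eventually_mono)
        fix n assume n: "r n \<in> C \<and> r' n \<in> C"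
        have "d (vertex_point (r n)) (vertex_point (r' n)) \<le> ennreal (\<eta> / 2)"
          using component_diameter[OF tail C(1)] n by blast
        also have "\<dots> \<le> ennreal \<eta>" using \<eta> by (intro ennreal_leI) simp
        finally show "d (ptseq a n) (ptseq b n) \<le> ennreal \<eta>"
          unfolding VEnd(5) \<open>ptseq a = (\<lambda>n. vertex_point (r n))\<close> .
      qed
      then show ?thesis using rho_le[OF a bm] by blast
    qed
  qed
  moreover have "a \<in> end_nbhd V E S \<omega> \<epsilon>"
    unfolding VEnd(2) using VEnd_in_end_nbhd[OF VEnd(1) S VEnd(1,3)] C(2) by (simp add: C_def)
  ultimately show ?thesis using MTOP_end_nbhd[OF VEnd(1) S \<epsilon>(1)] end_nbhd_subset
    by (intro exI[of _ "end_nbhd V E S \<omega> \<epsilon>"]) auto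
qed

lemma openin_MTOP: "openin (MTOP V E) U \<longleftrightarrow> emetric_open mspace rho U"
proof
  assume U: "emetric_open mspace rho U"
  show "openin (MTOP V E) U"
  proof (subst openin_subopen, intro ballI)
    fix a assume aU: "a \<in> U"
    then obtain \<epsilon> where \<epsilon>: "0 < \<epsilon>" "{b \<in> mspace. rho a b < \<epsilon>} \<subseteq> U" and a: "a \<in> mspace"
      using U unfolding emetric_open_def by blast
    obtain \<eta> :: real where \<eta>: "0 < \<eta>" "ennreal \<eta> < \<epsilon>" using ennreal_positive_real[OF \<epsilon>(1)] .
    obtain W where W: "openin (MTOP V E) W" "a \<in> W" "W \<subseteq> mspace" "\<forall>b\<in>W. rho a b \<le> ennreal \<eta>"
      using ball_contains_MTOP_open[OF a \<eta>(1)] by blast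
    have "W \<subseteq> U" using W(3,4) \<epsilon>(2) \<eta>(2) by (force dest: le_less_trans)
    then show "\<exists>W. openin (MTOP V E) W \<and> a \<in> W \<and> W \<subseteq> U" using W by blast
  qed
qed (rule MTOP_imp_emetric_open)

end

context weighted_graph
begin

section \<open>Distinct points and vertex-ends have positive distance\<close>

lemma rho_sym: "rho a b = rho b a"
  unfolding rho_def by (subst dist_len_sym) (rule refl)

lemma rho_zero_openD:
  assumes "emetric_open mspace rho U" "a \<in> U" "b \<in> mspace" "rho a b = 0"
  shows "b \<in> U"
proof -
  obtain \<epsilon> where "0 < \<epsilon>" "{b \<in> mspace. rho a b < \<epsilon>} \<subseteq> U"
    using assms(1,2) unfolding emetric_open_def by blast
  then show ?thesis using assms(3,4) by auto
qed

text \<open>Stars and interiors of edges are metrically open and contain no vertex-end.\<close>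

lemma rho_Pt_VEnd_ne_zero:
  assumes x: "x \<in> points V E" and \<omega>: "\<omega> \<in> vertex_ends V E"
  shows "rho (Pt x) (VEnd \<omega>) \<noteq> 0"
proof
  assume z: "rho (Pt x) (VEnd \<omega>) = 0"
  have b: "VEnd \<omega> \<in> mspace" using \<omega> by (simp add: mspace_def)
  from x show False
  proof (cases rule: points_cases)
    case (vertex v)
    have "Pt x \<in> Pt ` open_star V E v (1 / 2)"
      using x vertex by (auto simp: open_star_def vertex_point_def)
    then have "VEnd \<omega> \<in> Pt ` open_star V E v (1 / 2)"
      by (rule rho_zero_openD[OF star_open[OF vertex(1)] _ b z, rotated 2]) auto
    then show False by blast
  next
    case (inner u v t)
    have "Pt x \<in> Pt ` edge_point u v ` {0<..<1}" using inner by auto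
    then have "VEnd \<omega> \<in> Pt ` edge_point u v ` {0<..<1}"
      by (rule rho_zero_openD[OF edge_interior_open[OF inner(1)] _ b z, rotated 2]) auto
    then show False by blast
  qed
qed

text \<open>Two vertex-ends at distance 0 lie in the same basic neighbourhoods, so their rays have tails in the
  same component of \<open>G - S\<close> for every finite \<open>S\<close>.\<close>

lemma rho_zero_imp_eq:
  assumes a: "a \<in> mspace" and b: "b \<in> mspace" and z: "rho a b = 0"
  shows "a = b"
  using a
proof (cases rule: mspace_cases)
  case (Pt x)
  note Px = Pt
  from b show ?thesis
  proof (cases rule: mspace_cases)
    case (Pt y)
    have "d x y = 0" using LIMSEQ_unique[OF rho_tendsto[OF a b]] z Px Pt by simp
    then show ?thesis using d_pos[OF Px(1) Pt(1)] Px Pt by force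
  next
    case (VEnd \<omega> r)
    then show ?thesis using rho_Pt_VEnd_ne_zero[OF Px(1) VEnd(1)] z Px by simp
  qed
next
  case (VEnd \<omega> r)
  note Vr = VEnd
  from b show ?thesis
  proof (cases rule: mspace_cases)
    case (Pt y)
    then show ?thesis using rho_Pt_VEnd_ne_zero[OF Pt(1) Vr(1)] z Vr rho_sym[of a b] by simp
  next
    case (VEnd \<omega>' r')
    have "(r, r') \<in> end_equiv V E"
    proof (rule end_equivI[OF Vr(4) VEnd(4)])
      fix S :: "'a set" assume S: "finite S" "S \<subseteq> V"
      note C = end_comp[OF Vr(1,3) S]
      have "a \<in> end_nbhd V E S \<omega> 1"
        unfolding Vr(2) using VEnd_in_end_nbhd[OF Vr(1) S Vr(1,3)] C(2) by blast
      then have "b \<in> end_nbhd V E S \<omega> 1"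
        by (rule rho_zero_openD[OF end_nbhd_open[OF Vr(1) S] _ b z, rotated]) simp
      then have "eventually_in r' (end_comp V E S \<omega>)"
        unfolding VEnd(2) using VEnd_in_end_nbhd[OF Vr(1) S VEnd(1,3)] by blast
      then show "\<exists>C\<in>comps_minus V E S. eventually_in r C \<and> eventually_in r' C" using C by blast
    qed
    then have "\<omega> = \<omega>'" by (rule vertex_ends_eqI[OF Vr(1) VEnd(1) Vr(3) VEnd(3)])
    then show ?thesis using Vr(2) VEnd(2) by simp
  qed
qed

section \<open>Every Cauchy sequence has a limit\<close>

lemma points_nonneg: "p \<in> points V E \<Longrightarrow> 0 \<le> p v"
  by (simp add: points_def)

lemma points_le_1:
  assumes "p \<in> points V E"
  shows "p v \<le> 1"
  using assms by (cases rule: points_cases) (auto simp: vertex_point_def edge_point_def)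

lemma coordinate_convergent:
  assumes p: "p \<in> cauchy_seqs (points V E) d" and v: "v \<in> V"
  shows "convergent (\<lambda>n. p n v)"
proof -
  have "Cauchy (\<lambda>n. p n v)"
  proof (rule metric_CauchyI)
    fix e :: real assume e: "0 < e"
    have "0 < ennreal (w v / 2 * e)" using e w_pos[OF v] by simp
    from cauchy_seqsD[OF p this] obtain N where
      N: "\<And>m n. N \<le> m \<Longrightarrow> N \<le> n \<Longrightarrow> d (p m) (p n) < ennreal (w v / 2 * e)" by blast
    have "dist (p m v) (p n v) < e" if "N \<le> m" "N \<le> n" for m n
    proof -
      have "ennreal (w v / 2 * \<bar>p m v - p n v\<bar>) < ennreal (w v / 2 * e)"
        using coordinate_bound[OF cauchy_seqs_in[OF p] cauchy_seqs_in[OF p] v] N[OF that]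
        by (rule le_less_trans)
      then have "w v / 2 * \<bar>p m v - p n v\<bar> < w v / 2 * e"
        using w_pos[OF v] by (subst (asm) ennreal_less_iff) auto
      then show ?thesis using w_pos[OF v] by (simp add: dist_real_def)
    qed
    then show "\<exists>N. \<forall>m\<ge>N. \<forall>n\<ge>N. dist (p m v) (p n v) < e" by blast
  qed
  then show ?thesis by (rule Cauchy_convergent)
qed

lemma cauchy_limit_vertex:
  assumes p: "p \<in> cauchy_seqs (points V E) d" and v: "v \<in> V" and lim: "(\<lambda>n. p n v) \<longlonglongrightarrow> 1"
  shows "(\<lambda>n. d (p n) (vertex_point v)) \<longlonglongrightarrow> 0"
proof -
  note pp = cauchy_seqs_in[OF p]
  have tot: "0 < total" using total_pos v .
  have "\<forall>\<^sub>F n in sequentially. p n v > 1 / 2" using order_tendstoD(1)[OF lim, of "1 / 2"] by simp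
  then have "\<forall>\<^sub>F n in sequentially. d (p n) (vertex_point v) \<le> ennreal (total * (1 - p n v))"
  proof (rule eventually_mono)
    fix n assume "p n v > 1 / 2"
    then have "p n v \<noteq> 0" by simp
    from d_vertex_le[OF pp this] show "d (p n) (vertex_point v) \<le> ennreal (total * (1 - p n v))"
    proof (elim disjE exE conjE)
      assume "p n = vertex_point v"
      then show ?thesis using v d_self by simp
    next
      fix b assume b: "{b, v} \<in> E" "p n v < 1" "d (p n) (vertex_point v) \<le> ennreal (l {b, v} * (1 - p n v))"
      have "ennreal (l {b, v} * (1 - p n v)) \<le> ennreal (total * (1 - p n v))"
        using b l_le_total[OF b(1)] by (intro ennreal_leI mult_right_mono) auto
      then show ?thesis using b(3) by (rule order_trans[rotated])
    qed
  qed
  moreover have "(\<lambda>n. ennreal (total * (1 - p n v))) \<longlonglongrightarrow> ennreal (total * (1 - 1))"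
    by (intro tendsto_ennrealI tendsto_mult tendsto_diff tendsto_const lim)
  then have "(\<lambda>n. ennreal (total * (1 - p n v))) \<longlonglongrightarrow> 0" by simp
  ultimately show ?thesis by (rule tendsto_sandwich[OF _ _ tendsto_const, rotated]) simp
qed

text \<open>Eventually the sequence stays on inner parts of edges at \<open>v\<close>. By \<open>inner_edge_bound\<close> it cannot
  change the edge, so it converges on that edge.\<close>

lemma cauchy_limit_inner:
  assumes p: "p \<in> cauchy_seqs (points V E) d" and v: "v \<in> V" and lim: "(\<lambda>n. p n v) \<longlonglongrightarrow> \<alpha>"
    and \<alpha>: "0 < \<alpha>" "\<alpha> < 1"
  shows "\<exists>x\<in>points V E. (\<lambda>n. d (p n) x) \<longlonglongrightarrow> 0"
proof -
  note pp = cauchy_seqs_in[OF p]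
  define \<kappa> where "\<kappa> = min (\<alpha> / 2) ((1 - \<alpha>) / 2)"
  have \<kappa>: "0 < \<kappa>" "\<kappa> < \<alpha>" "\<alpha> < 1 - \<kappa>" using \<alpha> by (auto simp: \<kappa>_def min_def field_simps)
  have "\<forall>\<^sub>F n in sequentially. \<kappa> < p n v \<and> p n v < 1 - \<kappa>"
    using order_tendstoD[OF lim] \<kappa> by (intro eventually_conj) auto
  then obtain N1 where N1: "\<And>n. N1 \<le> n \<Longrightarrow> \<kappa> < p n v \<and> p n v < 1 - \<kappa>"
    unfolding eventually_sequentially by blast
  have "0 < ennreal (w v / 2 * \<kappa>)" using w_pos[OF v] \<kappa> by simp
  from cauchy_seqsD[OF p this] obtain N2 where
    N2: "\<And>m n. N2 \<le> m \<Longrightarrow> N2 \<le> n \<Longrightarrow> d (p m) (p n) < ennreal (w v / 2 * \<kappa>)" by blast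
  define N where "N = max N1 N2"
  have onedge: "\<exists>b. {b, v} \<in> E \<and> b \<noteq> v \<and> supp (p n) = {b, v} \<and> p n b = 1 - p n v" if n: "N \<le> n" for n
  proof -
    have pn: "\<kappa> < p n v" "p n v < 1 - \<kappa>" using N1[of n] n by (auto simp: N_def)
    then have "p n v \<noteq> 0" "p n \<noteq> vertex_point v" using \<kappa> by (auto simp: vertex_point_def)
    then show ?thesis using d_vertex_le[OF pp, of n v] by blast
  qed
  obtain u where u: "{u, v} \<in> E" "u \<noteq> v" "supp (p N) = {u, v}" "p N u = 1 - p N v"
    using onedge[of N] by blast
  have same: "p n = edge_point u v (p n v)" if n: "N \<le> n" for n
  proof -
    obtain b where b: "{b, v} \<in> E" "b \<noteq> v" "supp (p n) = {b, v}" "p n b = 1 - p n v"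
      using onedge[OF n] by blast
    have "b = u"
    proof (rule ccontr)
      assume "b \<noteq> u"
      then have "p n u = 0" using b(3) u(2) by (auto simp: supp_def)
      then have m0: "min (p n u) (p n v) = 0" using points_nonneg[OF pp, of n v] by simp
      have "\<kappa> \<le> min (p N u) (p N v)" using N1[of N] u(4) by (auto simp: N_def)
      then have "w v / 2 * \<kappa> \<le> l {u, v} * min (p N u) (p N v)"
        using half_w_le_l(2)[OF u(1)] \<kappa>(1) l_pos[OF u(1)] by (intro mult_mono) auto
      then have "ennreal (w v / 2 * \<kappa>) \<le>
          ennreal \<bar>l {u, v} * min (p N u) (p N v) - l {u, v} * min (p n u) (p n v)\<bar>"
        unfolding m0 by (intro ennreal_leI) simp
      also have "\<dots> \<le> d (p N) (p n)" by (rule inner_edge_bound[OF pp u(1)])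
      finally show False using N2[of N n] n by (simp add: N_def)
    qed
    show ?thesis
    proof
      fix z show "p n z = edge_point u v (p n v) z"
        using b \<open>b = u\<close> by (auto simp: edge_point_def supp_def)
    qed
  qed
  let ?x = "edge_point u v \<alpha>"
  have "\<forall>\<^sub>F n in sequentially. d (p n) ?x \<le> ennreal (l {u, v} * \<bar>p n v - \<alpha>\<bar>)"
    unfolding eventually_sequentially
  proof (intro exI[of _ N] allI impI)
    fix n assume n: "N \<le> n"
    have "d (edge_point u v (p n v)) ?x \<le> ennreal (l {u, v} * \<bar>p n v - \<alpha>\<bar>)"
      by (rule d_edge_le[OF u(1)]) (use points_nonneg[OF pp] points_le_1[OF pp] \<alpha> in auto)
    then show "d (p n) ?x \<le> ennreal (l {u, v} * \<bar>p n v - \<alpha>\<bar>)" using same[OF n] by simp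
  qed
  moreover have "(\<lambda>n. ennreal (l {u, v} * \<bar>p n v - \<alpha>\<bar>)) \<longlonglongrightarrow> ennreal (l {u, v} * \<bar>\<alpha> - \<alpha>\<bar>)"
    by (intro tendsto_ennrealI tendsto_mult tendsto_rabs tendsto_diff tendsto_const lim)
  then have "(\<lambda>n. ennreal (l {u, v} * \<bar>p n v - \<alpha>\<bar>)) \<longlonglongrightarrow> 0" by simp
  ultimately have "(\<lambda>n. d (p n) ?x) \<longlonglongrightarrow> 0"
    by (rule tendsto_sandwich[OF _ _ tendsto_const, rotated]) simp
  moreover have "?x \<in> points V E" using edge_point_in_points[OF u(1)] \<alpha> by simp
  ultimately show ?thesis by blast
qed

text \<open>By \<open>component_bound\<close> the sequence is eventually in one component of \<open>G - S\<close>, for each finite \<open>S\<close>.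
  A ray that is eventually in all these components stays close to the sequence by
  \<open>component_diameter\<close>.\<close>

lemma vertex_sequence_limit:
  assumes c: "\<And>n. c n \<in> V" and fin: "\<And>S. finite S \<Longrightarrow> \<forall>\<^sub>F n in sequentially. c n \<notin> S"
    and cauchy: "(\<lambda>n. vertex_point (c n)) \<in> cauchy_seqs (points V E) d"
  shows "\<exists>\<omega>\<in>vertex_ends V E. (\<lambda>n. d (vertex_point (c n)) (ptseq (VEnd \<omega>) n)) \<longlonglongrightarrow> 0"
proof -
  have comp: "\<exists>C\<in>comps_minus V E S. eventually_in c C" if S: "finite S" "S \<subseteq> V" for S
  proof -
    obtain \<delta> where \<delta>: "0 < \<delta>" "\<And>C x y. C \<in> comps_minus V E S \<Longrightarrow> x \<in> points V E \<Longrightarrow>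
        ennreal (\<delta> * \<bar>mass C x - mass C y\<bar>) \<le> d x y"
      using component_bound[OF S] by metis
    obtain N1 where N1: "\<And>n. N1 \<le> n \<Longrightarrow> c n \<notin> S"
      using fin[OF S(1)] unfolding eventually_sequentially by blast
    have "0 < ennreal \<delta>" using \<delta>(1) by simp
    from cauchy_seqsD[OF cauchy this] obtain N2 where
      N2: "\<And>m n. N2 \<le> m \<Longrightarrow> N2 \<le> n \<Longrightarrow> d (vertex_point (c m)) (vertex_point (c n)) < ennreal \<delta>" by blast
    define N where "N = max N1 N2"
    define C where "C = (adj_minus V E S)\<^sup>* `` {c N}"
    have C: "C \<in> comps_minus V E S" "c N \<in> C"
      unfolding C_def using comps_minusI[of "c N" S] c N1[of N] by (auto simp: N_def)
    have "c n \<in> C" if n: "N \<le> n" for n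
    proof (rule ccontr)
      assume "c n \<notin> C"
      then have "ennreal \<delta> \<le> d (vertex_point (c N)) (vertex_point (c n))"
        using \<delta>(2)[OF C(1), of "vertex_point (c N)" "vertex_point (c n)"] c C(2) by simp
      then show False using N2[of N n] n by (simp add: N_def)
    qed
    then have "eventually_in c C" unfolding eventually_in_def eventually_sequentially by blast
    then show ?thesis using C by blast
  qed
  \<comment> \<open>An increasing sequence of finite sets that exhausts the countable set \<open>V\<close>.\<close>
  define S where "S = (\<lambda>k. {x \<in> V. to_nat_on V x < k})"
  have S: "finite (S k)" "S k \<subseteq> V" for k
  proof -
    show "S k \<subseteq> V" by (auto simp: S_def)
    have "inj_on (to_nat_on V) (S k)"
      using inj_on_to_nat_on[OF countable_V] by (rule inj_on_subset) (auto simp: S_def)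
    moreover have "to_nat_on V ` S k \<subseteq> {..<k}" by (auto simp: S_def)
    ultimately show "finite (S k)" by (meson finite_imageD finite_lessThan finite_subset)
  qed
  have "\<forall>k. \<exists>C. C \<in> comps_minus V E (S k) \<and> eventually_in c C" using comp[OF S] by metis
  then obtain C where C: "\<And>k. C k \<in> comps_minus V E (S k)" "\<And>k. eventually_in c (C k)" by metis
  have dec: "C (Suc k) \<subseteq> C k" for k
  proof
    fix y assume y: "y \<in> C (Suc k)"
    obtain n where n: "c n \<in> C k" "c n \<in> C (Suc k)" using eventually_in_meet[OF C(2) C(2)] .
    have "(c n, y) \<in> (adj_minus V E (S (Suc k)))\<^sup>*" using comps_minus_reach[OF C(1) n(2)] y by blast
    then have "(c n, y) \<in> (adj_minus V E (S k))\<^sup>*" by (rule reach_mono[rotated]) (auto simp: S_def)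
    then show "y \<in> C k" using comps_minus_reach[OF C(1) n(1)] by blast
  qed
  have ex: "\<exists>k. x \<in> S k" if "x \<in> V" for x
    using that by (intro exI[of _ "Suc (to_nat_on V x)"]) (simp add: S_def)
  obtain r where r: "r \<in> rays V E" "\<And>k. eventually_in r (C k)"
    using ray_through_components[of C S, OF C(1) dec ex] by blast
  define \<omega> where "\<omega> = end_equiv V E `` {r}"
  have \<omega>: "\<omega> \<in> vertex_ends V E" using r(1) by (simp add: \<omega>_def vertex_ends_def quotientI)
  have "VEnd \<omega> \<in> mspace" using \<omega> by (simp add: mspace_def)
  then obtain r' where r': "r' \<in> \<omega>" "ptseq (VEnd \<omega>) = (\<lambda>n. vertex_point (r' n))"
    by (cases rule: mspace_cases) auto
  have rr: "(r, r') \<in> end_equiv V E" using r'(1) by (simp add: \<omega>_def)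
  have "(\<lambda>n. d (vertex_point (c n)) (ptseq (VEnd \<omega>) n)) \<longlonglongrightarrow> 0"
  proof (rule tendsto_zero_ennrealI)
    fix \<epsilon> :: real assume "0 < \<epsilon>"
    then obtain T where T: "finite T" "T \<subseteq> V" and tail: "\<And>F. finite F \<Longrightarrow> F \<subseteq> V - T \<Longrightarrow> sum w F \<le> \<epsilon>"
      using small_tail by blast
    define k where "k = Suc (Max (insert 0 (to_nat_on V ` T)))"
    have "T \<subseteq> S k"
    proof
      fix x assume x: "x \<in> T"
      then have "to_nat_on V x \<le> Max (insert 0 (to_nat_on V ` T))" using T(1) by (intro Max_ge) auto
      then show "x \<in> S k" using x T(2) by (auto simp: S_def k_def)
    qed
    then have tail': "sum w F \<le> \<epsilon>" if "finite F" "F \<subseteq> V - S k" for F using tail[of F] that by blast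
    have "eventually_in r' (C k)" by (rule end_equiv_same_component[OF rr S C(1) r(2)])
    then have "\<forall>\<^sub>F n in sequentially. c n \<in> C k \<and> r' n \<in> C k"
      using C(2)[of k] unfolding eventually_in_def by (simp add: eventually_conj)
    then show "\<forall>\<^sub>F n in sequentially. d (vertex_point (c n)) (ptseq (VEnd \<omega>) n) \<le> ennreal \<epsilon>"
      unfolding r'(2) by (rule eventually_mono) (use component_diameter[OF tail' C(1)] in blast)
  qed
  then show ?thesis using \<omega> by blast
qed

text \<open>Each point of the sequence is moved to the end \<open>c n\<close> of its edge with the larger coordinate. The
  distance tends to 0: either both ends of the edge are outside a given finite set \<open>S\<close> and the edge is
  short, or the other end is in \<open>S\<close> and has small coordinate.\<close>

lemma cauchy_limit_end:
  assumes p: "p \<in> cauchy_seqs (points V E) d" and zero: "\<And>v. v \<in> V \<Longrightarrow> (\<lambda>n. p n v) \<longlonglongrightarrow> 0"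
  shows "\<exists>\<omega>\<in>vertex_ends V E. (\<lambda>n. d (p n) (ptseq (VEnd \<omega>) n)) \<longlonglongrightarrow> 0"
proof -
  note pp = cauchy_seqs_in[OF p]
  have "\<exists>c\<in>V. 1 / 2 \<le> q c" if "q \<in> points V E" for q
    using that
  proof (cases rule: points_cases)
    case (vertex v)
    then show ?thesis by (intro bexI[of _ v]) (auto simp: vertex_point_def)
  next
    case (inner u v t)
    have "q u = 1 - t" "q v = t" using inner edge_point_apply[of u v t] by auto
    then have "1 / 2 \<le> q u \<or> 1 / 2 \<le> q v" by auto
    then show ?thesis using edgeD[OF inner(1)] by blast
  qed
  then have "\<forall>n. \<exists>c. c \<in> V \<and> 1 / 2 \<le> p n c" using pp by blast
  then obtain c where c: "\<And>n. c n \<in> V" "\<And>n. 1 / 2 \<le> p n (c n)" by metis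
  have small: "\<forall>\<^sub>F n in sequentially. \<forall>s\<in>S. p n s < \<epsilon>" if "finite S" "S \<subseteq> V" "0 < \<epsilon>" for S and \<epsilon> :: real
    using that(1,2)
  proof induction
    case (insert s S)
    have "\<forall>\<^sub>F n in sequentially. p n s < \<epsilon>" using order_tendstoD(2)[OF zero that(3)] insert by blast
    moreover have "\<forall>\<^sub>F n in sequentially. \<forall>s\<in>S. p n s < \<epsilon>" using insert by blast
    ultimately show ?case by eventually_elim auto
  qed simp
  have fin: "\<forall>\<^sub>F n in sequentially. c n \<notin> S" if S: "finite S" for S
  proof -
    have "\<forall>\<^sub>F n in sequentially. \<forall>s\<in>S \<inter> V. p n s < 1 / 2" using S by (intro small) auto
    then show ?thesis
    proof (rule eventually_mono)
      fix n assume "\<forall>s\<in>S \<inter> V. p n s < 1 / 2"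
      then show "c n \<notin> S" using c[of n] by force
    qed
  qed
  have tot: "0 < total" using total_pos c(1) by blast
  have near: "(\<lambda>n. d (p n) (vertex_point (c n))) \<longlonglongrightarrow> 0"
  proof (rule tendsto_zero_ennrealI)
    fix \<epsilon> :: real assume \<epsilon>: "0 < \<epsilon>"
    obtain S where S: "finite S" "S \<subseteq> V" and tail: "\<And>F. finite F \<Longrightarrow> F \<subseteq> V - S \<Longrightarrow> sum w F \<le> \<epsilon>"
      using small_tail[OF \<epsilon>] by blast
    have "0 < \<epsilon> / total" using \<epsilon> tot by simp
    from eventually_conj[OF small[OF S this] fin[OF S(1)]]
    show "\<forall>\<^sub>F n in sequentially. d (p n) (vertex_point (c n)) \<le> ennreal \<epsilon>"
    proof (rule eventually_mono, elim conjE)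
      fix n assume n: "\<forall>s\<in>S. p n s < \<epsilon> / total" "c n \<notin> S"
      have "p n (c n) \<noteq> 0" using c(2)[of n] by auto
      from d_vertex_le[OF pp this] show "d (p n) (vertex_point (c n)) \<le> ennreal \<epsilon>"
      proof (elim disjE exE conjE)
        assume "p n = vertex_point (c n)"
        then show ?thesis using d_self[OF pp[of n]] by simp
      next
        fix b assume b: "{b, c n} \<in> E" "b \<noteq> c n" "p n b = 1 - p n (c n)" "0 < p n (c n)" "p n (c n) < 1"
          "d (p n) (vertex_point (c n)) \<le> ennreal (l {b, c n} * (1 - p n (c n)))"
        have bV: "b \<in> V" using edgeD[OF b(1)] by blast
        have "l {b, c n} * (1 - p n (c n)) \<le> \<epsilon>"
        proof (cases "b \<in> S")
          case True
          then have "1 - p n (c n) \<le> \<epsilon> / total" using n(1) b(3) by auto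
          then have "l {b, c n} * (1 - p n (c n)) \<le> total * (\<epsilon> / total)"
            using l_le_total[OF b(1)] tot b(5) by (intro mult_mono) auto
          then show ?thesis using tot by simp
        next
          case False
          have "l {b, c n} * (1 - p n (c n)) \<le> l {b, c n}"
            using b(4,5) l_pos[OF b(1)] by (intro mult_left_le) auto
          also have "\<dots> \<le> w b + w (c n)" using l_eq[OF b(1)] w_pos[OF bV] w_pos[OF c(1)[of n]] by simp
          also have "\<dots> \<le> \<epsilon>" using tail[of "{b, c n}"] b(2) bV c(1) n(2) False by simp
          finally show ?thesis .
        qed
        then show ?thesis using b(6) by (meson ennreal_leI order_trans)
      qed
    qed
  qed
  have cp: "vertex_point (c n) \<in> points V E" for n using c(1) by simp
  have "(\<lambda>n. vertex_point (c n)) \<in> cauchy_seqs (points V E) d"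
  proof -
    have "\<exists>N. \<forall>m\<ge>N. \<forall>n\<ge>N. d (vertex_point (c m)) (vertex_point (c n)) < \<epsilon>" if \<epsilon>: "0 < \<epsilon>" for \<epsilon>
    proof -
      obtain \<epsilon>' :: real where \<epsilon>': "0 < \<epsilon>'" "ennreal \<epsilon>' < \<epsilon>" using ennreal_positive_real[OF \<epsilon>] .
      have e3: "0 < ennreal (\<epsilon>' / 3)" using \<epsilon>' by simp
      obtain N1 where N1: "\<And>n. N1 \<le> n \<Longrightarrow> d (p n) (vertex_point (c n)) < ennreal (\<epsilon>' / 3)"
        using order_tendstoD(2)[OF near e3] unfolding eventually_sequentially by blast
      obtain N2 where N2: "\<And>m n. N2 \<le> m \<Longrightarrow> N2 \<le> n \<Longrightarrow> d (p m) (p n) < ennreal (\<epsilon>' / 3)"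
        using cauchy_seqsD[OF p e3] by blast
      have "d (vertex_point (c m)) (vertex_point (c n)) < \<epsilon>" if mn: "max N1 N2 \<le> m" "max N1 N2 \<le> n" for m n
      proof -
        have "d (vertex_point (c m)) (vertex_point (c n)) \<le>
            d (vertex_point (c m)) (p m) + (d (p m) (p n) + d (p n) (vertex_point (c n)))"
          using d_triangle[OF cp[of m] pp[of m] cp[of n]] d_triangle[OF pp[of m] pp[of n] cp[of n]]
          by (meson add_left_mono order_trans)
        also have "\<dots> \<le> ennreal (\<epsilon>' / 3) + (ennreal (\<epsilon>' / 3) + ennreal (\<epsilon>' / 3))"
          using N1[of m] N1[of n] N2[of m n] mn dist_len_sym[of l "p m"]
          by (intro add_mono) (auto simp: less_imp_le)
        also have "\<dots> = ennreal \<epsilon>'"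
          using \<epsilon>'(1) by (simp add: ennreal_plus[symmetric] del: ennreal_plus)
        finally show ?thesis using \<epsilon>'(2) by simp
      qed
      then show ?thesis by blast
    qed
    then show ?thesis using cp by (auto simp: cauchy_seqs_def)
  qed
  then obtain \<omega> where \<omega>: "\<omega> \<in> vertex_ends V E"
    "(\<lambda>n. d (vertex_point (c n)) (ptseq (VEnd \<omega>) n)) \<longlonglongrightarrow> 0"
    using vertex_sequence_limit[OF c(1) fin] by blast
  have mem: "ptseq (VEnd \<omega>) n \<in> points V E" for n
    using \<omega>(1) by (intro ptseq_in_points) (simp add: mspace_def)
  have "(\<lambda>n. d (p n) (vertex_point (c n)) + d (vertex_point (c n)) (ptseq (VEnd \<omega>) n)) \<longlonglongrightarrow> 0"
    using tendsto_add[OF near \<omega>(2)] by simp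
  then have "(\<lambda>n. d (p n) (ptseq (VEnd \<omega>) n)) \<longlonglongrightarrow> 0"
    by (rule tendsto_sandwich[OF _ _ tendsto_const, rotated 2])
      (auto intro!: always_eventually d_triangle pp cp mem)
  then show ?thesis using \<omega>(1) by blast
qed

lemma cauchy_has_limit:
  assumes p: "p \<in> cauchy_seqs (points V E) d"
  shows "\<exists>a\<in>mspace. (\<lambda>n. d (p n) (ptseq a n)) \<longlonglongrightarrow> 0"
proof -
  note pp = cauchy_seqs_in[OF p]
  have "\<forall>v\<in>V. \<exists>\<alpha>. (\<lambda>n. p n v) \<longlonglongrightarrow> \<alpha>" using coordinate_convergent[OF p] unfolding convergent_def by blast
  then obtain \<alpha> where \<alpha>: "\<And>v. v \<in> V \<Longrightarrow> (\<lambda>n. p n v) \<longlonglongrightarrow> \<alpha> v" by metis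
  show ?thesis
  proof (cases "\<forall>v\<in>V. \<alpha> v = 0")
    case True
    then have "\<And>v. v \<in> V \<Longrightarrow> (\<lambda>n. p n v) \<longlonglongrightarrow> 0" using \<alpha> by metis
    then show ?thesis using cauchy_limit_end[OF p] by (auto simp: mspace_def)
  next
    case False
    then obtain v where v: "v \<in> V" "\<alpha> v \<noteq> 0" by blast
    have "0 \<le> \<alpha> v" by (rule LIMSEQ_le_const[OF \<alpha>[OF v(1)]]) (use points_nonneg[OF pp] in auto)
    moreover have "\<alpha> v \<le> 1" by (rule LIMSEQ_le_const2[OF \<alpha>[OF v(1)]]) (use points_le_1[OF pp] in auto)
    ultimately consider "\<alpha> v = 1" | "0 < \<alpha> v" "\<alpha> v < 1" using v(2) by linarith
    then have "\<exists>x\<in>points V E. (\<lambda>n. d (p n) x) \<longlonglongrightarrow> 0"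
    proof cases
      case 1
      then have "(\<lambda>n. d (p n) (vertex_point v)) \<longlonglongrightarrow> 0"
        using cauchy_limit_vertex[OF p v(1)] \<alpha>[OF v(1)] by simp
      then show ?thesis using v(1) by (intro bexI[of _ "vertex_point v"]) auto
    next
      case 2
      then show ?thesis using cauchy_limit_inner[OF p v(1) \<alpha>[OF v(1)]] by blast
    qed
    then obtain x where "x \<in> points V E" "(\<lambda>n. d (p n) x) \<longlonglongrightarrow> 0" by blast
    then show ?thesis by (intro bexI[of _ "Pt x"]) (auto simp: mspace_def ptseq_def)
  qed
qed

section \<open>The homeomorphism\<close>

text \<open>Distinct points have positive distance, so no vertices are identified.\<close>

lemma vertex_ident_class: "x \<in> points V E \<Longrightarrow> vertex_ident V E l `` {x} = {x}"
  using d_pos by (force simp: vertex_ident_def d_self)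

lemma Gbar_eq: "Gbar V E l = (\<lambda>x. {x}) ` points V E"
  unfolding Gbar_def quotient_def using vertex_ident_class by auto

lemma Gbar_dist_singleton: "Gbar_dist V E l {x} {y} = d x y"
  by (simp add: Gbar_dist_def)

lemma Gbar_pseudometric: "ext_pseudometric (Gbar V E l) (Gbar_dist V E l)"
  by unfold_locales (auto simp: Gbar_eq Gbar_dist_singleton d_self dist_len_sym intro: d_triangle)

lemma cauchy_seqs_Gbar:
  "(\<lambda>n. {p n}) \<in> cauchy_seqs (Gbar V E l) (Gbar_dist V E l) \<longleftrightarrow> p \<in> cauchy_seqs (points V E) d"
  by (auto simp: cauchy_seqs_def Gbar_eq Gbar_dist_singleton image_subset_iff)

lemma homeomorphic_len_space_MTOP:
  "\<exists>h. homeomorphic_map (len_space V E l) (MTOP V E) h \<and> (\<forall>x\<in>points V E. h (len_embed V E l x) = Pt x)"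
proof -
  let ?M = "Gbar V E l" and ?D = "Gbar_dist V E l"
  interpret G: ext_pseudometric ?M ?D by (rule Gbar_pseudometric)
  define rep :: "'a mpoint \<Rightarrow> nat \<Rightarrow> 'a point set" where "rep = (\<lambda>a n. {ptseq a n})"
  have rep: "rep a \<in> cauchy_seqs ?M ?D" if "a \<in> mspace" for a
    unfolding rep_def cauchy_seqs_Gbar using ptseq_cauchy[OF that] .
  have rep_equiv: "(rep a, rep b) \<in> cauchy_equiv ?M ?D \<longleftrightarrow> (\<lambda>n. d (ptseq a n) (ptseq b n)) \<longlonglongrightarrow> 0"
    if "a \<in> mspace" "b \<in> mspace" for a b
    using rep that by (simp add: cauchy_equiv_def) (simp add: rep_def Gbar_dist_singleton)
  have dist_eq: "completion_dist ?D (cauchy_equiv ?M ?D `` {rep a}) (cauchy_equiv ?M ?D `` {rep b}) = rho a b"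
    if "a \<in> mspace" "b \<in> mspace" for a b
    using G.completion_dist_tendsto[OF rep[OF that(1)] rep[OF that(2)]] rho_tendsto[OF that]
    by (simp add: rep_def Gbar_dist_singleton LIMSEQ_unique)
  have "\<exists>h. homeomorphic_map (emetric_top (completion ?M ?D) (completion_dist ?D)) (MTOP V E) h \<and>
      (\<forall>a\<in>mspace. h (cauchy_equiv ?M ?D `` {rep a}) = a)"
  proof (rule G.homeomorphic_completion[OF rep])
    fix a b assume ab: "a \<in> mspace" "b \<in> mspace" "(rep a, rep b) \<in> cauchy_equiv ?M ?D"
    then have "(\<lambda>n. d (ptseq a n) (ptseq b n)) \<longlonglongrightarrow> 0" using rep_equiv[OF ab(1,2)] by simp
    then have "rho a b = 0" by (rule LIMSEQ_unique[OF rho_tendsto[OF ab(1,2)]])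
    then show "a = b" using rho_zero_imp_eq ab by blast
  next
    fix s assume s: "s \<in> cauchy_seqs ?M ?D"
    define p where "p = (\<lambda>n. the_elem (s n))"
    have sp: "s = (\<lambda>n. {p n})"
    proof
      fix n
      have "s n \<in> ?M" using G.cauchy_seqs_in[OF s] .
      then obtain x where "s n = {x}" unfolding Gbar_eq by blast
      then show "s n = {p n}" by (simp add: p_def)
    qed
    then have p: "p \<in> cauchy_seqs (points V E) d" using s cauchy_seqs_Gbar by simp
    obtain a where a: "a \<in> mspace" "(\<lambda>n. d (p n) (ptseq a n)) \<longlonglongrightarrow> 0" using cauchy_has_limit[OF p] by blast
    then have "(s, rep a) \<in> cauchy_equiv ?M ?D"
      using s rep[OF a(1)] by (simp add: cauchy_equiv_def) (simp add: sp rep_def Gbar_dist_singleton)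
    then show "\<exists>a\<in>mspace. (s, rep a) \<in> cauchy_equiv ?M ?D" using a(1) by blast
  next
    fix U
    show "openin (MTOP V E) U \<longleftrightarrow> emetric_open mspace
        (\<lambda>a b. completion_dist ?D (cauchy_equiv ?M ?D `` {rep a}) (cauchy_equiv ?M ?D `` {rep b})) U"
      unfolding openin_MTOP emetric_open_def
    proof (rule conj_cong[OF refl], rule ball_cong[OF refl])
      fix a assume "U \<subseteq> mspace" "a \<in> U"
      then have "{b \<in> mspace. completion_dist ?D (cauchy_equiv ?M ?D `` {rep a}) (cauchy_equiv ?M ?D `` {rep b}) < \<epsilon>} =
          {b \<in> mspace. rho a b < \<epsilon>}" for \<epsilon> using dist_eq by auto
      then show "(\<exists>\<epsilon>>0. {b \<in> mspace. rho a b < \<epsilon>} \<subseteq> U) \<longleftrightarrow> (\<exists>\<epsilon>>0. {b \<in> mspace. completion_dist ?D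
          (cauchy_equiv ?M ?D `` {rep a}) (cauchy_equiv ?M ?D `` {rep b}) < \<epsilon>} \<subseteq> U)" by simp
    qed
  qed
  then obtain h where h: "homeomorphic_map (emetric_top (completion ?M ?D) (completion_dist ?D)) (MTOP V E) h"
    "\<And>a. a \<in> mspace \<Longrightarrow> h (cauchy_equiv ?M ?D `` {rep a}) = a" by blast
  have "h (len_embed V E l x) = Pt x" if x: "x \<in> points V E" for x
    using h(2)[of "Pt x"] x
    by (simp add: len_embed_def completion_embed_def vertex_ident_class rep_def ptseq_def mspace_def)
  then show ?thesis using h(1) unfolding len_space_def by blast
qed

end

theorem corollary3p5:
  fixes V :: "'a set" and E :: "'a set set"
    and I :: "nat set" and v :: "nat \<Rightarrow> 'a"
    and l :: "nat \<Rightarrow> real" and l' :: "'a set \<Rightarrow> real"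
  assumes "ugraph V E"
    and "I = UNIV \<or> (\<exists>n. I = {..<n})"
    and "bij_betw v I V"
    and "\<And>i. 0 < l i"
    and "summable l"
    and "\<And>i j. i \<in> I \<Longrightarrow> j \<in> I \<Longrightarrow> {v i, v j} \<in> E \<Longrightarrow> l' {v i, v j} = (l i + l j) / 2"
  shows "\<exists>h. homeomorphic_map (len_space V E l') (MTOP V E) h \<and>
             (\<forall>x\<in>points V E. h (len_embed V E l' x) = Pt x)"
proof -
  define w where "w = (\<lambda>x. l (inv_into I v x))"
  have w: "w (v i) = l i" if "i \<in> I" for i
    using assms(3) that by (simp add: w_def bij_betw_def)
  have "l summable_on UNIV"
    using assms(4,5) by (simp add: summable_on_UNIV_nonneg_real_iff less_imp_le)
  then have "l summable_on I" by (rule summable_on_subset_banach) simp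
  then have "(\<lambda>i. w (v i)) summable_on I" using w by (simp cong: summable_on_cong)
  then have sum: "w summable_on V" using summable_on_reindex_bij_betw[OF assms(3)] by blast
  interpret weighted_graph V E w l'
  proof
    show "ugraph V E" by (rule assms(1))
    show "0 < w x" for x using assms(4) by (simp add: w_def)
    show "w summable_on V" by (rule sum)
    fix x y assume xy: "{x, y} \<in> E"
    then have "x \<in> V" "y \<in> V" using assms(1) by (auto simp: ugraph_def)
    then obtain i j where "i \<in> I" "j \<in> I" "x = v i" "y = v j" using assms(3) by (auto simp: bij_betw_def)
    then show "l' {x, y} = (w x + w y) / 2" using assms(6) xy w by simp
  qed
  show ?thesis by (rule homeomorphic_len_space_MTOP)
qed

end
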